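(* Let $(H,A,\gamma)$ be a Dirac system with constant coefficients. Let $\Lambda$ be a real number and let $$H_{\le\Lambda}=E\oplus U\quad\text{and}\quad H_{<-\Lambda}=F\oplus V$$ be orthogonal decompositions, where $E\subset H^{1/2}_{\le\Lambda}$ and $F\subset H^{1/2}_{<-\Lambda}$ are finite-dimensional subspaces, and let $g:U\to V$ be a $1/2$-smooth linear map. Then $$B=\gamma F\oplus\{u+\gamma gu : u\in U\cap H^{1/2}\}$$ is an elliptic boundary condition with $$B^a=\gamma E\oplus\{v+\gamma g^*v : v\in V\cap H^{1/2}\}.$$ All elliptic boundary conditions arise in this way.
   Context: A Dirac system with constant coefficients is a triple $(H,A,\gamma)$: $H$ is a separable complex Hilbert space with inner product $\langle\cdot,\cdot\rangle$; $A$ is a self-adjoint operator in $H$ with domain $H_A$ such that $H_A\to H$ is compact for the graph norm; $\gamma$ is a bounded operator on $H$, restricting to a bounded operator on $H_A$, with $-\gamma=\gamma^*=\gamma^{-1}$ on $H$ and $A\gamma+\gamma A=0$ on $H_A$. For $s\ge0$ let $H^s$ be the domain of $|A|^s$ with norm $\|x\|_s=\|(I+A^2)^{s/2}x\|$; for $s<0$ let $H^s$ be the completion of $\bigcap_{r\ge0}H^r$ in $\|\cdot\|_s$. The spaces $H^s$ and $H^{-s}$ are dually paired by $B_s(x,y)=\langle(I+A^2)^{s/2}x,(I+A^2)^{-s/2}y\rangle$. For $J\subset\mathbb{R}$ let $Q_J$ be the spectral projection of $A$, $H^s_J=Q_J(H^s)$, $H_J=Q_J(H)$; subscripts $\le\Lambda$,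 $<-\Lambda$ mean $J=(-\infty,\Lambda]$, $J=(-\infty,-\Lambda)$. Put $\check H=H^{1/2}_{(-\infty,0]}\oplus H^{-1/2}_{(0,\infty)}$ with its Hilbert sum norm. On $\check H$ consider the non-degenerate form $\omega(x,y)=B_{1/2}(Q_{(-\infty,0]}x,\gamma Q_{[0,\infty)}y)+B_{-1/2}(Q_{(0,\infty)}x,\gamma Q_{(-\infty,0)}y)$, which extends $\langle x,\gamma y\rangle$. A boundary condition is a closed linear subspace $B\subset\check H$; $B^a=\{y\in\check H:\omega(x,y)=0\ \forall x\in B\}$. $B$ is regular if $B\subset H^{1/2}$, elliptic if both $B$ and $B^a$ are regular. A bounded linear map $g:U\to V$ between closed subspaces of $H$, with adjoint $g^*:V\to U$, is $1/2$-smooth if $g(U\cap H^{1/2})\subset V\cap H^{1/2}$ and $g^*(V\cap H^{1/2})\subset U\cap H^{1/2}$. *)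

theory Defs
  imports "HOL-Analysis.Analysis"
begin

section \<open>Complex Hilbert spaces\<close>

text \<open>
  A complex Hilbert space is a complete real inner product space together with a complex
  scalar multiplication and a complex inner product (linear in the first argument) that
  induce the given real structure; in particular \<open>cinner x x = (norm x)\<^sup>2\<close>.
\<close>

class chilbert_space = real_inner + complete_space +
  fixes scaleC :: "complex \<Rightarrow> 'a \<Rightarrow> 'a"  (infixr "*\<^sub>C" 75)
    and cinner :: "'a \<Rightarrow> 'a \<Rightarrow> complex"
  assumes scaleC_add_right: "c *\<^sub>C (x + y) = c *\<^sub>C x + c *\<^sub>C y"
    and scaleC_add_left: "(c + d) *\<^sub>C x = c *\<^sub>C x + d *\<^sub>C x"
    and scaleC_scaleC: "c *\<^sub>C (d *\<^sub>C x) = (c * d) *\<^sub>C x"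
    and scaleR_scaleC: "r *\<^sub>R x = complex_of_real r *\<^sub>C x"
    and cinner_commute: "cinner x y = cnj (cinner y x)"
    and cinner_add_left: "cinner (x + y) z = cinner x z + cinner y z"
    and cinner_scaleC_left: "cinner (c *\<^sub>C x) y = c * cinner x y"
    and inner_eq_Re_cinner: "inner x y = Re (cinner x y)"

interpretation cvec: vector_space "scaleC :: complex \<Rightarrow> 'a \<Rightarrow> 'a::chilbert_space"
proof
  fix x :: 'a
  show "1 *\<^sub>C x = x"
    using scaleR_scaleC[of 1 x] by simp
qed (simp_all add: scaleC_add_right scaleC_add_left scaleC_scaleC)

definition clinear_on :: "'a::chilbert_space set \<Rightarrow> ('a \<Rightarrow> 'a) \<Rightarrow> bool" where
  "clinear_on S f \<longleftrightarrow>
     (\<forall>x\<in>S. \<forall>y\<in>S. f (x + y) = f x + f y) \<and> (\<forall>c. \<forall>x\<in>S. f (c *\<^sub>C x) = c *\<^sub>C f x)"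

definition bounded_clinear_between ::
    "'a::chilbert_space set \<Rightarrow> 'a set \<Rightarrow> ('a \<Rightarrow> 'a) \<Rightarrow> bool" where
  "bounded_clinear_between U V g \<longleftrightarrow>
     clinear_on U g \<and> g ` U \<subseteq> V \<and> (\<exists>K. \<forall>u\<in>U. norm (g u) \<le> K * norm u)"

definition orth_proj :: "'a::chilbert_space set \<Rightarrow> 'a \<Rightarrow> 'a" where
  "orth_proj M x = (THE y. y \<in> M \<and> (\<forall>z\<in>M. cinner (x - y) z = 0))"

text \<open>The adjoint \<open>V \<rightarrow> U\<close> of a bounded map \<open>U \<rightarrow> V\<close> between closed subspaces.\<close>

definition adjoint_between ::
    "'a::chilbert_space set \<Rightarrow> ('a \<Rightarrow> 'a) \<Rightarrow> 'a \<Rightarrow> 'a" where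
  "adjoint_between U g v = (THE u. u \<in> U \<and> (\<forall>x\<in>U. cinner (g x) v = cinner x u))"

definition finite_dim :: "'a::chilbert_space set \<Rightarrow> bool" where
  "finite_dim M \<longleftrightarrow> (\<exists>b. finite b \<and> M = cvec.span b)"

definition orth_decomp :: "'a::chilbert_space set \<Rightarrow> 'a set \<Rightarrow> 'a set \<Rightarrow> bool" where
  "orth_decomp M E U \<longleftrightarrow>
     cvec.subspace E \<and> cvec.subspace U \<and> (\<forall>e\<in>E. \<forall>u\<in>U. cinner e u = 0) \<and>
     M = {e + u | e u. e \<in> E \<and> u \<in> U}"

text \<open>Self-adjointness of an unbounded operator \<open>A\<close> with domain \<open>D\<close>: it is densely defined,
  symmetric, and the domain of its adjoint is contained in \<open>D\<close>.\<close>

definition self_adjoint :: "'a::chilbert_space set \<Rightarrow> ('a \<Rightarrow> 'a) \<Rightarrow> bool" where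
  "self_adjoint D A \<longleftrightarrow>
     cvec.subspace D \<and> closure D = UNIV \<and> clinear_on D A \<and>
     (\<forall>x\<in>D. \<forall>y\<in>D. cinner (A x) y = cinner x (A y)) \<and>
     {y. \<exists>z. \<forall>x\<in>D. cinner (A x) y = cinner x z} \<subseteq> D"

definition graph_norm :: "('a::chilbert_space \<Rightarrow> 'a) \<Rightarrow> 'a \<Rightarrow> real" where
  "graph_norm A x = sqrt ((norm x)\<^sup>2 + (norm (A x))\<^sup>2)"


section \<open>Dirac systems with constant coefficients\<close>

locale dirac_system =
  fixes D :: "'a::chilbert_space set" and A :: "'a \<Rightarrow> 'a" and \<gamma> :: "'a \<Rightarrow> 'a"
  assumes separable: "\<exists>S :: 'a set. countable S \<and> closure S = UNIV"
    and A_self_adjoint: "self_adjoint D A"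
    and compact_embedding: "compact (closure {x \<in> D. graph_norm A x \<le> 1})"
    and \<gamma>_bounded: "bounded_clinear_between UNIV UNIV \<gamma>"
    and \<gamma>_bounded_graph:
      "\<gamma> ` D \<subseteq> D \<and> (\<exists>K. \<forall>x\<in>D. graph_norm A (\<gamma> x) \<le> K * graph_norm A x)"
    and \<gamma>_adjoint: "cinner (\<gamma> x) y = cinner x (- \<gamma> y)"
    and \<gamma>_inverse: "\<gamma> (\<gamma> x) = - x"
    and anticommute: "x \<in> D \<Longrightarrow> A (\<gamma> x) + \<gamma> (A x) = 0"
begin

text \<open>
  Since \<open>D\<close> embeds compactly, the spectrum of \<open>A\<close> consists of eigenvalues, and \<open>A\<close> is
  diagonalised by its eigenspaces (proved as \<open>spec_space_UNIV\<close> below). Hence the spectral subspace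
  belonging to \<open>J\<close> is the closed linear span of the eigenspaces with eigenvalue in \<open>J\<close>.
\<close>

definition eigenspace :: "real \<Rightarrow> 'a set" where
  "eigenspace t = {x \<in> D. A x = t *\<^sub>R x}"

definition spec_space :: "real set \<Rightarrow> 'a set" where
  "spec_space J = closure (cvec.span (\<Union>t\<in>J. eigenspace t))"

definition spec_proj :: "real set \<Rightarrow> 'a \<Rightarrow> 'a" where
  "spec_proj J = orth_proj (spec_space J)"


subsection \<open>The scale of spaces \<open>H\<^sup>s\<close>\<close>

text \<open>
  All spaces \<open>H\<^sup>s\<close>, for \<open>s\<close> of either sign, are realised inside one vector space: the families
  \<open>x :: real \<Rightarrow> 'a\<close> whose entry \<open>x t\<close> lies in the \<open>t\<close>-eigenspace of \<open>A\<close>; a function \<open>f A\<close> of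
  \<open>A\<close> multiplies the entry at \<open>t\<close> by \<open>f t\<close>. A vector \<open>x\<close> of \<open>H\<close> is identified with the family
  \<open>coeffs x\<close> of its eigencomponents. The elements of \<open>sobolev s\<close> are the families whose
  \<open>s\<close>-norm is finite. For \<open>s \<ge> 0\<close> these are the vectors in the domain of \<open>\<bar>A\<bar>\<^sup>s\<close>, and for
  \<open>s < 0\<close> they form the completion of the intersection of all \<open>H\<^sup>r\<close>, in which the families with
  finitely many nonzero entries are dense.
\<close>

definition coeffs :: "'a \<Rightarrow> real \<Rightarrow> 'a" where
  "coeffs x t = spec_proj {t} x"

definition sobolev :: "real \<Rightarrow> (real \<Rightarrow> 'a) set" where
  "sobolev s = {x. (\<forall>t. x t \<in> eigenspace t) \<and>
     (\<lambda>t. (norm ((1 + t\<^sup>2) powr (s/2) *\<^sub>R x t))\<^sup>2) summable_on UNIV}"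

definition sobolev_norm :: "real \<Rightarrow> (real \<Rightarrow> 'a) \<Rightarrow> real" where
  "sobolev_norm s x = sqrt (\<Sum>\<^sub>\<infinity>t. (norm ((1 + t\<^sup>2) powr (s/2) *\<^sub>R x t))\<^sup>2)"

definition H_half :: "'a set" where
  "H_half = {x. coeffs x \<in> sobolev (1/2)}"

text \<open>The pairing \<open>B\<^sub>s\<close> of \<open>sobolev s\<close> with \<open>sobolev (-s)\<close>.\<close>

definition pairing :: "real \<Rightarrow> (real \<Rightarrow> 'a) \<Rightarrow> (real \<Rightarrow> 'a) \<Rightarrow> complex" where
  "pairing s x y =
     (\<Sum>\<^sub>\<infinity>t. cinner ((1 + t\<^sup>2) powr (s/2) *\<^sub>R x t) ((1 + t\<^sup>2) powr (- s/2) *\<^sub>R y t))"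

text \<open>The extensions of the spectral projections and of \<open>\<gamma>\<close> to families. As \<open>\<gamma>\<close> anticommutes
  with \<open>A\<close>, it maps the \<open>-t\<close>-eigenspace onto the \<open>t\<close>-eigenspace.\<close>

definition cut :: "real set \<Rightarrow> (real \<Rightarrow> 'a) \<Rightarrow> real \<Rightarrow> 'a" where
  "cut J x t = (if t \<in> J then x t else 0)"

definition \<gamma>_ext :: "(real \<Rightarrow> 'a) \<Rightarrow> real \<Rightarrow> 'a" where
  "\<gamma>_ext x t = \<gamma> (x (- t))"


subsection \<open>Boundary conditions\<close>

definition H_check :: "(real \<Rightarrow> 'a) set" where
  "H_check = {x. cut {..0} x \<in> sobolev (1/2) \<and> cut {0<..} x \<in> sobolev (- 1/2)}"

definition check_norm :: "(real \<Rightarrow> 'a) \<Rightarrow> real" where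
  "check_norm x = sqrt ((sobolev_norm (1/2) (cut {..0} x))\<^sup>2
                      + (sobolev_norm (- 1/2) (cut {0<..} x))\<^sup>2)"

definition \<omega> :: "(real \<Rightarrow> 'a) \<Rightarrow> (real \<Rightarrow> 'a) \<Rightarrow> complex" where
  "\<omega> x y = pairing (1/2) (cut {..0} x) (\<gamma>_ext (cut {0..} y))
          + pairing (- 1/2) (cut {0<..} x) (\<gamma>_ext (cut {..<0} y))"

definition boundary_condition :: "(real \<Rightarrow> 'a) set \<Rightarrow> bool" where
  "boundary_condition B \<longleftrightarrow>
     B \<subseteq> H_check \<and>
     (\<lambda>t. 0) \<in> B \<and>
     (\<forall>x\<in>B. \<forall>y\<in>B. (\<lambda>t. x t + y t) \<in> B) \<and>
     (\<forall>c. \<forall>x\<in>B. (\<lambda>t. c *\<^sub>C x t) \<in> B) \<and>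
     (\<forall>x\<in>H_check. (\<forall>e>0. \<exists>b\<in>B. check_norm (\<lambda>t. x t - b t) < e) \<longrightarrow> x \<in> B)"

definition annihilator :: "(real \<Rightarrow> 'a) set \<Rightarrow> (real \<Rightarrow> 'a) set" where
  "annihilator B = {y \<in> H_check. \<forall>x\<in>B. \<omega> x y = 0}"

definition regular :: "(real \<Rightarrow> 'a) set \<Rightarrow> bool" where
  "regular B \<longleftrightarrow> B \<subseteq> sobolev (1/2)"

definition elliptic :: "(real \<Rightarrow> 'a) set \<Rightarrow> bool" where
  "elliptic B \<longleftrightarrow> boundary_condition B \<and> regular B \<and> regular (annihilator B)"

definition half_smooth :: "'a set \<Rightarrow> 'a set \<Rightarrow> ('a \<Rightarrow> 'a) \<Rightarrow> bool" where
  "half_smooth U V g \<longleftrightarrow>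
     cvec.subspace U \<and> closed U \<and> cvec.subspace V \<and> closed V \<and>
     bounded_clinear_between U V g \<and>
     g ` (U \<inter> H_half) \<subseteq> V \<inter> H_half \<and>
     adjoint_between U g ` (V \<inter> H_half) \<subseteq> U \<inter> H_half"

text \<open>The data \<open>spec_space {..\<Lambda>} = E \<oplus> U\<close>, \<open>spec_space {..<-\<Lambda>} = F \<oplus> V\<close>, \<open>g : U \<rightarrow> V\<close>.\<close>

definition boundary_data ::
    "real \<Rightarrow> 'a set \<Rightarrow> 'a set \<Rightarrow> 'a set \<Rightarrow> 'a set \<Rightarrow> ('a \<Rightarrow> 'a) \<Rightarrow> bool" where
  "boundary_data \<Lambda> E U F V g \<longleftrightarrow>
     orth_decomp (spec_space {..\<Lambda>}) E U \<and>
     finite_dim E \<and> E \<subseteq> spec_proj {..\<Lambda>} ` H_half \<and>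
     orth_decomp (spec_space {..<-\<Lambda>}) F V \<and>
     finite_dim F \<and> F \<subseteq> spec_proj {..<-\<Lambda>} ` H_half \<and>
     half_smooth U V g"

definition graph_part :: "'a set \<Rightarrow> ('a \<Rightarrow> 'a) \<Rightarrow> 'a set" where
  "graph_part U g = {u + \<gamma> (g u) | u. u \<in> U \<inter> H_half}"

text \<open>The sum of \<open>\<gamma> F\<close> and the graph part, transported from \<open>H\<close> to families.\<close>

definition graph_condition :: "'a set \<Rightarrow> 'a set \<Rightarrow> ('a \<Rightarrow> 'a) \<Rightarrow> (real \<Rightarrow> 'a) set" where
  "graph_condition F U g = coeffs ` {f + w | f w. f \<in> \<gamma> ` F \<and> w \<in> graph_part U g}"

end


section \<open>The eigenvectors of a Dirac system span a dense subspace\<close>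

text \<open>Orthogonal projection onto a closed subspace exists; the library proves this only in
  finite dimension.\<close>


lemma closed_subspace_orth_proj_exists:
  fixes M :: "'a::{real_inner,complete_space} set"
  assumes M: "subspace M" "closed M"
  shows "\<exists>y\<in>M. \<forall>z\<in>M. inner (x - y) z = 0"
proof -
  define d where "d = infdist x M"
  have ne: "M \<noteq> {}" using M(1) subspace_0 by auto
  have d0: "d \<ge> 0" unfolding d_def by (rule infdist_nonneg)
  have lower: "d \<le> norm (x - y)" if "y \<in> M" for y
    using infdist_le[OF that, of x] by (simp add: d_def dist_norm)
  have "\<exists>y\<in>M. norm (x - y) < d + e" if "e > 0" for e
  proof -
    have "(INF a\<in>M. dist x a) < d + e" using that ne by (simp add: d_def infdist_def)
    then obtain y where "y \<in> M" "dist x y < d + e"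
      using cInf_lessD[of "dist x ` M" "d + e"] ne by auto
    then show ?thesis by (auto simp: dist_norm)
  qed
  then have "\<forall>n. \<exists>y\<in>M. norm (x - y) < d + 1 / real (Suc n)" by simp
  then obtain y where yM: "\<And>n. y n \<in> M" and yn: "\<And>n. norm (x - y n) < d + 1 / real (Suc n)"
    by metis
  have lim: "(\<lambda>n. norm (x - y n)) \<longlonglongrightarrow> d"
  proof (rule tendsto_sandwich[of "\<lambda>_. d" _ _ "\<lambda>n. d + 1 / real (Suc n)"])
    show "(\<lambda>n. d + 1 / real (Suc n)) \<longlonglongrightarrow> d"
      using tendsto_add[OF tendsto_const[of d] LIMSEQ_Suc[OF lim_1_over_n]] by simp
  qed (use lower yM yn in \<open>auto intro!: always_eventually less_imp_le\<close>)
  have para: "(norm (y m - y n))\<^sup>2 \<le> 2 * (norm (x - y m))\<^sup>2 + 2 * (norm (x - y n))\<^sup>2 - 4 * d\<^sup>2" for m n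
  proof -
    have mid: "(1/2) *\<^sub>R (y m + y n) \<in> M" using M(1) yM by (simp add: subspace_add subspace_scale)
    have "(norm (y m - y n))\<^sup>2 = 2 * (norm (x - y m))\<^sup>2 + 2 * (norm (x - y n))\<^sup>2
            - 4 * (norm (x - (1/2) *\<^sub>R (y m + y n)))\<^sup>2"
    proof -
      define u v where "u = x - y m" and "v = x - y n"
      have 1: "y m - y n = v - u" by (simp add: u_def v_def)
      have 2: "x - (1/2) *\<^sub>R (y m + y n) = (1/2) *\<^sub>R (u + v)"
      proof -
        have "x = (1/2) *\<^sub>R (x + x)" by (simp flip: scaleR_2)
        then have "x - (1/2) *\<^sub>R (y m + y n) = (1/2) *\<^sub>R (x + x) - (1/2) *\<^sub>R (y m + y n)" by simp
        also have "\<dots> = (1/2) *\<^sub>R (u + v)" unfolding scaleR_diff_right[symmetric] by (simp add: u_def v_def)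
        finally show ?thesis .
      qed
      show ?thesis unfolding 1 2 u_def[symmetric] v_def[symmetric]
        by (simp only: power2_norm_eq_inner inner_diff_left inner_diff_right inner_add_left
              inner_add_right inner_scaleR_left inner_scaleR_right) (simp add: inner_commute[of v u] field_simps)
    qed
    moreover have "d\<^sup>2 \<le> (norm (x - (1/2) *\<^sub>R (y m + y n)))\<^sup>2"
      using lower[OF mid] d0 by (intro power_mono)
    ultimately show ?thesis by linarith
  qed
  have "Cauchy y"
  proof (rule CauchyI)
    fix e :: real assume e: "e > 0"
    have "(\<lambda>n. (norm (x - y n))\<^sup>2) \<longlonglongrightarrow> d\<^sup>2" by (intro tendsto_intros lim)
    then have "eventually (\<lambda>n. (norm (x - y n))\<^sup>2 < d\<^sup>2 + e\<^sup>2 / 4) sequentially"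
      using e by (intro order_tendstoD) auto
    then obtain N where N: "\<And>n. n \<ge> N \<Longrightarrow> (norm (x - y n))\<^sup>2 < d\<^sup>2 + e\<^sup>2 / 4"
      by (auto simp: eventually_sequentially)
    have "norm (y m - y n) < e" if "m \<ge> N" "n \<ge> N" for m n
    proof -
      have "(norm (y m - y n))\<^sup>2 < e\<^sup>2" using para[of m n] N[OF that(1)] N[OF that(2)] by linarith
      then show ?thesis using e by (simp add: power_less_imp_less_base)
    qed
    then show "\<exists>N. \<forall>m\<ge>N. \<forall>n\<ge>N. norm (y m - y n) < e" by blast
  qed
  then obtain l where l: "y \<longlonglongrightarrow> l" using Cauchy_convergent_iff convergent_def by blast
  have lM: "l \<in> M" using closed_sequentially[OF M(2) yM l] .
  have "(\<lambda>n. norm (x - y n)) \<longlonglongrightarrow> norm (x - l)" by (intro tendsto_intros l)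
  then have dl: "norm (x - l) = d" using lim LIMSEQ_unique by blast
  have "inner (x - l) z = 0" if z: "z \<in> M" for z
  proof (cases "z = 0")
    case False
    define t where "t = inner (x - l) z / inner z z"
    have zz: "inner z z > 0" using False by simp
    have "l + t *\<^sub>R z \<in> M" using M(1) lM z by (simp add: subspace_add subspace_scale)
    then have "d\<^sup>2 \<le> (norm (x - (l + t *\<^sub>R z)))\<^sup>2" using lower d0 by (intro power_mono) auto
    also have "\<dots> = (norm (x - l))\<^sup>2 - 2 * t * inner (x - l) z + t * t * inner z z"
    proof -
      define u where "u = x - l"
      have eq: "x - (l + t *\<^sub>R z) = u - t *\<^sub>R z" by (simp add: u_def)
      show ?thesis unfolding eq unfolding u_def[symmetric]
        by (simp add: power2_norm_eq_inner inner_diff_left inner_diff_right inner_commute[of z u]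
              algebra_simps)
    qed
    also have "\<dots> = d\<^sup>2 - (inner (x - l) z)\<^sup>2 / inner z z"
      using zz by (simp add: dl t_def power2_eq_square)
    finally have "(inner (x - l) z)\<^sup>2 / inner z z \<le> 0" by simp
    then show ?thesis using zz by (simp add: divide_le_0_iff)
  qed simp
  with lM show ?thesis by blast
qed


lemma closure_subspace_real:
  fixes M :: "'a::real_normed_vector set"
  assumes "subspace M"
  shows "subspace (closure M)"
proof -
  have 0: "0 \<in> closure M" using assms closure_subset subspace_0 by blast
  moreover have "x + y \<in> closure M" if xy: "x \<in> closure M" "y \<in> closure M" for x y
  proof -
    obtain a b where "\<forall>n. a n \<in> M" "a \<longlonglongrightarrow> x" "\<forall>n. b n \<in> M" "b \<longlonglongrightarrow> y"
      using xy unfolding closure_sequential by blast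
    then show ?thesis unfolding closure_sequential using assms
      by (intro exI[of _ "\<lambda>n. a n + b n"]) (auto intro!: tendsto_add subspace_add)
  qed
  moreover have "c *\<^sub>R x \<in> closure M" if x: "x \<in> closure M" for x c
  proof -
    obtain a where "\<forall>n. a n \<in> M" "a \<longlonglongrightarrow> x"
      using x unfolding closure_sequential by blast
    then show ?thesis unfolding closure_sequential using assms
      by (intro exI[of _ "\<lambda>n. c *\<^sub>R a n"]) (auto intro!: tendsto_intros subspace_scale)
  qed
  ultimately show ?thesis unfolding subspace_def by blast
qed

lemma cvec_subspace_imp_subspace: "cvec.subspace M \<Longrightarrow> subspace M"
  unfolding subspace_def cvec.subspace_def by (simp add: scaleR_scaleC)

abbreviation imul :: "'a::chilbert_space \<Rightarrow> 'a" where
  "imul x \<equiv> \<i> *\<^sub>C x"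

lemma imul_imul [simp]: "imul (imul x) = - x"
  by (simp add: scaleC_scaleC)

lemma cinner_scaleC_right: "cinner x (c *\<^sub>C y) = cnj c * cinner x y"
  by (metis cinner_commute cinner_scaleC_left complex_cnj_mult)

lemma cinner_eq_inner: "cinner x y = Complex (inner x y) (inner x (imul y))"
  by (simp add: inner_eq_Re_cinner cinner_scaleC_right complex_eq_iff)

lemma inner_imul_left: "inner (imul x) y = - inner x (imul y)"
  by (simp add: inner_eq_Re_cinner cinner_scaleC_right cinner_scaleC_left)

lemma norm_imul [simp]: "norm (imul x) = norm x"
  by (simp add: norm_eq_sqrt_inner inner_imul_left)

lemma imul_scaleR: "imul (r *\<^sub>R x) = r *\<^sub>R imul x"
  by (simp add: scaleR_scaleC scaleC_scaleC mult.commute)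

lemma inner_imul_self [simp]: "inner x (imul x) = 0"
  using inner_imul_left[of x x] by (simp add: inner_commute)

context dirac_system
begin

lemma D_subspace: "cvec.subspace D" "subspace D"
  and D_dense: "closure D = UNIV"
  and A_add: "x \<in> D \<Longrightarrow> y \<in> D \<Longrightarrow> A (x + y) = A x + A y"
  and A_scaleC: "x \<in> D \<Longrightarrow> A (c *\<^sub>C x) = c *\<^sub>C A x"
  and A_scaleR: "x \<in> D \<Longrightarrow> A (r *\<^sub>R x) = r *\<^sub>R A x"
  and A_symmetric: "x \<in> D \<Longrightarrow> y \<in> D \<Longrightarrow> inner (A x) y = inner x (A y)"
  using A_self_adjoint
  by (auto simp: self_adjoint_def clinear_on_def cvec_subspace_imp_subspace inner_eq_Re_cinner scaleR_scaleC)

lemma D_imul: "x \<in> D \<Longrightarrow> imul x \<in> D" and A_imul: "x \<in> D \<Longrightarrow> A (imul x) = imul (A x)"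
  using D_subspace(1) by (auto simp: cvec.subspace_scale A_scaleC)

lemma A_diff: "x \<in> D \<Longrightarrow> y \<in> D \<Longrightarrow> A (x - y) = A x - A y"
  using A_add[of x "- y"] A_scaleR[of y "-1"] D_subspace(2) subspace_scale[of D y "-1"] by simp

lemma A_maximal:
  assumes "\<And>x. x \<in> D \<Longrightarrow> inner (A x) y = inner x z"
  shows "y \<in> D" "A y = z"
proof -
  have "cinner (A x) y = cinner x z" if x: "x \<in> D" for x
    using assms[OF x] assms[OF D_imul[OF x]]
    by (simp add: cinner_eq_inner A_imul x inner_imul_left)
  then show y: "y \<in> D" using A_self_adjoint unfolding self_adjoint_def by blast
  have orth: "inner x (A y - z) = 0" if "x \<in> D" for x
    using assms[OF that] A_symmetric[OF that y] by (simp add: inner_diff_right)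
  have "A y - z \<in> closure D" using D_dense by simp
  then obtain a where "\<And>n. a n \<in> D" "a \<longlonglongrightarrow> A y - z" by (auto simp: closure_sequential)
  then have "(\<lambda>n. inner (a n) (A y - z)) \<longlonglongrightarrow> inner (A y - z) (A y - z)"
    by (intro tendsto_intros)
  then have "inner (A y - z) (A y - z) = 0"
    using \<open>\<And>n. a n \<in> D\<close> orth by (simp add: LIMSEQ_const_iff)
  then show "A y = z" by simp
qed

text \<open>The resolvents of \<open>A\<close> at \<open>\<plusminus>\<i>\<close>.\<close>

lemma resolvent_norm:
  assumes "x \<in> D" "c = 1 \<or> c = -1"
  shows "(norm (A x + c *\<^sub>R imul x))\<^sup>2 = (norm x)\<^sup>2 + (norm (A x))\<^sup>2"
proof -
  have "inner (A x) (imul x) = 0"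
    using A_symmetric[OF assms(1) D_imul[OF assms(1)]] inner_imul_left[of x "A x"]
    by (simp add: A_imul assms(1) inner_commute)
  moreover from this have "inner (imul x) (A x) = 0" by (simp only: inner_commute[of "imul x"])
  ultimately show ?thesis using assms(2)
    unfolding power2_norm_eq_inner
    by (auto simp: inner_add_left inner_add_right inner_diff_left inner_diff_right inner_imul_left[of x "imul x"])
qed

lemma resolvent_surj:
  assumes c: "c = 1 \<or> c = -1"
  shows "\<exists>x\<in>D. A x + c *\<^sub>R imul x = h"
proof -
  define R where "R = (\<lambda>x. A x + c *\<^sub>R imul x) ` D"
  have R_diff: "A (x - y) + c *\<^sub>R imul (x - y) = (A x + c *\<^sub>R imul x) - (A y + c *\<^sub>R imul y)"
    if "x \<in> D" "y \<in> D" for x y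
    using that by (simp add: A_diff cvec.scale_right_diff_distrib scaleR_diff_right)
  have "subspace R"
    unfolding subspace_def
  proof (intro conjI ballI allI)
    have "A 0 = 0" using A_scaleR[of 0 0] D_subspace(2) by (simp add: subspace_0)
    then show "0 \<in> R" unfolding R_def using D_subspace(2) by (intro image_eqI[of _ _ 0]) (auto simp: subspace_0)
  next
    fix p q assume "p \<in> R" "q \<in> R"
    then obtain x y where "x \<in> D" "y \<in> D" "p = A x + c *\<^sub>R imul x" "q = A y + c *\<^sub>R imul y"
      by (auto simp: R_def)
    then show "p + q \<in> R" unfolding R_def using D_subspace(2)
      by (intro image_eqI[of _ _ "x + y"])
         (auto simp: subspace_add A_add scaleC_add_right scaleR_add_right)
  next
    fix r p assume "p \<in> R"
    then obtain x where "x \<in> D" "p = A x + c *\<^sub>R imul x"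
      by (auto simp: R_def)
    then show "r *\<^sub>R p \<in> R" unfolding R_def using D_subspace(2)
      by (intro image_eqI[of _ _ "r *\<^sub>R x"])
         (auto simp: subspace_scale A_scaleR imul_scaleR scaleR_add_right mult.commute)
  qed
  moreover have "closed R"
    unfolding closed_sequential_limits
  proof (intro allI impI, elim conjE)
    fix p l assume pR: "\<forall>n. p n \<in> R" and pl: "p \<longlonglongrightarrow> l"
    then obtain x where xD: "\<And>n. x n \<in> D" and px: "\<And>n. p n = A (x n) + c *\<^sub>R imul (x n)"
      unfolding R_def image_iff by metis
    have "norm (x m - x n) \<le> norm (p m - p n)" for m n
    proof -
      have "(norm (p m - p n))\<^sup>2 = (norm (x m - x n))\<^sup>2 + (norm (A (x m - x n)))\<^sup>2"
        unfolding px R_diff[OF xD xD, symmetric]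
        using D_subspace(2) xD by (intro resolvent_norm c) (auto simp: subspace_diff)
      then have "(norm (x m - x n))\<^sup>2 \<le> (norm (p m - p n))\<^sup>2" by simp
      then show ?thesis by (rule power2_le_imp_le) simp
    qed
    moreover have "Cauchy p" using pl by (rule LIMSEQ_imp_Cauchy)
    ultimately have "Cauchy x" unfolding Cauchy_iff by (metis order_le_less_trans)
    then obtain y where y: "x \<longlonglongrightarrow> y" using Cauchy_convergent_iff convergent_def by blast
    have ix: "(\<lambda>n. imul (x n)) \<longlonglongrightarrow> imul y"
    proof -
      have "(\<lambda>n. norm (x n - y)) \<longlonglongrightarrow> 0" by (intro tendsto_norm_zero LIM_zero y)
      moreover have "norm (imul (x n) - imul y) = norm (x n - y)" for n
        using norm_imul[of "x n - y"] by (simp add: cvec.scale_right_diff_distrib)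
      ultimately have "(\<lambda>n. norm (imul (x n) - imul y)) \<longlonglongrightarrow> 0" by (simp only:)
      then show ?thesis by (rule LIM_zero_cancel[OF tendsto_norm_zero_cancel])
    qed
    define z where "z = l - c *\<^sub>R imul y"
    have Ax: "(\<lambda>n. A (x n)) \<longlonglongrightarrow> z"
    proof -
      have "(\<lambda>n. p n - c *\<^sub>R imul (x n)) \<longlonglongrightarrow> z" unfolding z_def by (intro tendsto_intros pl ix)
      then show ?thesis by (simp add: px)
    qed
    have weak: "inner (A u) y = inner u z" if u: "u \<in> D" for u
    proof -
      have "(\<lambda>n. inner (A u) (x n)) \<longlonglongrightarrow> inner (A u) y" by (intro tendsto_intros y)
      moreover have "(\<lambda>n. inner (A u) (x n)) \<longlonglongrightarrow> inner u z"
        unfolding A_symmetric[OF u xD] by (intro tendsto_intros Ax)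
      ultimately show ?thesis using LIMSEQ_unique by blast
    qed
    have "y \<in> D" "A y = z" using A_maximal[OF weak] by auto
    then show "l \<in> R" unfolding R_def by (intro image_eqI[of _ _ y]) (auto simp: z_def)
  qed
  ultimately obtain y where y: "y \<in> R" and orth: "\<And>z. z \<in> R \<Longrightarrow> inner (h - y) z = 0"
    using closed_subspace_orth_proj_exists[of R h] by auto
  define w where "w = h - y"
  have weak: "inner (A x) w = inner x (c *\<^sub>R imul w)" if "x \<in> D" for x
  proof -
    have "inner w (A x + c *\<^sub>R imul x) = 0"
      unfolding w_def using that by (intro orth) (auto simp: R_def)
    then show ?thesis
      by (simp add: inner_add_right inner_commute[of w "A x"] inner_commute[of w "imul x"] inner_imul_left)
  qed
  have w: "w \<in> D" "A w = c *\<^sub>R imul w" using A_maximal[OF weak] by auto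
  then have "(norm (A w + (- c) *\<^sub>R imul w))\<^sup>2 = (norm w)\<^sup>2 + (norm (A w))\<^sup>2"
    using c by (intro resolvent_norm) auto
  then have "w = 0" by (simp add: w(2) add_nonneg_eq_0_iff)
  then show ?thesis using y by (auto simp: w_def R_def)
qed

definition resolvent :: "real \<Rightarrow> 'a \<Rightarrow> 'a" where
  "resolvent c h = (SOME x. x \<in> D \<and> A x + c *\<^sub>R imul x = h)"

context
  fixes c :: real
  assumes c: "c = 1 \<or> c = -1"
begin

lemma resolvent_D: "resolvent c h \<in> D"
  and resolvent_eq: "A (resolvent c h) + c *\<^sub>R imul (resolvent c h) = h"
proof -
  have "resolvent c h \<in> D \<and> A (resolvent c h) + c *\<^sub>R imul (resolvent c h) = h"
    unfolding resolvent_def by (rule someI_ex) (use resolvent_surj[OF c, of h] in blast)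
  then show "resolvent c h \<in> D" "A (resolvent c h) + c *\<^sub>R imul (resolvent c h) = h" by auto
qed

lemma resolvent_graph_norm: "graph_norm A (resolvent c h) = norm h"
proof -
  have "(norm h)\<^sup>2 = (norm (resolvent c h))\<^sup>2 + (norm (A (resolvent c h)))\<^sup>2"
    using resolvent_norm[OF resolvent_D c, of h] by (simp only: resolvent_eq)
  from this[symmetric] show ?thesis unfolding graph_norm_def by (simp only: real_sqrt_abs abs_norm_cancel)
qed

lemma resolvent_le: "norm (resolvent c h) \<le> norm h"
proof -
  have "(norm h)\<^sup>2 = (norm (resolvent c h))\<^sup>2 + (norm (A (resolvent c h)))\<^sup>2"
    using resolvent_norm[OF resolvent_D c, of h] by (simp only: resolvent_eq)
  then have "(norm (resolvent c h))\<^sup>2 \<le> (norm h)\<^sup>2"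
    using zero_le_power2[of "norm (A (resolvent c h))"] by linarith
  then show ?thesis by (rule power2_le_imp_le) simp
qed

lemma resolvent_unique:
  assumes "x \<in> D" "A x + c *\<^sub>R imul x = h"
  shows "resolvent c h = x"
proof -
  let ?y = "resolvent c h - x"
  have "A ?y + c *\<^sub>R imul ?y = (A (resolvent c h) + c *\<^sub>R imul (resolvent c h)) - (A x + c *\<^sub>R imul x)"
    by (simp add: A_diff assms(1) resolvent_D cvec.scale_right_diff_distrib scaleR_diff_right)
  also have "\<dots> = 0" by (simp add: resolvent_eq assms(2))
  finally have 1: "A ?y + c *\<^sub>R imul ?y = 0" .
  have "?y \<in> D" using assms(1) resolvent_D D_subspace(2) by (simp add: subspace_diff)
  from resolvent_norm[OF this c] have "(norm (0::'a))\<^sup>2 = (norm ?y)\<^sup>2 + (norm (A ?y))\<^sup>2" unfolding 1 .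
  then have "(norm ?y)\<^sup>2 + (norm (A ?y))\<^sup>2 = 0" by (simp only: norm_zero zero_power2)
  then have "(norm ?y)\<^sup>2 = 0" using zero_le_power2[of "norm ?y"] zero_le_power2[of "norm (A ?y)"] by linarith
  then show ?thesis by simp
qed

lemma resolvent_scaleR: "resolvent c (r *\<^sub>R h) = r *\<^sub>R resolvent c h"
proof (rule resolvent_unique)
  show "r *\<^sub>R resolvent c h \<in> D" using resolvent_D D_subspace(2) by (simp add: subspace_scale)
  have "A (r *\<^sub>R resolvent c h) + c *\<^sub>R imul (r *\<^sub>R resolvent c h)
      = r *\<^sub>R (A (resolvent c h) + c *\<^sub>R imul (resolvent c h))"
    by (simp add: A_scaleR resolvent_D imul_scaleR scaleR_add_right mult.commute)
  then show "A (r *\<^sub>R resolvent c h) + c *\<^sub>R imul (r *\<^sub>R resolvent c h) = r *\<^sub>R h"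
    by (simp add: resolvent_eq)
qed

lemma resolvent_diff: "resolvent c (h - k) = resolvent c h - resolvent c k"
proof (rule resolvent_unique)
  show "resolvent c h - resolvent c k \<in> D" using resolvent_D D_subspace(2) by (simp add: subspace_diff)
  have "A (resolvent c h - resolvent c k) + c *\<^sub>R imul (resolvent c h - resolvent c k)
      = (A (resolvent c h) + c *\<^sub>R imul (resolvent c h))
        - (A (resolvent c k) + c *\<^sub>R imul (resolvent c k))"
    by (simp add: A_diff resolvent_D cvec.scale_right_diff_distrib scaleR_diff_right)
  then show "A (resolvent c h - resolvent c k) + c *\<^sub>R imul (resolvent c h - resolvent c k) = h - k"
    by (simp add: resolvent_eq)
qed

lemma resolvent_tendsto:
  assumes "h \<longlonglongrightarrow> l" shows "(\<lambda>n. resolvent c (h n)) \<longlonglongrightarrow> resolvent c l"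
proof -
  have "(\<lambda>n. norm (h n - l)) \<longlonglongrightarrow> 0" by (intro tendsto_norm_zero LIM_zero assms)
  then have "(\<lambda>n. norm (resolvent c (h n) - resolvent c l)) \<longlonglongrightarrow> 0"
    by (rule Lim_null_comparison[rotated]) (simp add: resolvent_le flip: resolvent_diff)
  then show ?thesis by (rule LIM_zero_cancel[OF tendsto_norm_zero_cancel])
qed

end

lemma resolvent_adjoint:
  assumes c: "c = 1 \<or> c = -1"
  shows "inner (resolvent (- c) (resolvent c k)) k = (norm (resolvent c k))\<^sup>2"
proof -
  have c': "- c = 1 \<or> - c = -1" using c by auto
  define v y where "v = resolvent c k" and "y = resolvent (- c) v"
  have v: "v \<in> D" "A v + c *\<^sub>R imul v = k" using resolvent_D[OF c] resolvent_eq[OF c] by (auto simp: v_def)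
  have y: "y \<in> D" "A y + (- c) *\<^sub>R imul y = v" using resolvent_D[OF c'] resolvent_eq[OF c'] by (auto simp: y_def)
  have "inner y k = inner (A y) v - c * inner (imul y) v"
    unfolding v(2)[symmetric] by (simp add: inner_add_right A_symmetric y(1) v(1) inner_imul_left)
  also have "\<dots> = inner (A y + (- c) *\<^sub>R imul y) v" by (simp add: inner_diff_left)
  also have "\<dots> = (norm v)\<^sup>2" unfolding y(2) by (simp add: power2_norm_eq_inner)
  finally show ?thesis by (simp add: v_def y_def)
qed

lemma eigenspace_imul: "x \<in> eigenspace t \<Longrightarrow> imul x \<in> eigenspace t"
  by (auto simp: eigenspace_def D_imul A_imul imul_scaleR)

lemma orth_eigenspaces_imp_zero:
  assumes w: "\<And>t x. x \<in> eigenspace t \<Longrightarrow> inner w x = 0"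
  shows "w = 0"
proof (rule ccontr)
  assume w0: "w \<noteq> 0"
  define W where "W = {w. \<forall>t. \<forall>x\<in>eigenspace t. inner w x = 0}"
  have wW: "w \<in> W" using w by (auto simp: W_def)
  have W_scale: "r *\<^sub>R h \<in> W" if "h \<in> W" for r h using that by (auto simp: W_def)
  have W_res: "resolvent c h \<in> W" if c: "c = 1 \<or> c = -1" and h: "h \<in> W" for c h
    unfolding W_def
  proof (intro CollectI allI ballI)
    fix t x assume x: "x \<in> eigenspace t"
    define y where "y = resolvent c h"
    have y: "y \<in> D" "A y + c *\<^sub>R imul y = h" using resolvent_D[OF c] resolvent_eq[OF c] by (auto simp: y_def)
    have *: "t * inner y z - c * inner y (imul z) = 0" if "z \<in> eigenspace t" for z
    proof -
      have "inner h z = inner (A y) z - c * inner y (imul z)"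
        unfolding y(2)[symmetric] by (simp add: inner_add_left inner_imul_left)
      moreover have "inner h z = 0" using h that by (simp add: W_def)
      moreover have "inner (A y) z = t * inner y z"
        using that y(1) by (simp add: eigenspace_def A_symmetric)
      ultimately show ?thesis by simp
    qed
    have 1: "t * inner y x = c * inner y (imul x)" using *[OF x] by simp
    have 2: "t * inner y (imul x) = - c * inner y x" using *[OF eigenspace_imul[OF x]] by simp
    have "c * c = 1" using c by auto
    have "(1 + t\<^sup>2) * inner y x = c * c * inner y x + t * (t * inner y x)"
      by (simp add: \<open>c * c = 1\<close> distrib_right power2_eq_square)
    also have "\<dots> = c * (t * inner y (imul x) + c * inner y x)" unfolding 1 by (simp add: algebra_simps)
    also have "\<dots> = 0" by (simp add: 2)
    finally have "(1 + t\<^sup>2) * inner y x = 0" .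
    moreover have "1 + t\<^sup>2 \<noteq> 0" by (smt (verit) zero_le_power2)
    ultimately show "inner (resolvent c h) x = 0" unfolding y_def[symmetric] by simp
  qed
  let ?T = "resolvent 1" and ?S = "resolvent (-1)"
  define N where "N = {norm (?T h) | h. h \<in> W \<and> norm h \<le> 1}"
  define m where "m = Sup N"
  have bdd: "bdd_above N"
  proof (rule bdd_aboveI)
    fix a assume "a \<in> N"
    then obtain h where "a = norm (?T h)" "norm h \<le> 1" by (auto simp: N_def)
    moreover have "norm (?T h) \<le> norm h" by (rule resolvent_le) simp
    ultimately show "a \<le> 1" by linarith
  qed
  have T_le: "norm (?T h) \<le> m * norm h" if h: "h \<in> W" for h
  proof (cases "h = 0")
    case True then show ?thesis using resolvent_le[of 1 0] by simp
  next
    case False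
    have "norm (?T ((1 / norm h) *\<^sub>R h)) \<in> N"
      unfolding N_def using False h by (auto intro!: exI[of _ "(1 / norm h) *\<^sub>R h"] W_scale)
    then have "norm (?T ((1 / norm h) *\<^sub>R h)) \<le> m" unfolding m_def by (intro cSup_upper bdd)
    then show ?thesis using False by (simp add: resolvent_scaleR field_simps)
  qed
  have m0: "m > 0"
  proof -
    have "?T w \<noteq> 0"
    proof
      assume "?T w = 0"
      then have "A 0 = w" using resolvent_eq[of 1 w] by simp
      moreover have "A 0 = 0" using A_scaleR[of 0 0] D_subspace(2) by (simp add: subspace_0)
      ultimately show False using w0 by simp
    qed
    then have "0 < m * norm w" using T_le[OF wW] by (metis norm_le_zero_iff not_le order_trans)
    then show ?thesis by (simp add: zero_less_mult_iff)
  qed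
  have S_le: "norm (?S v) \<le> m * norm v" if v: "v \<in> W" for v
  proof -
    have SW: "?S v \<in> W" using W_res[of "-1"] v by simp
    have "(norm (?S v))\<^sup>2 = inner (?T (?S v)) v" using resolvent_adjoint[of "-1" v] by simp
    also have "\<dots> \<le> norm (?T (?S v)) * norm v" by (rule norm_cauchy_schwarz)
    also have "\<dots> \<le> m * norm (?S v) * norm v" by (intro mult_right_mono T_le SW) simp
    finally have "norm (?S v) * norm (?S v) \<le> norm (?S v) * (m * norm v)"
      by (simp add: power2_eq_square mult_ac)
    then show ?thesis using m0 by (cases "norm (?S v) = 0") (auto simp: mult_le_cancel_left)
  qed
  have "\<exists>h. h \<in> W \<and> norm h \<le> 1 \<and> m - 1 / real (Suc n) < norm (?T h)" for n
  proof -
    have "N \<noteq> {}" unfolding N_def using W_scale[OF wW, of 0] by (auto intro!: exI[of _ 0])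
    moreover have "m - 1 / real (Suc n) < Sup N" unfolding m_def by simp
    ultimately obtain a where "a \<in> N" "m - 1 / real (Suc n) < a" using less_cSupD by metis
    then show ?thesis by (auto simp: N_def)
  qed
  then obtain h where hW: "\<And>n. h n \<in> W" and h1: "\<And>n. norm (h n) \<le> 1"
    and hm: "\<And>n. m - 1 / real (Suc n) < norm (?T (h n))" by metis
  have T_le_m: "norm (?T (h n)) \<le> m" for n
    using T_le[OF hW, of n] h1[of n] m0 by (smt (verit) mult_left_le)
  have lim: "(\<lambda>n. norm (?T (h n))) \<longlonglongrightarrow> m"
  proof (rule tendsto_sandwich[of "\<lambda>n. m - 1 / real (Suc n)" _ _ "\<lambda>_. m"])
    show "(\<lambda>n. m - 1 / real (Suc n)) \<longlonglongrightarrow> m"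
      using tendsto_diff[OF tendsto_const[of m] LIMSEQ_Suc[OF lim_1_over_n]] by simp
  qed (use hm T_le_m in \<open>auto intro!: always_eventually less_imp_le\<close>)
  have "\<forall>n. ?T (h n) \<in> closure {x \<in> D. graph_norm A x \<le> 1}"
    using h1 by (intro allI closure_subset[THEN subsetD]) (simp add: resolvent_D resolvent_graph_norm)
  then obtain x r where r: "strict_mono r" and Tx: "((\<lambda>n. ?T (h n)) \<circ> r) \<longlonglongrightarrow> x"
    by (rule seq_compactE[OF compact_imp_seq_compact[OF compact_embedding]]) blast
  define k where "k = h \<circ> r"
  have kW: "k n \<in> W" and k1: "norm (k n) \<le> 1" for n using hW h1 by (auto simp: k_def)
  have Tk: "(\<lambda>n. ?T (k n)) \<longlonglongrightarrow> x" using Tx by (simp add: k_def o_def)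
  have nTk: "(\<lambda>n. norm (?T (k n))) \<longlonglongrightarrow> m"
    using LIMSEQ_subseq_LIMSEQ[OF lim r] by (simp add: k_def o_def)
  have "norm x = m" using LIMSEQ_unique[OF tendsto_norm[OF Tk] nTk] .
  then have x0: "x \<noteq> 0" using m0 by auto
  have STk: "(\<lambda>n. ?S (?T (k n))) \<longlonglongrightarrow> ?S x" by (rule resolvent_tendsto[OF _ Tk]) simp
  have bound: "(norm (?S (?T (k n)) - m\<^sup>2 *\<^sub>R k n))\<^sup>2 \<le> m^4 - m\<^sup>2 * (norm (?T (k n)))\<^sup>2" for n
  proof -
    have "(norm (?S (?T (k n)) - m\<^sup>2 *\<^sub>R k n))\<^sup>2
        = (norm (?S (?T (k n))))\<^sup>2 - 2 * m\<^sup>2 * inner (?S (?T (k n))) (k n) + m^4 * (norm (k n))\<^sup>2"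
      unfolding power2_norm_eq_inner
      by (simp add: inner_diff_left inner_diff_right inner_commute[of "k n" "?S (?T (k n))"] power4_eq_xxxx power2_eq_square algebra_simps)
    also have "inner (?S (?T (k n))) (k n) = (norm (?T (k n)))\<^sup>2" using resolvent_adjoint[of 1 "k n"] by simp
    finally have eq: "(norm (?S (?T (k n)) - m\<^sup>2 *\<^sub>R k n))\<^sup>2
        = (norm (?S (?T (k n))))\<^sup>2 - 2 * m\<^sup>2 * (norm (?T (k n)))\<^sup>2 + m^4 * (norm (k n))\<^sup>2" .
    have "norm (?S (?T (k n))) \<le> m * norm (?T (k n))" by (intro S_le W_res kW) simp
    then have "(norm (?S (?T (k n))))\<^sup>2 \<le> (m * norm (?T (k n)))\<^sup>2" by (intro power_mono) auto
    then have 1: "(norm (?S (?T (k n))))\<^sup>2 \<le> m\<^sup>2 * (norm (?T (k n)))\<^sup>2" by (simp add: power_mult_distrib)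
    have "(norm (k n))\<^sup>2 \<le> 1" using k1[of n] by (simp add: power_le_one)
    then have 2: "m^4 * (norm (k n))\<^sup>2 \<le> m^4" using m0 by (simp add: mult_left_le)
    show ?thesis using eq 1 2 by linarith
  qed
  have "(\<lambda>n. m^4 - m\<^sup>2 * (norm (?T (k n)))\<^sup>2) \<longlonglongrightarrow> m^4 - m\<^sup>2 * m\<^sup>2" by (intro tendsto_intros nTk)
  then have "(\<lambda>n. m^4 - m\<^sup>2 * (norm (?T (k n)))\<^sup>2) \<longlonglongrightarrow> 0" by (simp add: power4_eq_xxxx power2_eq_square)
  then have "(\<lambda>n. (norm (?S (?T (k n)) - m\<^sup>2 *\<^sub>R k n))\<^sup>2) \<longlonglongrightarrow> 0"
    by (rule Lim_null_comparison[rotated]) (use bound in auto)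
  then have "(\<lambda>n. norm (?S (?T (k n)) - m\<^sup>2 *\<^sub>R k n)) \<longlonglongrightarrow> 0"
    by (auto dest!: tendsto_real_sqrt)
  then have "(\<lambda>n. ?S (?T (k n)) - m\<^sup>2 *\<^sub>R k n) \<longlonglongrightarrow> 0" by (rule tendsto_norm_zero_cancel)
  then have "(\<lambda>n. ?S (?T (k n)) - (?S (?T (k n)) - m\<^sup>2 *\<^sub>R k n)) \<longlonglongrightarrow> ?S x - 0"
    by (intro tendsto_diff STk)
  then have "(\<lambda>n. (1 / m\<^sup>2) *\<^sub>R (m\<^sup>2 *\<^sub>R k n)) \<longlonglongrightarrow> (1 / m\<^sup>2) *\<^sub>R ?S x"
    by (intro tendsto_scaleR tendsto_const) simp
  then have k_lim: "k \<longlonglongrightarrow> (1 / m\<^sup>2) *\<^sub>R ?S x" using m0 by simp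
  define y g where "y = ?S x" and "g = (1 / m\<^sup>2) *\<^sub>R y"
  have "(\<lambda>n. ?T (k n)) \<longlonglongrightarrow> ?T g" using resolvent_tendsto[of 1, OF _ k_lim] by (simp add: g_def y_def)
  then have x: "x = ?T g" using LIMSEQ_unique[OF Tk] by simp
  have xD: "x \<in> D" and Ax: "A x + imul x = g"
    using resolvent_D[of 1 g] resolvent_eq[of 1 g] by (auto simp: x)
  have yD: "y \<in> D" and Ay: "A y - imul y = x"
    using resolvent_D[of "-1" x] resolvent_eq[of "-1" x] by (auto simp: y_def)
  have AyD: "A y \<in> D" using Ay xD D_imul[OF yD] D_subspace(2) by (metis diff_add_cancel subspace_add)
  have AAy: "A (A y) = (1 / m\<^sup>2 - 1) *\<^sub>R y"
  proof -
    have "A (A y) - imul (A y) = A x" using Ay A_diff[OF AyD D_imul[OF yD]] by (simp add: A_imul yD)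
    moreover have "imul (A y) = imul x - y"
      using arg_cong[OF Ay, of imul] by (simp add: cvec.scale_right_diff_distrib) (metis add_diff_cancel_right')
    ultimately have "A (A y) = A x + imul x - y" by (metis add_diff_eq diff_eq_eq)
    then show ?thesis by (simp add: Ax g_def scaleR_left_diff_distrib)
  qed
  have y0: "y \<noteq> 0"
  proof
    assume "y = 0"
    then have "x = A 0" using Ay by simp
    moreover have "A 0 = 0" using A_scaleR[of 0 0] D_subspace(2) by (simp add: subspace_0)
    ultimately show False using x0 by simp
  qed
  have yW: "inner y z = 0" if z: "z \<in> eigenspace t" for z t
  proof -
    have "(\<lambda>n. inner (k n) z) \<longlonglongrightarrow> inner g z" using k_lim by (intro tendsto_intros) (simp add: g_def y_def)
    then have "inner g z = 0" using kW z by (simp add: W_def LIMSEQ_const_iff)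
    then show ?thesis using m0 by (simp add: g_def)
  qed
  define q where "q = sqrt (1 / m\<^sup>2 - 1)"
  have qn: "(1 / m\<^sup>2 - 1) * inner y y = inner (A y) (A y)"
    using A_symmetric[OF AyD yD] by (simp add: AAy)
  have "1 / m\<^sup>2 - 1 \<ge> 0"
  proof (rule ccontr)
    assume "\<not> ?thesis"
    then have "(1 / m\<^sup>2 - 1) * inner y y < 0" using y0 by (intro mult_neg_pos) auto
    then show False unfolding qn using inner_ge_zero[of "A y"] by linarith
  qed
  then have q2: "q * q = 1 / m\<^sup>2 - 1" unfolding q_def by simp
  have "A y + q *\<^sub>R y \<in> eigenspace q" using AyD yD D_subspace(2)
    by (simp add: eigenspace_def subspace_add subspace_scale A_add A_scaleR AAy scaleR_add_right add.commute flip: q2)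
  from yW[OF this] have e1: "inner y (A y) + q * inner y y = 0" by (simp add: inner_add_right)
  have "A y - q *\<^sub>R y \<in> eigenspace (- q)" using AyD yD D_subspace(2)
    by (simp add: eigenspace_def subspace_diff subspace_scale A_diff A_scaleR AAy scaleR_diff_right flip: q2)
  from yW[OF this] have e2: "inner y (A y) - q * inner y y = 0" by (simp add: inner_diff_right)
  have "q * inner y y = 0" using e1 e2 by linarith
  then have "q = 0" using y0 by simp
  then have "inner (A y) (A y) = 0" using qn q2 by (metis mult_zero_left)
  then have "y \<in> eigenspace 0" using yD by (simp add: eigenspace_def)
  from yW[OF this] y0 show False by simp
qed

lemma spec_space_UNIV: "spec_space UNIV = UNIV"
proof (rule ccontr)
  let ?M = "spec_space UNIV"
  assume "?M \<noteq> UNIV"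
  then obtain x where x: "x \<notin> ?M" by blast
  have "subspace ?M" "closed ?M" unfolding spec_space_def
    by (intro closure_subspace_real cvec_subspace_imp_subspace cvec.subspace_span) simp
  then obtain y where y: "y \<in> ?M" and orth: "\<And>z. z \<in> ?M \<Longrightarrow> inner (x - y) z = 0"
    using closed_subspace_orth_proj_exists[of ?M x] by auto
  have "eigenspace t \<subseteq> ?M" for t
  proof -
    have "eigenspace t \<subseteq> (\<Union>s\<in>UNIV. eigenspace s)" by blast
    also have "\<dots> \<subseteq> cvec.span \<dots>" by (rule cvec.span_superset)
    also have "\<dots> \<subseteq> closure \<dots>" by (rule closure_subset)
    finally show ?thesis by (simp only: spec_space_def)
  qed
  then have "x - y = 0" using orth by (intro orth_eigenspaces_imp_zero) blast
  then show False using x y by simp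
qed

end

end

theory Submission
  imports Defs
begin

text \<open>
  A family in the hybrid space \<open>H_check\<close> splits into its entries in the spectral set
  \<open>J = {..\<Lambda>}\<close> and the others.  As \<open>\<gamma>\<close> reverses the spectrum, the second part is \<open>\<gamma>\<close> of a family on the set \<open>opp J\<close> of
  those \<open>t\<close> with \<open>- t\<close> outside \<open>J\<close>, here \<open>{..<-\<Lambda>}\<close>.  So a boundary condition is a linear relation
  between families on \<open>J\<close> and families on \<open>opp J\<close>, and the theorem says that the elliptic ones are
  the graphs of operators \<open>g\<close>, up to finite-dimensional spaces.  Multiplication with suitable weights
  identifies the hybrid space with \<open>H\<close> in such a way that \<open>\<omega> x y\<close> becomes \<open>cinner x (\<gamma> y)\<close>.
  Therefore the annihilator is \<open>\<gamma>\<close> of an orthogonal complement, and a closed subspace is the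
  annihilator of its annihilator (\<open>biannihilator\<close>).

  For the first half of the theorem, the annihilator of a graph is computed entry by entry, by
  testing with eigenvectors (\<open>annihilator_graph_condition\<close>).  The result is again a graph of the same
  kind, with the roles of \<open>J\<close> and \<open>opp J\<close> exchanged and \<open>g\<close> replaced by its adjoint.  Hence the graph
  is itself an annihilator and so closed, and both it and its annihilator are regular by construction.

  For the second half, let \<open>B\<close> be elliptic.  By uniform boundedness the norm of \<open>sobolev (1/2)\<close> is
  bounded on \<open>B\<close> by the hybrid norm (\<open>regular_estimate\<close>), hence by the part on \<open>J\<close> up to the norm of
  \<open>sobolev (-1/2)\<close>, which is relatively compact.  Such an estimate has the usual consequences: the
  elements of \<open>B\<close> without entries in \<open>J\<close> form a finite-dimensional space \<open>\<gamma> F\<close>, modulo which \<open>B\<close> is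
  controlled by its entries in \<open>J\<close> (\<open>vecs_coercive\<close>), and the range of \<open>B\<close> on \<open>J\<close> is closed.  The same
  holds for the annihilator of \<open>B\<close>, with a finite-dimensional space \<open>\<gamma> E\<close>, and since the annihilator
  is regular the range of \<open>B\<close> on \<open>J\<close> consists of all regular vectors orthogonal to \<open>E\<close>
  (\<open>elliptic_range\<close>).  Modulo the two finite-dimensional spaces, this makes \<open>B\<close> the graph of an
  operator \<open>g0\<close> between regular vectors, and its annihilator the graph of an operator \<open>h0\<close> in the
  opposite direction.

  What remains is that \<open>g0\<close> is bounded for the norm of \<open>H\<close>, which is weaker than that of
  \<open>sobolev (1/2)\<close>.  Since \<open>\<omega>\<close> vanishes between \<open>B\<close> and its annihilator, \<open>g0\<close> and \<open>h0\<close> are adjoint to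
  each other in \<open>H\<close>, so \<open>h0 \<circ> g0\<close> is symmetric there.  A symmetric operator that is bounded for a
  stronger norm is bounded (\<open>symmetric_orbit_bound\<close>), and \<open>g0\<close> inherits the bound because
  \<open>(norm (g0 u))\<^sup>2\<close> is the inner product of \<open>u\<close> and \<open>h0 (g0 u)\<close>.
\<close>


section \<open>Complex Hilbert spaces\<close>

lemma cinner_add_right: "cinner x (y + z) = cinner x y + cinner x z"
  by (metis cinner_commute cinner_add_left complex_cnj_add)

lemma cinner_scaleR_left: "cinner (r *\<^sub>R x) y = of_real r * cinner x y"
  by (simp add: scaleR_scaleC cinner_scaleC_left)

lemma cinner_scaleR_right: "cinner x (r *\<^sub>R y) = of_real r * cinner x y"
  by (simp add: scaleR_scaleC cinner_scaleC_right)

lemma cinner_zero_left [simp]: "cinner 0 x = 0"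
  using cinner_scaleR_left[of 0 0 x] by simp

lemma cinner_zero_right [simp]: "cinner x 0 = 0"
  using cinner_scaleR_right[of x 0 0] by simp

lemma cinner_minus_left [simp]: "cinner (- x) y = - cinner x y"
  using cinner_scaleR_left[of "-1" x y] by simp

lemma cinner_minus_right [simp]: "cinner x (- y) = - cinner x y"
  using cinner_scaleR_right[of x "-1" y] by simp

lemma cinner_diff_left: "cinner (x - y) z = cinner x z - cinner y z"
  using cinner_add_left[of x "- y" z] by simp

lemma cinner_diff_right: "cinner x (y - z) = cinner x y - cinner x z"
  using cinner_add_right[of x y "- z"] by simp

lemma cinner_sum_left: "cinner (sum f S) y = (\<Sum>i\<in>S. cinner (f i) y)"
  by (induction S rule: infinite_finite_induct) (auto simp: cinner_add_left)

lemma cinner_sum_right: "cinner y (sum f S) = (\<Sum>i\<in>S. cinner y (f i))"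
  by (induction S rule: infinite_finite_induct) (auto simp: cinner_add_right)

lemma cinner_self: "cinner x x = of_real ((norm x)\<^sup>2)"
  by (simp add: cinner_eq_inner power2_norm_eq_inner complex_eq_iff)

lemma cinner_self_eq_0 [simp]: "cinner x x = 0 \<longleftrightarrow> x = 0"
  by (simp add: cinner_self)

lemma cinner_eq_0_commute: "cinner x y = 0 \<longleftrightarrow> cinner y x = 0"
  by (metis cinner_commute complex_cnj_zero)


lemma cinner_0_imp_inner_0: "cinner x y = 0 \<Longrightarrow> inner x y = 0"
  by (simp add: inner_eq_Re_cinner)

lemma norm_scaleC: "norm (c *\<^sub>C x) = cmod c * norm x"
proof -
  have "cinner (c *\<^sub>C x) (c *\<^sub>C x) = (c * cnj c) * cinner x x"
    by (simp add: cinner_scaleC_left cinner_scaleC_right)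
  also have "\<dots> = of_real ((cmod c)\<^sup>2 * (norm x)\<^sup>2)"
    by (simp only: complex_norm_square[symmetric] cinner_self of_real_mult of_real_power)
  finally have "cinner (c *\<^sub>C x) (c *\<^sub>C x) = of_real ((cmod c)\<^sup>2 * (norm x)\<^sup>2)" .
  then have "(norm (c *\<^sub>C x))\<^sup>2 = (cmod c * norm x)\<^sup>2"
    unfolding cinner_self of_real_eq_iff by (simp add: power_mult_distrib)
  then show ?thesis by (metis abs_norm_cancel mult_nonneg_nonneg norm_ge_zero power2_eq_imp_eq)
qed

lemma cmod_cinner_le: "cmod (cinner x y) \<le> norm x * norm y"
proof (cases "cinner x y = 0")
  case False
  define c where "c = cnj (cinner x y) / of_real (cmod (cinner x y))"
  have "cmod c = 1" using False by (simp add: c_def norm_divide)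
  have "c * cinner x y = of_real (cmod (cinner x y))"
    using False complex_norm_square[of "cinner x y"]
    by (simp add: c_def mult.commute power2_eq_square field_simps)
  then have "cmod (cinner x y) = inner (c *\<^sub>C x) y"
    by (simp add: inner_eq_Re_cinner cinner_scaleC_left)
  also have "\<dots> \<le> norm (c *\<^sub>C x) * norm y" by (rule norm_cauchy_schwarz)
  finally show ?thesis by (simp add: norm_scaleC \<open>cmod c = 1\<close>)
qed simp

lemma bounded_bilinear_cinner: "bounded_bilinear cinner"
proof
  show "\<exists>K. \<forall>a b. cmod (cinner a b) \<le> norm a * norm b * K"
    by (rule exI[of _ 1]) (simp add: cmod_cinner_le)
qed (simp_all add: cinner_add_left cinner_add_right cinner_scaleR_left cinner_scaleR_right scaleR_conv_of_real)

lemmas tendsto_cinner = bounded_bilinear.tendsto[OF bounded_bilinear_cinner]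

lemma bounded_linear_scaleC: "bounded_linear (\<lambda>x. c *\<^sub>C x)"
proof (rule bounded_linear_intro)
  show "norm (c *\<^sub>C x) \<le> norm x * cmod c" for x by (simp add: norm_scaleC)
qed (simp_all add: scaleC_add_right scaleR_scaleC scaleC_scaleC mult.commute)

lemmas tendsto_scaleC = bounded_linear.tendsto[OF bounded_linear_scaleC]

lemma closure_csubspace:
  assumes "cvec.subspace M" shows "cvec.subspace (closure M)"
proof -
  have r: "subspace (closure M)"
    by (intro closure_subspace_real cvec_subspace_imp_subspace assms)
  have "c *\<^sub>C x \<in> closure M" if "x \<in> closure M" for c x
  proof -
    obtain a where "\<And>n. a n \<in> M" "a \<longlonglongrightarrow> x" using \<open>x \<in> closure M\<close> by (auto simp: closure_sequential)
    then show ?thesis unfolding closure_sequential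
      by (intro exI[of _ "\<lambda>n. c *\<^sub>C a n"]) (auto intro!: tendsto_scaleC cvec.subspace_scale[OF assms])
  qed
  then show ?thesis using r unfolding subspace_def cvec.subspace_def by blast
qed

lemma orth_projection_exists:
  assumes M: "cvec.subspace M" "closed M"
  obtains y where "y \<in> M" "\<And>z. z \<in> M \<Longrightarrow> cinner (x - y) z = 0"
proof -
  obtain y where y: "y \<in> M" "\<And>z. z \<in> M \<Longrightarrow> inner (x - y) z = 0"
    using closed_subspace_orth_proj_exists[OF cvec_subspace_imp_subspace[OF M(1)] M(2), of x] by blast
  have "cinner (x - y) z = 0" if "z \<in> M" for z
    using y(2)[OF that] y(2)[OF cvec.subspace_scale[OF M(1) that, of \<i>]] by (simp add: cinner_eq_inner complex_eq_iff)
  with y(1) that show ?thesis by blast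
qed

lemma orth_proj_eqI:
  assumes "cvec.subspace M" "y \<in> M" "\<And>z. z \<in> M \<Longrightarrow> cinner (x - y) z = 0"
  shows "orth_proj M x = y"
  unfolding orth_proj_def
proof (rule the_equality)
  fix y' assume y': "y' \<in> M \<and> (\<forall>z\<in>M. cinner (x - y') z = 0)"
  have "y - y' \<in> M" using assms y' by (simp add: cvec.subspace_diff)
  then have "cinner (y - y') (y - y') = 0"
    using assms(3)[of "y - y'"] y' by (simp add: cinner_diff_left)
  then show "y' = y" by simp
qed (use assms in auto)

context
  fixes M :: "'a::chilbert_space set"
  assumes M: "cvec.subspace M" "closed M"
begin

lemma orth_proj_props: "orth_proj M x \<in> M \<and> (\<forall>z\<in>M. cinner (x - orth_proj M x) z = 0)"
proof -
  obtain y where y: "y \<in> M" "\<And>z. z \<in> M \<Longrightarrow> cinner (x - y) z = 0"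
    using orth_projection_exists[OF M, of x] by blast
  then have "orth_proj M x = y" by (intro orth_proj_eqI M(1))
  with y show ?thesis by auto
qed

lemma orth_proj_in: "orth_proj M x \<in> M"
  and orth_proj_orth: "z \<in> M \<Longrightarrow> cinner (x - orth_proj M x) z = 0"
  using orth_proj_props by auto

lemma cinner_orth_proj: "z \<in> M \<Longrightarrow> cinner (orth_proj M x) z = cinner x z"
  using orth_proj_orth[of z x] by (simp add: cinner_diff_left)

lemma orth_proj_add: "orth_proj M (x + y) = orth_proj M x + orth_proj M y"
  by (intro orth_proj_eqI M)
    (auto simp: cvec.subspace_add M(1) orth_proj_in cinner_diff_left cinner_add_left cinner_orth_proj)

lemma orth_proj_scaleC: "orth_proj M (c *\<^sub>C x) = c *\<^sub>C orth_proj M x"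
  by (intro orth_proj_eqI M)
    (auto simp: cvec.subspace_scale M(1) orth_proj_in cinner_diff_left cinner_scaleC_left cinner_orth_proj)

lemma norm_orth_proj_le: "norm (orth_proj M x) \<le> norm x"
proof -
  have "orthogonal (orth_proj M x) (x - orth_proj M x)"
    using orth_proj_orth[OF orth_proj_in, of x x]
    by (metis orthogonal_def inner_commute cinner_0_imp_inner_0)
  from norm_add_Pythagorean[OF this]
  have "(norm (orth_proj M x))\<^sup>2 \<le> (norm x)\<^sup>2" by simp
  then show ?thesis by (rule power2_le_imp_le) simp
qed

lemma bounded_linear_orth_proj: "bounded_linear (orth_proj M)"
  by (rule bounded_linear_intro[of _ 1])
    (auto simp: orth_proj_add orth_proj_scaleC norm_orth_proj_le scaleR_scaleC)

end

text \<open>Off the kernel of the functional there is a vector orthogonal to the kernel, and suitably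
  scaled it represents the functional.\<close>

lemma riesz_representation:
  fixes U :: "'a::chilbert_space set" and f :: "'a \<Rightarrow> complex"
  assumes U: "cvec.subspace U" "closed U"
    and add: "\<And>x y. x \<in> U \<Longrightarrow> y \<in> U \<Longrightarrow> f (x + y) = f x + f y"
    and scale: "\<And>c x. x \<in> U \<Longrightarrow> f (c *\<^sub>C x) = c * f x"
    and bound: "\<And>x. x \<in> U \<Longrightarrow> cmod (f x) \<le> K * norm x"
  obtains u where "u \<in> U" "\<And>x. x \<in> U \<Longrightarrow> f x = cinner x u"
proof (cases "\<forall>x\<in>U. f x = 0")
  case True
  with that[of 0] U show ?thesis by (auto simp: cvec.subspace_0)
next
  case False
  then obtain a where a: "a \<in> U" "f a \<noteq> 0" by blast
  have f_diff: "f (x - y) = f x - f y" if "x \<in> U" "y \<in> U" for x y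
    using add[OF cvec.subspace_diff[OF U(1) that] that(2)] by simp
  define N where "N = {x \<in> U. f x = 0}"
  have N: "cvec.subspace N" unfolding N_def
    using U(1) scale[of 0 0] by (auto simp: cvec.subspace_def add scale)
  moreover have "closed N" unfolding closed_sequential_limits
  proof (intro allI impI, elim conjE)
    fix s l assume s: "\<forall>n. s n \<in> N" "s \<longlonglongrightarrow> l"
    then have lU: "l \<in> U" using closed_sequentially[OF U(2)] by (auto simp: N_def)
    have "(\<lambda>n. K * norm (l - s n)) \<longlonglongrightarrow> K * norm (l - l)" by (intro tendsto_intros s(2))
    moreover have "cmod (f l) \<le> K * norm (l - s n)" for n
      using bound[OF cvec.subspace_diff[OF U(1) lU, of "s n"]] f_diff[OF lU, of "s n"] s(1)
      by (auto simp: N_def)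
    ultimately have "cmod (f l) \<le> 0" by (intro LIMSEQ_le_const[of _ 0]) auto
    with lU show "l \<in> N" by (simp add: N_def)
  qed
  ultimately obtain b where b: "b \<in> N" "\<And>z. z \<in> N \<Longrightarrow> cinner (a - b) z = 0"
    using orth_projection_exists[of N a] by blast
  define p where "p = a - b"
  have p: "p \<in> U" "f p \<noteq> 0" using a b(1) U(1) f_diff by (auto simp: p_def N_def cvec.subspace_diff)
  then have p0: "cinner p p \<noteq> 0" using scale[of 0 0] U(1) by (auto simp: cvec.subspace_0)
  define u where "u = cnj (f p / cinner p p) *\<^sub>C p"
  show ?thesis
  proof (rule that)
    show "u \<in> U" by (simp add: u_def cvec.subspace_scale U(1) p)
    fix x assume x: "x \<in> U"
    define q where "q = x - (f x / f p) *\<^sub>C p"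
    have "q \<in> N" using x p U(1) by (simp add: q_def N_def f_diff scale cvec.subspace_diff cvec.subspace_scale)
    then have "cinner q p = 0" using b(2) by (subst cinner_eq_0_commute) (simp add: p_def)
    then have "cinner x p = (f x / f p) * cinner p p"
      by (simp add: q_def cinner_diff_left cinner_scaleC_left)
    then show "f x = cinner x u" using p p0 by (simp add: u_def cinner_scaleC_right)
  qed
qed

lemma adjoint_betweenI:
  assumes "cvec.subspace U" "u \<in> U" "\<And>x. x \<in> U \<Longrightarrow> cinner (g x) v = cinner x u"
  shows "adjoint_between U g v = u"
  unfolding adjoint_between_def
proof (rule the_equality)
  fix u' assume u': "u' \<in> U \<and> (\<forall>x\<in>U. cinner (g x) v = cinner x u')"
  have "u' - u \<in> U" using u' assms by (simp add: cvec.subspace_diff)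
  then have "cinner (u' - u) (u' - u) = 0" using u' assms(3)[of "u' - u"] by (simp add: cinner_diff_right)
  then show "u' = u" by simp
qed (use assms in auto)

lemma adjoint_between_props:
  fixes U :: "'a::chilbert_space set"
  assumes U: "cvec.subspace U" "closed U" and g: "bounded_clinear_between U V g"
  shows "adjoint_between U g v \<in> U"
    and "x \<in> U \<Longrightarrow> cinner (g x) v = cinner x (adjoint_between U g v)"
proof -
  obtain K where K: "\<And>u. u \<in> U \<Longrightarrow> norm (g u) \<le> K * norm u"
    using g by (auto simp: bounded_clinear_between_def)
  have "cmod (cinner (g x) v) \<le> (K * norm v) * norm x" if "x \<in> U" for x
  proof -
    have "cmod (cinner (g x) v) \<le> norm (g x) * norm v" by (rule cmod_cinner_le)
    also have "\<dots> \<le> (K * norm x) * norm v" by (intro mult_right_mono K that) simp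
    finally show ?thesis by (simp add: mult_ac)
  qed
  then obtain u where u: "u \<in> U" "\<And>x. x \<in> U \<Longrightarrow> cinner (g x) v = cinner x u"
    using riesz_representation[OF U, of "\<lambda>x. cinner (g x) v" "K * norm v"] g
    by (auto simp: bounded_clinear_between_def clinear_on_def cinner_add_left cinner_scaleC_left)
  then have "adjoint_between U g v = u" by (intro adjoint_betweenI U)
  with u show "adjoint_between U g v \<in> U" 
    and "x \<in> U \<Longrightarrow> cinner (g x) v = cinner x (adjoint_between U g v)" by auto
qed


section \<open>Finite-dimensional subspaces\<close>

definition orthonormal :: "'a::chilbert_space set \<Rightarrow> bool" where
  "orthonormal S \<longleftrightarrow> (\<forall>x\<in>S. \<forall>y\<in>S. cinner x y = (if x = y then 1 else 0))"

definition fourier :: "'a::chilbert_space set \<Rightarrow> 'a \<Rightarrow> 'a" where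
  "fourier S x = (\<Sum>e\<in>S. cinner x e *\<^sub>C e)"

lemma fourier_in_span: "fourier S x \<in> cvec.span S"
  unfolding fourier_def by (intro cvec.span_sum cvec.span_scale cvec.span_base)

lemma cinner_span_zero:
  assumes "z \<in> cvec.span S" "\<And>e. e \<in> S \<Longrightarrow> cinner w e = 0"
  shows "cinner w z = 0"
  using assms(1)
  by (induction rule: cvec.span_induct_alt) (auto simp: cinner_add_right cinner_scaleC_right assms(2))

lemma fourier_orth:
  assumes S: "finite S" "orthonormal S" and z: "z \<in> cvec.span S"
  shows "cinner (x - fourier S x) z = 0"
proof (rule cinner_span_zero[OF z])
  fix e assume e: "e \<in> S"
  have "cinner (fourier S x) e = (\<Sum>f\<in>S. if f = e then cinner x e else 0)"
    unfolding fourier_def cinner_sum_left cinner_scaleC_left using S e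
    by (intro sum.cong) (auto simp: orthonormal_def)
  then show "cinner (x - fourier S x) e = 0" using e S(1) by (simp add: cinner_diff_left)
qed

lemma fourier_eq:
  assumes S: "finite S" "orthonormal S" and z: "z \<in> cvec.span S"
  shows "fourier S z = z"
proof -
  have "z - fourier S z \<in> cvec.span S" by (intro cvec.span_diff z fourier_in_span)
  from fourier_orth[OF S this, of z] have "z - fourier S z = 0" by (simp only: cinner_self_eq_0)
  then show ?thesis by simp
qed

lemma orthonormal_extend:
  assumes S: "finite S" "orthonormal S" and x: "x \<notin> cvec.span S"
  obtains y where "y \<notin> S" "orthonormal (insert y S)"
    "cvec.span (insert y S) = cvec.span (insert x S)"
proof -
  define z where "z = x - fourier S x"
  have z0: "z \<noteq> 0" using x fourier_in_span[of S x] by (auto simp: z_def)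
  define y where "y = of_real (1 / norm z) *\<^sub>C z"
  have orth: "cinner y e = 0" if "e \<in> S" for e
    using fourier_orth[OF S cvec.span_base[OF that], of x] by (simp add: y_def z_def cinner_scaleC_left)
  have yy: "cinner y y = 1"
    using z0 by (simp only: y_def cinner_scaleC_left cinner_scaleC_right cinner_self[of z])
      (simp add: power2_eq_square)
  have yS: "y \<notin> S" using orth yy by auto
  have on: "orthonormal (insert y S)" unfolding orthonormal_def
    using S(2) orth yy yS cinner_eq_0_commute[of y]
    by (auto simp: orthonormal_def)
  have f: "fourier S x \<in> cvec.span (insert w S)" for w
    using fourier_in_span[of S x] cvec.span_mono[of S "insert w S"] by blast
  have "y \<in> cvec.span (insert x S)" unfolding y_def z_def
    by (intro cvec.span_scale cvec.span_diff f cvec.span_base) simp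
  moreover have "x \<in> cvec.span (insert y S)"
  proof -
    have "x = of_real (norm z) *\<^sub>C y + fourier S x" using z0 by (simp add: y_def scaleC_scaleC) (simp add: z_def)
    also have "\<dots> \<in> cvec.span (insert y S)" by (intro cvec.span_add cvec.span_scale f cvec.span_base) simp
    finally show ?thesis .
  qed
  ultimately have "cvec.span (insert y S) = cvec.span (insert x S)"
    by (intro antisym cvec.span_minimal) (auto intro: cvec.span_base)
  with yS on that show ?thesis by blast
qed

lemma finite_dim_orthonormal_basis:
  assumes "finite_dim M"
  obtains S where "finite S" "orthonormal S" "cvec.span S = M"
proof -
  obtain b where b: "finite b" "M = cvec.span b" using assms by (auto simp: finite_dim_def)
  have "\<exists>S. finite S \<and> orthonormal S \<and> cvec.span S = cvec.span b" using b(1)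
  proof (induction b rule: finite_induct)
    case empty
    then show ?case by (intro exI[of _ "{}"]) (simp add: orthonormal_def)
  next
    case (insert x b)
    then obtain S where S: "finite S" "orthonormal S" "cvec.span S = cvec.span b" by blast
    have eq: "cvec.span (insert x S) = cvec.span (insert x b)"
      using S(3) cvec.span_Un[of "{x}" S] cvec.span_Un[of "{x}" b] by simp
    show ?case
    proof (cases "x \<in> cvec.span S")
      case True
      then show ?thesis using S eq cvec.span_redundant[OF True] by auto
    next
      case False
      then obtain y where "orthonormal (insert y S)" "cvec.span (insert y S) = cvec.span (insert x S)"
        using orthonormal_extend[OF S(1,2)] by blast
      then show ?thesis using S eq by (intro exI[of _ "insert y S"]) auto
    qed
  qed
  with b that show ?thesis by metis
qed

lemma finite_dim_subspace: "finite_dim M \<Longrightarrow> cvec.subspace M"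
  by (auto simp: finite_dim_def cvec.subspace_span)

text \<open>Riesz's criterion: in an infinite-dimensional space an infinite orthonormal sequence can be
  chosen, and its members keep distance at least one from each other.\<close>

lemma compact_imp_finite_dim:
  fixes M :: "'a::chilbert_space set"
  assumes M: "cvec.subspace M"
    and compact: "\<And>s. (\<And>n::nat. s n \<in> M \<and> norm (s n) \<le> 1) \<Longrightarrow> \<exists>r. strict_mono r \<and> Cauchy (s \<circ> r)"
  shows "finite_dim M"
proof (rule ccontr)
  assume inf: "\<not> finite_dim M"
  define P where "P = (\<lambda>S. finite S \<and> orthonormal S \<and> S \<subseteq> M)"
  have step: "\<exists>y. y \<notin> S \<and> P (insert y S)" if "P S" for S
  proof -
    have "cvec.span S \<subseteq> M" using that M by (intro cvec.span_minimal) (auto simp: P_def)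
    moreover have "cvec.span S \<noteq> M" using inf that by (auto simp: finite_dim_def P_def)
    ultimately obtain x where x: "x \<in> M" "x \<notin> cvec.span S" by blast
    have S: "finite S" "orthonormal S" using that by (auto simp: P_def)
    obtain y where y: "y \<notin> S" "orthonormal (insert y S)"
      "cvec.span (insert y S) = cvec.span (insert x S)"
      using orthonormal_extend[OF S x(2)] .
    have "y \<in> cvec.span (insert x S)" using y(3) cvec.span_base[of y "insert y S"] by auto
    moreover have "cvec.span (insert x S) \<subseteq> M" using that M x by (intro cvec.span_minimal) (auto simp: P_def)
    ultimately show ?thesis using that y by (auto simp: P_def)
  qed
  define pick where "pick S = (SOME y. y \<notin> S \<and> P (insert y S))" for S
  have pick: "pick S \<notin> S \<and> P (insert (pick S) S)" if "P S" for S
    unfolding pick_def by (rule someI_ex[OF step[OF that]])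
  define T where "T = rec_nat {} (\<lambda>_ S. insert (pick S) S)"
  have T: "T 0 = {}" "T (Suc n) = insert (pick (T n)) (T n)" for n by (simp_all add: T_def)
  have PT: "P (T n)" for n
    by (induction n) (use pick in \<open>auto simp: T, simp add: P_def orthonormal_def\<close>)
  define s where "s n = pick (T n)" for n
  have mono: "T m \<subseteq> T n" if "m \<le> n" for m n using that by (induction rule: dec_induct) (auto simp: T)
  have sT: "s m \<in> T n" if "m < n" for m n
    using mono[of "Suc m" n] that by (auto simp: T s_def)
  have sn: "s n \<in> M" "cinner (s n) (s n) = 1" for n
    using PT[of "Suc n"] by (auto simp: T s_def P_def orthonormal_def)
  have norm1: "norm (s n) = 1" for n
    using sn(2)[of n] unfolding cinner_self of_real_eq_1_iff by (simp add: power2_eq_1_iff) (use norm_ge_zero[of "s n"] in linarith)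
  have far: "1 \<le> norm (s m - s n)" if "m < n" for m n
  proof -
    have ne: "s m \<noteq> s n" using sT[OF that] pick[OF PT, of n] by (auto simp: s_def)
    have "s m \<in> T (Suc n)" "s n \<in> T (Suc n)" using that by (auto intro: sT)
    then have "cinner (s m) (s n) = 0" using PT[of "Suc n"] ne by (auto simp: P_def orthonormal_def)
    then have "orthogonal (s m) (- s n)" by (simp add: orthogonal_def cinner_0_imp_inner_0)
    from norm_add_Pythagorean[OF this] have "1\<^sup>2 \<le> (norm (s m - s n))\<^sup>2" by (simp add: norm1)
    then show ?thesis by (rule power2_le_imp_le) simp
  qed
  have "\<exists>r. strict_mono r \<and> Cauchy (s \<circ> r)" by (rule compact) (simp add: sn norm1)
  then obtain r where r: "strict_mono r" "Cauchy (s \<circ> r)" by blast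
  from CauchyD[OF r(2), of 1] obtain N where "\<forall>m\<ge>N. \<forall>n\<ge>N. norm ((s \<circ> r) m - (s \<circ> r) n) < 1" by auto
  then have "norm (s (r N) - s (r (Suc N))) < 1" by simp
  moreover have "r N < r (Suc N)" using r(1) by (simp add: strict_mono_def)
  ultimately show False using far[of "r N" "r (Suc N)"] by simp
qed


section \<open>Boundedness and extension of operators\<close>

text \<open>The Banach-Steinhaus theorem: by Baire's theorem one of the closed sets on which all
  \<open>f i\<close> are bounded by \<open>n\<close> contains a ball of \<open>M\<close>.\<close>

lemma uniform_boundedness:
  fixes f :: "'i \<Rightarrow> 'a::{real_normed_vector,complete_space} \<Rightarrow> 'b::real_normed_vector"
  assumes M: "subspace M" "closed M"
    and lin: "\<And>i. i \<in> I \<Longrightarrow> bounded_linear (f i)"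
    and ptw: "\<And>x. x \<in> M \<Longrightarrow> \<exists>K. \<forall>i\<in>I. norm (f i x) \<le> K"
  obtains K where "\<And>i x. i \<in> I \<Longrightarrow> x \<in> M \<Longrightarrow> norm (f i x) \<le> K * norm x"
proof -
  define T where "T n = {x \<in> M. \<forall>i\<in>I. norm (f i x) \<le> real n}" for n
  have "closed (T n)" for n
  proof -
    have "T n = M \<inter> (\<Inter>i\<in>I. {x. norm (f i x) \<le> real n})" by (auto simp: T_def)
    moreover have "closed {x. norm (f i x) \<le> real n}" if "i \<in> I" for i
      using linear_continuous_on[OF lin[OF that]] by (intro closed_Collect_le continuous_intros)
    ultimately show ?thesis using M by (simp add: closed_INT closed_Int)
  qed
  moreover have "T n \<subseteq> M" for n by (auto simp: T_def)
  ultimately have closedin: "closedin (top_of_set M) (T n)" for n by (simp add: closed_subset)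
  have "(\<Union>n. T n) = M"
  proof -
    have "\<exists>n. x \<in> T n" if x: "x \<in> M" for x
    proof -
      obtain K where K: "\<forall>i\<in>I. norm (f i x) \<le> K" using ptw[OF x] by blast
      obtain n where "K \<le> real n" using real_arch_simple by blast
      then show ?thesis using x K by (auto simp: T_def intro!: exI[of _ n] intro: order_trans)
    qed
    then show ?thesis by (auto simp: T_def)
  qed
  then have "(top_of_set M) interior_of (\<Union>(range T)) = M" by (metis interior_of_topspace topspace_euclidean_subtopology)
  then have "(top_of_set M) interior_of (\<Union>(range T)) \<noteq> {}" using M(1) subspace_0 by blast
  moreover have "completely_metrizable_space (top_of_set M)"
    using M(2) completely_metrizable_space_closedin completely_metrizable_space_euclidean
    by (metis closed_closedin)
  ultimately obtain n where "(top_of_set M) interior_of (T n) \<noteq> {}"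
    using Baire_category_alt[of "top_of_set M" "range T"] closedin by auto
  then obtain x0 W where W: "openin (top_of_set M) W" "x0 \<in> W" "W \<subseteq> T n" by (auto simp: interior_of_def)
  then obtain e where e: "e > 0" "ball x0 e \<inter> M \<subseteq> W"
    by (metis openin_contains_ball)
  have x0: "x0 \<in> M" using W by (auto simp: T_def)
  show ?thesis
  proof (rule that)
    fix i x assume i: "i \<in> I" and x: "x \<in> M"
    interpret bounded_linear "f i" by (rule lin[OF i])
    show "norm (f i x) \<le> (4 * real n / e) * norm x"
    proof (cases "x = 0")
      case False
      define y where "y = (e / (2 * norm x)) *\<^sub>R x"
      have "norm y = e / 2" using False e(1) by (simp add: y_def)
      then have "x0 + y \<in> ball x0 e" using e(1) by (simp add: dist_norm)
      moreover have "x0 + y \<in> M" unfolding y_def by (intro subspace_add subspace_scale M x x0)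
      ultimately have "x0 + y \<in> T n" "x0 \<in> T n" using e(2) W by blast+
      then have "norm (f i (x0 + y)) \<le> real n" "norm (f i x0) \<le> real n"
        using i by (auto simp: T_def)
      then have "norm (f i y) \<le> 2 * real n"
        using norm_triangle_ineq4[of "f i (x0 + y)" "f i x0"] by (simp add: add)
      moreover have "norm (f i y) = (e / (2 * norm x)) * norm (f i x)"
        using e(1) by (simp add: y_def scale)
      ultimately show ?thesis using False e(1) by (simp add: field_simps)
    qed (simp add: zero)
  qed
qed

text \<open>An operator that is symmetric for the inner product is bounded for it as soon as its powers
  grow at most geometrically along every orbit.  Indeed, by the Cauchy-Schwarz inequality the norms
  \<open>a n = norm ((T ^^ n) x)\<close> satisfy \<open>(a 1) ^ 2 ^ n \<le> a (2 ^ n) * (a 0) ^ (2 ^ n - 1)\<close>, and taking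
  roots of order \<open>2 ^ n\<close> removes the constant \<open>K\<close>, which may depend on the orbit.\<close>

lemma symmetric_orbit_bound:
  fixes T :: "'a::real_inner \<Rightarrow> 'a"
  assumes inv: "\<And>x. x \<in> M \<Longrightarrow> T x \<in> M"
    and sym: "\<And>x y. x \<in> M \<Longrightarrow> y \<in> M \<Longrightarrow> inner (T x) y = inner x (T y)"
    and growth: "\<And>n. norm ((T ^^ n) x) \<le> K * R ^ n"
    and x: "x \<in> M" and R: "R > 0"
  shows "norm (T x) \<le> R * norm x"
proof (cases "norm x = 0")
  case True
  then have "inner (T x) (T x) = inner (T (T x)) 0" using sym[of "T x" x] inv x by (simp add: inner_commute)
  then show ?thesis using True by simp
next
  case False
  then have x0: "norm x > 0" by simp
  have inM: "(T ^^ n) x \<in> M" for n by (induction n) (auto simp: inv x)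
  have symn: "inner ((T ^^ n) y) z = inner y ((T ^^ n) z)" if "y \<in> M" "z \<in> M" for n y z
    using that
  proof (induction n arbitrary: y z)
    case (Suc n)
    have "(T ^^ n) w \<in> M" if "w \<in> M" for w using that by (induction n) (auto simp: inv)
    then have "inner ((T ^^ Suc n) y) z = inner ((T ^^ n) y) (T z)" using Suc.prems by (simp add: sym)
    also have "\<dots> = inner y ((T ^^ n) (T z))" using Suc inv by blast
    finally show ?case by (simp add: funpow_swap1)
  qed simp
  have doubling: "(norm ((T ^^ n) x))\<^sup>2 \<le> norm ((T ^^ (2 * n)) x) * norm x" for n
  proof -
    have "(norm ((T ^^ n) x))\<^sup>2 = inner ((T ^^ n) ((T ^^ n) x)) x"
      using symn[OF inM x, of n n] by (simp add: power2_norm_eq_inner)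
    also have "\<dots> = inner ((T ^^ (2 * n)) x) x" by (simp add: mult_2 funpow_add)
    also have "\<dots> \<le> norm ((T ^^ (2 * n)) x) * norm x" by (rule norm_cauchy_schwarz)
    finally show ?thesis .
  qed
  define q where "q n = norm ((T ^^ n) x) / norm x" for n
  have q0: "q n \<ge> 0" for n by (simp add: q_def)
  have q2: "(q n)\<^sup>2 \<le> q (2 * n)" for n
    using doubling[of n] x0 by (simp add: q_def power_divide power2_eq_square field_simps)
  have qpow: "(q 1) ^ (2 ^ n) \<le> q (2 ^ n)" for n
  proof (induction n)
    case (Suc n)
    have "(q 1) ^ (2 ^ Suc n) = ((q 1) ^ (2 ^ n))\<^sup>2" by (simp add: power_mult[symmetric] mult.commute)
    also have "\<dots> \<le> (q (2 ^ n))\<^sup>2" by (intro power_mono Suc) (simp add: q0)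
    also have "\<dots> \<le> q (2 ^ Suc n)" using q2[of "2 ^ n"] by simp
    finally show ?case .
  qed simp
  have K: "(q 1 / R) ^ (2 ^ n) \<le> K / norm x" for n
  proof -
    have "(q 1) ^ (2 ^ n) \<le> q (2 ^ n)" by (rule qpow)
    also have "\<dots> \<le> K * R ^ (2 ^ n) / norm x" unfolding q_def by (intro divide_right_mono growth) simp
    finally show ?thesis using R by (simp add: power_divide field_simps)
  qed
  have "q 1 \<le> R"
  proof (rule ccontr)
    assume "\<not> ?thesis"
    then have "1 < q 1 / R" using R by simp
    then obtain n where n: "K / norm x < (q 1 / R) ^ n" using real_arch_pow by blast
    also have "(q 1 / R) ^ n \<le> (q 1 / R) ^ (2 ^ n)"
      using \<open>1 < q 1 / R\<close> by (intro power_increasing less_imp_le[OF less_exp]) simp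
    finally show False using K[of n] by simp
  qed
  then show ?thesis using x0 by (simp add: q_def field_simps)
qed

text \<open>The value \<open>g u\<close> is determined by its pairings with \<open>V1\<close>, so no choice of approximating
  sequence enters and linearity is automatic.\<close>

lemma bounded_extension:
  fixes U V U1 V1 :: "'a::chilbert_space set"
  assumes U: "cvec.subspace U" and V: "cvec.subspace V" "closed V"
    and dense: "\<And>u. u \<in> U \<Longrightarrow> \<exists>s. (\<forall>n. s n \<in> U1) \<and> s \<longlonglongrightarrow> u"
    and test: "\<And>d. d \<in> V \<Longrightarrow> (\<And>v. v \<in> V1 \<Longrightarrow> cinner d v = 0) \<Longrightarrow> d = 0"
    and U1: "cvec.subspace U1" "U1 \<subseteq> U"
    and g0: "\<And>u. u \<in> U1 \<Longrightarrow> g0 u \<in> V" "\<And>u. u \<in> U1 \<Longrightarrow> norm (g0 u) \<le> R * norm u"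
    and adj: "\<And>u v. u \<in> U1 \<Longrightarrow> v \<in> V1 \<Longrightarrow> cinner (g0 u) v = cinner u (h0 v)"
  shows "\<exists>g. bounded_clinear_between U V g \<and> (\<forall>u\<in>U1. g u = g0 u) \<and>
    (\<forall>u\<in>U. \<forall>v\<in>V1. cinner (g u) v = cinner u (h0 v))"
proof -
  have uniq: "y = y'" if "y \<in> V" "y' \<in> V" "\<And>v. v \<in> V1 \<Longrightarrow> cinner y v = cinner y' v" for y y'
    using test[of "y - y'"] that V(1) by (simp add: cvec.subspace_diff cinner_diff_left)
  have g0_diff: "g0 (u - u') = g0 u - g0 u'" if "u \<in> U1" "u' \<in> U1" for u u'
    using that U1(1) V(1) g0(1)
    by (intro uniq) (auto simp: cvec.subspace_diff adj cinner_diff_left)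
  define P where "P u y \<longleftrightarrow> y \<in> V \<and> norm y \<le> R * norm u \<and> (\<forall>v\<in>V1. cinner y v = cinner u (h0 v))" for u y
  have "\<exists>y. P u y" if u: "u \<in> U" for u
  proof -
    obtain s where s: "\<And>n. s n \<in> U1" "s \<longlonglongrightarrow> u" using dense[OF u] by blast
    have diff: "norm (g0 (s m) - g0 (s n)) \<le> \<bar>R\<bar> * norm (s m - s n)" for m n
    proof -
      have "norm (g0 (s m - s n)) \<le> R * norm (s m - s n)"
        by (intro g0(2) cvec.subspace_diff[OF U1(1)] s(1))
      also have "\<dots> \<le> \<bar>R\<bar> * norm (s m - s n)" by (intro mult_right_mono) auto
      finally show ?thesis by (simp add: g0_diff s(1))
    qed
    have "Cauchy (\<lambda>n. g0 (s n))"
    proof (rule CauchyI)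
      fix e :: real assume e: "e > 0"
      then have "e / (\<bar>R\<bar> + 1) > 0" by simp
      from CauchyD[OF LIMSEQ_imp_Cauchy[OF s(2)] this]
      obtain M where M: "\<forall>m\<ge>M. \<forall>n\<ge>M. norm (s m - s n) < e / (\<bar>R\<bar> + 1)" by blast
      have "norm (g0 (s m) - g0 (s n)) < e" if "m \<ge> M" "n \<ge> M" for m n
      proof -
        have "norm (s m - s n) \<le> e / (\<bar>R\<bar> + 1)" using M that by (simp add: less_imp_le)
        then have "\<bar>R\<bar> * norm (s m - s n) \<le> \<bar>R\<bar> * (e / (\<bar>R\<bar> + 1))" by (rule mult_left_mono) simp
        with diff have "norm (g0 (s m) - g0 (s n)) \<le> \<bar>R\<bar> * (e / (\<bar>R\<bar> + 1))" by (rule order_trans)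
        also have "\<dots> < e" using e by (simp add: field_simps)
        finally show ?thesis .
      qed
      then show "\<exists>M. \<forall>m\<ge>M. \<forall>n\<ge>M. norm (g0 (s m) - g0 (s n)) < e" by blast
    qed
    then obtain y where y: "(\<lambda>n. g0 (s n)) \<longlonglongrightarrow> y" using Cauchy_convergent_iff convergent_def by blast
    have "y \<in> V" by (rule closed_sequentially[OF V(2) _ y]) (simp add: g0 s)
    moreover have "norm y \<le> R * norm u"
    proof (rule LIMSEQ_le)
      show "(\<lambda>n. norm (g0 (s n))) \<longlonglongrightarrow> norm y" by (intro tendsto_norm y)
      show "(\<lambda>n. R * norm (s n)) \<longlonglongrightarrow> R * norm u" by (intro tendsto_intros s)
      show "\<exists>N. \<forall>n\<ge>N. norm (g0 (s n)) \<le> R * norm (s n)" by (simp add: g0 s)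
    qed
    moreover have "cinner y v = cinner u (h0 v)" if v: "v \<in> V1" for v
    proof (rule LIMSEQ_unique)
      show "(\<lambda>n. cinner (g0 (s n)) v) \<longlonglongrightarrow> cinner y v" by (intro tendsto_cinner y tendsto_const)
      show "(\<lambda>n. cinner (g0 (s n)) v) \<longlonglongrightarrow> cinner u (h0 v)"
        unfolding adj[OF s(1) v] by (intro tendsto_cinner s tendsto_const)
    qed
    ultimately have "P u y" by (simp add: P_def)
    then show ?thesis by blast
  qed
  then obtain g where g: "\<And>u. u \<in> U \<Longrightarrow> P u (g u)" by metis
  have gV: "g u \<in> V" and gR: "norm (g u) \<le> R * norm u"
    and gadj: "v \<in> V1 \<Longrightarrow> cinner (g u) v = cinner u (h0 v)" if "u \<in> U" for u v
    using g[OF that] by (auto simp: P_def)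
  have "clinear_on U g" unfolding clinear_on_def
  proof (intro conjI ballI allI)
    show "g (x + y) = g x + g y" if "x \<in> U" "y \<in> U" for x y
      using that U V(1) by (intro uniq) (auto simp: cvec.subspace_add gV gadj cinner_add_left)
    show "g (c *\<^sub>C x) = c *\<^sub>C g x" if "x \<in> U" for c x
      using that U V(1) by (intro uniq) (auto simp: cvec.subspace_scale gV gadj cinner_scaleC_left)
  qed
  then have "bounded_clinear_between U V g"
    using gV gR by (auto simp: bounded_clinear_between_def)
  moreover have "g u = g0 u" if "u \<in> U1" for u
    using that U1(2) by (intro uniq) (auto simp: gV gadj g0 adj)
  ultimately show ?thesis using gadj by blast
qed

context dirac_system
begin

section \<open>The eigenvector expansion\<close>

lemma eigenspace_csubspace: "cvec.subspace (eigenspace t)"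
proof -
  have "A 0 = 0" using A_scaleC[of 0 0] D_subspace(1) by (simp add: cvec.subspace_0)
  then show ?thesis unfolding cvec.subspace_def eigenspace_def using D_subspace(1)
    by (auto simp: cvec.subspace_0 cvec.subspace_add cvec.subspace_scale A_add A_scaleC
        scaleC_add_right scaleR_scaleC scaleC_scaleC mult.commute)
qed

lemma eigenspace_closed: "closed (eigenspace t)"
proof -
  have "eigenspace t = (\<Inter>z\<in>D. {x. inner (A z) x = inner z (t *\<^sub>R x)})"
  proof (intro antisym subsetI)
    fix x assume "x \<in> eigenspace t"
    then show "x \<in> (\<Inter>z\<in>D. {x. inner (A z) x = inner z (t *\<^sub>R x)})"
      by (auto simp: eigenspace_def A_symmetric)
  next
    fix x assume "x \<in> (\<Inter>z\<in>D. {x. inner (A z) x = inner z (t *\<^sub>R x)})"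
    then have "inner (A z) x = inner z (t *\<^sub>R x)" if "z \<in> D" for z using that by blast
    from A_maximal[OF this] show "x \<in> eigenspace t" by (simp add: eigenspace_def)
  qed
  then show ?thesis by (auto intro!: closed_INT closed_Collect_eq continuous_intros)
qed

lemmas eigenspace_0 [simp] = cvec.subspace_0[OF eigenspace_csubspace]

lemma eigenspace_scaleC: "x \<in> eigenspace t \<Longrightarrow> c *\<^sub>C x \<in> eigenspace t"
  by (rule cvec.subspace_scale[OF eigenspace_csubspace])

lemma eigenspace_scaleR: "x \<in> eigenspace t \<Longrightarrow> r *\<^sub>R x \<in> eigenspace t"
  by (simp add: scaleR_scaleC eigenspace_scaleC)

lemma A_csymmetric: "x \<in> D \<Longrightarrow> y \<in> D \<Longrightarrow> cinner (A x) y = cinner x (A y)"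
  using A_self_adjoint by (auto simp: self_adjoint_def)

lemma eigenspace_orth:
  assumes "x \<in> eigenspace s" "y \<in> eigenspace t" "s \<noteq> t"
  shows "cinner x y = 0"
proof -
  have "s * cinner x y = t * cinner x y"
    using A_csymmetric[of x y] assms
    by (simp add: eigenspace_def cinner_scaleR_left cinner_scaleR_right)
  then show ?thesis using assms(3) by simp
qed

lemma spec_space_singleton: "spec_space {t} = eigenspace t"
  by (simp add: spec_space_def cvec.span_eq_iff[THEN iffD2, OF eigenspace_csubspace] eigenspace_closed)

lemma coeffs_eq_orth_proj: "coeffs x t = orth_proj (eigenspace t) x"
  by (simp add: coeffs_def spec_proj_def spec_space_singleton)

lemma coeffs_in [simp]: "coeffs x t \<in> eigenspace t"
  by (simp add: coeffs_eq_orth_proj orth_proj_in eigenspace_csubspace eigenspace_closed)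

lemma cinner_coeffs: "z \<in> eigenspace t \<Longrightarrow> cinner (coeffs x t) z = cinner x z"
  by (simp add: coeffs_eq_orth_proj cinner_orth_proj eigenspace_csubspace eigenspace_closed)

lemma coeffs_eqI:
  assumes "y \<in> eigenspace t" "\<And>z. z \<in> eigenspace t \<Longrightarrow> cinner x z = cinner y z"
  shows "coeffs x t = y"
  unfolding coeffs_eq_orth_proj using assms
  by (intro orth_proj_eqI eigenspace_csubspace) (auto simp: cinner_diff_left)

lemma coeffs_linear: "bounded_linear (\<lambda>x. coeffs x t)"
  unfolding coeffs_eq_orth_proj by (intro bounded_linear_orth_proj eigenspace_csubspace eigenspace_closed)

lemma coeffs_add: "coeffs (x + y) t = coeffs x t + coeffs y t"
  and coeffs_diff: "coeffs (x - y) t = coeffs x t - coeffs y t"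
  and coeffs_minus: "coeffs (- x) t = - coeffs x t"
  and coeffs_scaleR: "coeffs (r *\<^sub>R x) t = r *\<^sub>R coeffs x t"
  and coeffs_zero [simp]: "coeffs 0 t = 0"
  and coeffs_sum: "coeffs (sum f S) t = (\<Sum>i\<in>S. coeffs (f i) t)"
  by (simp_all add: linear_simps[OF coeffs_linear] Real_Vector_Spaces.linear_sum[OF bounded_linear.linear[OF coeffs_linear]])

lemma coeffs_scaleC: "coeffs (c *\<^sub>C x) t = c *\<^sub>C coeffs x t"
  by (simp add: coeffs_eq_orth_proj orth_proj_scaleC eigenspace_csubspace eigenspace_closed)

lemma coeffs_eigenvector: "x \<in> eigenspace s \<Longrightarrow> coeffs x t = (if t = s then x else 0)"
  by (intro coeffs_eqI) (auto simp: eigenspace_orth)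

lemma coeffs_inject: "(\<And>t. coeffs x t = coeffs y t) \<Longrightarrow> x = y"
proof -
  assume eq: "\<And>t. coeffs x t = coeffs y t"
  have "inner (x - y) z = 0" if "z \<in> eigenspace t" for z t
    using cinner_coeffs[OF that, of "x - y"] eq by (simp add: coeffs_diff cinner_0_imp_inner_0)
  from orth_eigenspaces_imp_zero[OF this] show "x = y" by simp
qed

lemma norm_sum_eigenvectors:
  assumes "finite F" "\<And>t. t \<in> F \<Longrightarrow> x t \<in> eigenspace t"
  shows "(norm (\<Sum>t\<in>F. x t))\<^sup>2 = (\<Sum>t\<in>F. (norm (x t))\<^sup>2)"
  using assms by (intro norm_sum_Pythagorean)
    (auto simp: pairwise_def orthogonal_def intro!: cinner_0_imp_inner_0 intro: eigenspace_orth)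

definition ell2 :: "(real \<Rightarrow> 'a) \<Rightarrow> bool" where
  "ell2 x \<longleftrightarrow> (\<forall>t. x t \<in> eigenspace t) \<and> (\<lambda>t. (norm (x t))\<^sup>2) summable_on UNIV"

lemma ell2_compare:
  assumes "ell2 y" "\<And>t. x t \<in> eigenspace t" "\<And>t. norm (x t) \<le> norm (y t)"
  shows "ell2 x"
proof -
  have "(\<lambda>t. (norm (x t))\<^sup>2) summable_on UNIV"
    by (rule summable_on_comparison_test[of "\<lambda>t. (norm (y t))\<^sup>2"])
      (use assms in \<open>auto simp: ell2_def intro: power_mono\<close>)
  then show ?thesis using assms(2) by (simp add: ell2_def)
qed

text \<open>Partial sums over finite sets that exhaust the square norm form a Cauchy sequence.\<close>

lemma riesz_fischer:
  assumes x: "ell2 x"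
  obtains h where "coeffs h = x" "((\<lambda>t. (norm (x t))\<^sup>2) has_sum (norm h)\<^sup>2) UNIV"
proof -
  define q where "q t = (norm (x t))\<^sup>2" for t
  define S where "S = infsum q UNIV"
  have xe: "x t \<in> eigenspace t" for t using x by (simp add: ell2_def)
  have hs: "(q has_sum S) UNIV" using x by (simp add: S_def q_def[abs_def] ell2_def)
  have "\<exists>F. finite F \<and> F \<subseteq> UNIV \<and> dist (sum q F) S \<le> 1 / real (Suc n)" for n
    by (rule has_sum_finite_approximation[OF hs]) simp
  then obtain F where F: "\<And>n. finite (F n)" "\<And>n. dist (sum q (F n)) S \<le> 1 / real (Suc n)" by metis
  define G where "G n = (\<Union>k\<le>n. F k)" for n
  have finG: "finite (G n)" for n using F by (simp add: G_def)
  have monoG: "G m \<subseteq> G n" if "m \<le> n" for m n using that by (auto simp: G_def intro: order_trans)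
  have le_S: "sum q E \<le> S" if "finite E" for E
    by (rule finite_sum_le_has_sum[OF hs]) (use that in \<open>auto simp: q_def\<close>)
  have tail: "S - sum q (G n) \<le> 1 / real (Suc n)" for n
  proof -
    have "sum q (F n) \<le> sum q (G n)" by (intro sum_mono2 finG) (auto simp: G_def q_def)
    then show ?thesis using F(2)[of n] by (simp add: dist_real_def)
  qed
  have rest: "sum q E \<le> 1 / real (Suc n)" if "finite E" "E \<inter> G n = {}" for E n
  proof -
    have "sum q E + sum q (G n) = sum q (E \<union> G n)" using that finG by (simp add: sum.union_disjoint)
    then show ?thesis using le_S[of "E \<union> G n"] tail[of n] that(1) finG by simp
  qed
  define s where "s n = (\<Sum>t\<in>G n. x t)" for n
  have diff: "(norm (s n - s m))\<^sup>2 \<le> 1 / real (Suc m)" if "m \<le> n" for m n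
  proof -
    have "s n - s m = (\<Sum>t\<in>G n - G m. x t)"
      unfolding s_def using sum_diff[OF finG monoG[OF that], of x] by simp
    then have "(norm (s n - s m))\<^sup>2 = sum q (G n - G m)"
      unfolding q_def using finG xe by (simp add: norm_sum_eigenvectors)
    also have "\<dots> \<le> 1 / real (Suc m)" using finG by (intro rest) auto
    finally show ?thesis .
  qed
  have "Cauchy s"
  proof (rule CauchyI')
    fix e :: real assume e: "e > 0"
    obtain M where M: "inverse (real (Suc M)) < e\<^sup>2" using e reals_Archimedean[of "e\<^sup>2"] by auto
    have "norm (s m - s n) < e" if "M \<le> m" "m < n" for m n
    proof -
      have "(norm (s n - s m))\<^sup>2 \<le> 1 / real (Suc m)" using diff that by simp
      also have "\<dots> \<le> inverse (real (Suc M))" using that by (simp add: field_simps)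
      finally have "(norm (s n - s m))\<^sup>2 < e\<^sup>2" using M by simp
      then show ?thesis using e by (simp add: power_less_imp_less_base norm_minus_commute)
    qed
    then show "\<exists>M. \<forall>m\<ge>M. \<forall>n>m. dist (s m) (s n) < e" by (auto simp: dist_norm)
  qed
  then obtain h where h: "s \<longlonglongrightarrow> h" using Cauchy_convergent_iff convergent_def by blast
  have inv0: "(\<lambda>n. 1 / real (Suc n)) \<longlonglongrightarrow> 0" using LIMSEQ_inverse_real_of_nat by (simp add: inverse_eq_divide)
  have "coeffs h t = x t" for t
  proof -
    have c: "coeffs (s n) t = (if t \<in> G n then x t else 0)" for n
      using finG by (simp add: s_def coeffs_sum coeffs_eigenvector[OF xe])
    have "(\<lambda>n. (norm (x t - coeffs (s n) t))\<^sup>2) \<longlonglongrightarrow> 0"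
    proof (rule Lim_null_comparison[OF _ inv0], intro always_eventually allI)
      show "norm ((norm (x t - coeffs (s n) t))\<^sup>2) \<le> 1 / real (Suc n)" for n
        using rest[of "{t}" n] by (auto simp: c q_def)
    qed
    then have "(\<lambda>n. norm (x t - coeffs (s n) t)) \<longlonglongrightarrow> 0" by (auto dest!: tendsto_real_sqrt)
    then have "(\<lambda>n. x t - (x t - coeffs (s n) t)) \<longlonglongrightarrow> x t - 0"
      by (rule tendsto_diff[OF tendsto_const tendsto_norm_zero_cancel])
    moreover have "(\<lambda>n. coeffs (s n) t) \<longlonglongrightarrow> coeffs h t" by (rule bounded_linear.tendsto[OF coeffs_linear h])
    ultimately show ?thesis using LIMSEQ_unique[of "\<lambda>n. coeffs (s n) t"] by simp
  qed
  moreover have "S = (norm h)\<^sup>2"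
  proof -
    have "(norm (s n))\<^sup>2 = sum q (G n)" for n
      using finG xe by (simp add: s_def q_def norm_sum_eigenvectors)
    then have "norm (S - (norm (s n))\<^sup>2) \<le> 1 / real (Suc n)" for n
      using tail[of n] le_S[OF finG, of n] by simp
    then have "(\<lambda>n. S - (norm (s n))\<^sup>2) \<longlonglongrightarrow> 0" by (intro Lim_null_comparison[OF _ inv0]) simp
    moreover have "(\<lambda>n. S - (norm (s n))\<^sup>2) \<longlonglongrightarrow> S - (norm h)\<^sup>2" by (intro tendsto_intros h)
    ultimately have "S - (norm h)\<^sup>2 = 0" using LIMSEQ_unique by blast
    then show ?thesis by simp
  qed
  ultimately show ?thesis using that[of h] hs unfolding q_def[abs_def] by blast
qed

text \<open>By Bessel's inequality the components of \<open>h\<close> are square-summable, hence the components of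
  some vector, which is \<open>h\<close> because the eigenvectors are total.\<close>

lemma parseval: "((\<lambda>t. (norm (coeffs h t))\<^sup>2) has_sum (norm h)\<^sup>2) UNIV"
proof -
  have bessel: "(\<Sum>t\<in>F. (norm (coeffs h t))\<^sup>2) \<le> (norm h)\<^sup>2" if F: "finite F" for F
  proof -
    define p where "p = (\<Sum>t\<in>F. coeffs h t)"
    have "cinner (coeffs h t) (h - p) = 0" if t: "t \<in> F" for t
    proof -
      have "cinner p (coeffs h t) = (\<Sum>s\<in>F. if s = t then cinner h (coeffs h t) else 0)"
        unfolding p_def cinner_sum_left
        by (intro sum.cong) (auto simp: cinner_coeffs intro: eigenspace_orth[OF coeffs_in coeffs_in])
      then have "cinner (h - p) (coeffs h t) = 0" using F t by (simp add: cinner_diff_left)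
      then show ?thesis by (subst cinner_eq_0_commute)
    qed
    then have "cinner (\<Sum>t\<in>F. coeffs h t) (h - p) = 0" unfolding cinner_sum_left by (intro sum.neutral ballI)
    then have "cinner p (h - p) = 0" by (simp only: p_def[symmetric])
    then have "orthogonal p (h - p)" by (simp add: orthogonal_def cinner_0_imp_inner_0)
    from norm_add_Pythagorean[OF this] have "(norm p)\<^sup>2 \<le> (norm h)\<^sup>2" by simp
    then show ?thesis using F by (simp add: p_def norm_sum_eigenvectors)
  qed
  have "(\<lambda>t. (norm (coeffs h t))\<^sup>2) summable_on UNIV"
  proof (rule nonneg_bdd_above_summable_on)
    show "bdd_above (sum (\<lambda>t. (norm (coeffs h t))\<^sup>2) ` {F. F \<subseteq> UNIV \<and> finite F})"
      using bessel by (intro bdd_aboveI[of _ "(norm h)\<^sup>2"]) blast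
  qed simp
  then have "ell2 (coeffs h)" by (simp add: ell2_def)
  then obtain k where k: "coeffs k = coeffs h" "((\<lambda>t. (norm (coeffs h t))\<^sup>2) has_sum (norm k)\<^sup>2) UNIV"
    by (rule riesz_fischer)
  have "k = h" by (rule coeffs_inject) (simp add: k(1))
  with k show ?thesis by simp
qed

lemma ell2_coeffs [simp]: "ell2 (coeffs h)"
  using parseval[of h] by (auto simp: ell2_def summable_on_def)

lemma parseval_cinner: "((\<lambda>t. cinner (coeffs h t) (coeffs k t)) has_sum cinner h k) UNIV"
proof -
  have inner: "((\<lambda>t. inner (coeffs h t) (coeffs k t)) has_sum inner h k) UNIV" for h k
  proof -
    have pol: "inner x y = (1/4) * ((norm (x + y))\<^sup>2 + - (norm (x - y))\<^sup>2)" for x y :: 'a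
      by (simp add: power2_norm_eq_inner inner_add_left inner_add_right inner_diff_left inner_diff_right inner_commute[of y x])
    show ?thesis unfolding pol coeffs_add[symmetric] coeffs_diff[symmetric]
      by (intro has_sum_cmult_right has_sum_add has_sum_uminusI parseval)
  qed
  have c: "cinner x y = of_real (inner x y) + \<i> * of_real (inner x (imul y))" for x y :: 'a
    by (simp add: cinner_eq_inner complex_eq_iff)
  show ?thesis unfolding c coeffs_scaleC[symmetric]
    by (intro has_sum_add has_sum_cmult_right has_sum_of_real inner)
qed

lemma norm_le_coeffwise:
  assumes "\<And>t. norm (coeffs x t) \<le> norm (coeffs y t)"
  shows "norm x \<le> norm y"
proof -
  have "(norm x)\<^sup>2 \<le> (norm y)\<^sup>2"
    by (rule has_sum_mono[OF parseval parseval]) (simp add: assms power_mono)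
  then show ?thesis by (rule power2_le_imp_le) simp
qed


definition of_coeffs :: "(real \<Rightarrow> 'a) \<Rightarrow> 'a" where
  "of_coeffs x = (SOME h. coeffs h = x)"

lemma coeffs_of_coeffs: "ell2 x \<Longrightarrow> coeffs (of_coeffs x) = x"
  unfolding of_coeffs_def by (rule someI_ex) (metis riesz_fischer)

lemma of_coeffs_eqI: "coeffs h = x \<Longrightarrow> of_coeffs x = h"
  by (rule coeffs_inject) (use coeffs_of_coeffs[OF ell2_coeffs, of h] in auto)

lemma of_coeffs_coeffs [simp]: "of_coeffs (coeffs h) = h"
  by (rule of_coeffs_eqI) simp

lemma norm_of_coeffs: "ell2 x \<Longrightarrow> (norm (of_coeffs x))\<^sup>2 = (\<Sum>\<^sub>\<infinity>t. (norm (x t))\<^sup>2)"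
  using infsumI[OF parseval[of "of_coeffs x"]] by (simp add: coeffs_of_coeffs)


section \<open>Spectral subspaces\<close>

text \<open>Projecting a vector without components outside \<open>J\<close> onto the closed span of the eigenspaces
  in \<open>J\<close> changes none of its components.\<close>

lemma spec_space_eq: "spec_space J = {x. \<forall>t. t \<notin> J \<longrightarrow> coeffs x t = 0}"
proof -
  let ?R = "{x. \<forall>t. t \<notin> J \<longrightarrow> coeffs x t = 0}"
  have sub: "spec_space J \<subseteq> ?R" unfolding spec_space_def
  proof (rule closure_minimal)
    have "cvec.subspace ?R" by (auto simp: cvec.subspace_def coeffs_add coeffs_scaleC)
    then show "cvec.span (\<Union>t\<in>J. eigenspace t) \<subseteq> ?R"
      by (intro cvec.span_minimal) (auto simp: coeffs_eigenvector)
    have "?R = (\<Inter>t\<in>-J. {x. coeffs x t = 0})" by auto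
    then show "closed ?R"
      using linear_continuous_on[OF coeffs_linear] by (auto intro!: closed_INT closed_Collect_eq)
  qed
  have M: "cvec.subspace (spec_space J)" "closed (spec_space J)"
    by (auto simp: spec_space_def intro: closure_csubspace)
  have "x \<in> spec_space J" if x: "x \<in> ?R" for x
  proof -
    define y where "y = orth_proj (spec_space J) x"
    have y: "y \<in> spec_space J" unfolding y_def by (rule orth_proj_in[OF M])
    have "coeffs y t = coeffs x t" for t
    proof (cases "t \<in> J")
      case True
      have "z \<in> spec_space J" if "z \<in> eigenspace t" for z
        unfolding spec_space_def using that True by (intro closure_subset[THEN subsetD] cvec.span_base) auto
      then have "cinner y z = cinner x z" if "z \<in> eigenspace t" for z
        unfolding y_def using that cinner_orth_proj[OF M] by blast
      then show ?thesis by (intro coeffs_eqI) (auto simp: cinner_coeffs)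
    next
      case False
      then show ?thesis using x y sub by auto
    qed
    then have "y = x" by (rule coeffs_inject)
    with y show ?thesis by simp
  qed
  with sub show ?thesis by blast
qed

lemma spec_space_csubspace: "cvec.subspace (spec_space J)"
  and spec_space_closed: "closed (spec_space J)"
  by (auto simp: spec_space_def intro: closure_csubspace)

lemma coeffs_spec_proj: "coeffs (spec_proj J x) t = cut J (coeffs x) t"
proof (cases "t \<in> J")
  case True
  have "z \<in> spec_space J" if "z \<in> eigenspace t" for z
    using that True by (auto simp: spec_space_eq coeffs_eigenvector)
  then have "cinner (spec_proj J x) z = cinner x z" if "z \<in> eigenspace t" for z
    unfolding spec_proj_def using that cinner_orth_proj[OF spec_space_csubspace spec_space_closed] by blast
  then show ?thesis using True by (auto intro!: coeffs_eqI simp: cinner_coeffs cut_def)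
next
  case False
  then show ?thesis
    using orth_proj_in[OF spec_space_csubspace spec_space_closed, of J x, folded spec_proj_def]
    by (auto simp: spec_space_eq cut_def)
qed

lemma spec_proj_in [simp]: "spec_proj J x \<in> spec_space J"
  by (simp add: spec_space_eq coeffs_spec_proj cut_def)

lemma spec_proj_linear: "bounded_linear (spec_proj J)"
  unfolding spec_proj_def by (intro bounded_linear_orth_proj spec_space_csubspace spec_space_closed)

lemma spec_proj_scaleC: "spec_proj J (c *\<^sub>C x) = c *\<^sub>C spec_proj J x"
  unfolding spec_proj_def by (intro orth_proj_scaleC spec_space_csubspace spec_space_closed)

lemma spec_proj_add: "spec_proj J (x + y) = spec_proj J x + spec_proj J y"
  and spec_proj_diff: "spec_proj J (x - y) = spec_proj J x - spec_proj J y"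
  and spec_proj_zero [simp]: "spec_proj J 0 = 0"
  by (simp_all add: linear_simps[OF spec_proj_linear])

lemma spec_proj_id: "x \<in> spec_space J \<Longrightarrow> spec_proj J x = x"
  by (rule coeffs_inject) (auto simp: coeffs_spec_proj cut_def spec_space_eq)

lemma spec_proj_zero_disjoint: "x \<in> spec_space K \<Longrightarrow> J \<inter> K = {} \<Longrightarrow> spec_proj J x = 0"
  by (rule coeffs_inject) (auto simp: coeffs_spec_proj cut_def spec_space_eq)

lemma spec_proj_split: "spec_proj J x + spec_proj (- J) x = x"
  by (rule coeffs_inject) (simp add: coeffs_add coeffs_spec_proj cut_def)

lemma spec_space_orth:
  assumes "x \<in> spec_space J" "y \<in> spec_space K" "J \<inter> K = {}"
  shows "cinner x y = 0"
proof -
  have "cinner (coeffs x t) (coeffs y t) = 0" for t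
    using assms by (cases "t \<in> J") (auto simp: spec_space_eq)
  then show ?thesis using infsumI[OF parseval_cinner[of x y]] by simp
qed

lemma cinner_spec_proj: "y \<in> spec_space J \<Longrightarrow> cinner (spec_proj J x) y = cinner x y"
  unfolding spec_proj_def by (intro cinner_orth_proj spec_space_csubspace spec_space_closed)

lemma norm_spec_proj_le: "norm (spec_proj J x) \<le> norm x"
  by (rule norm_le_coeffwise) (simp add: coeffs_spec_proj cut_def)


section \<open>The operator \<open>\<gamma>\<close>\<close>

lemma \<gamma>_add: "\<gamma> (x + y) = \<gamma> x + \<gamma> y"
  and \<gamma>_scaleC: "\<gamma> (c *\<^sub>C x) = c *\<^sub>C \<gamma> x"
  using \<gamma>_bounded by (auto simp: bounded_clinear_between_def clinear_on_def)

lemma \<gamma>_scaleR: "\<gamma> (r *\<^sub>R x) = r *\<^sub>R \<gamma> x"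
  by (simp add: scaleR_scaleC \<gamma>_scaleC)

lemma \<gamma>_zero [simp]: "\<gamma> 0 = 0"
  using \<gamma>_scaleR[of 0 0] by simp

lemma \<gamma>_minus: "\<gamma> (- x) = - \<gamma> x"
  using \<gamma>_scaleR[of "-1" x] by simp

lemma \<gamma>_diff: "\<gamma> (x - y) = \<gamma> x - \<gamma> y"
  using \<gamma>_add[of x "- y"] by (simp add: \<gamma>_minus)

lemma cinner_\<gamma>_right: "cinner x (\<gamma> y) = - cinner (\<gamma> x) y"
  by (simp add: \<gamma>_adjoint)

lemma cinner_\<gamma>_\<gamma>: "cinner (\<gamma> x) (\<gamma> y) = cinner x y"
  by (simp add: \<gamma>_adjoint \<gamma>_inverse)

lemma norm_\<gamma> [simp]: "norm (\<gamma> x) = norm x"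
  using cinner_\<gamma>_\<gamma>[of x x] unfolding cinner_self of_real_eq_iff
  by (simp add: power2_eq_iff_nonneg)


lemma \<gamma>_linear: "bounded_linear \<gamma>"
  by (rule bounded_linear_intro[of _ 1]) (simp_all add: \<gamma>_add \<gamma>_scaleR)

lemma \<gamma>_eigenspace: "x \<in> eigenspace t \<Longrightarrow> \<gamma> x \<in> eigenspace (- t)"
  using \<gamma>_bounded_graph anticommute[of x]
  by (auto simp: eigenspace_def \<gamma>_scaleR add_eq_0_iff2)

lemma coeffs_\<gamma>: "coeffs (\<gamma> x) t = \<gamma> (coeffs x (- t))"
proof (rule coeffs_eqI)
  show "\<gamma> (coeffs x (- t)) \<in> eigenspace t" using \<gamma>_eigenspace[of "coeffs x (- t)" "- t"] by simp
  fix z assume "z \<in> eigenspace t"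
  then have "\<gamma> z \<in> eigenspace (- t)" by (rule \<gamma>_eigenspace)
  then show "cinner (\<gamma> x) z = cinner (\<gamma> (coeffs x (- t))) z"
    by (simp add: \<gamma>_adjoint cinner_coeffs)
qed


section \<open>The Sobolev scale\<close>

definition weight :: "real \<Rightarrow> real" where
  "weight t = (1 + t\<^sup>2) powr (1/4)"

lemma weight_ge_1: "1 \<le> weight t"
  unfolding weight_def by (rule ge_one_powr_ge_zero) auto

lemma weight_pos [simp]: "0 < weight t"
  using weight_ge_1[of t] by linarith

lemma weight_nonneg [simp]: "0 \<le> weight t" and weight_nonzero [simp]: "weight t \<noteq> 0"
  using weight_pos[of t] by linarith+

lemma weight_minus [simp]: "weight (- t) = weight t"
  by (simp add: weight_def)

lemma weight_mono: "\<bar>s\<bar> \<le> \<bar>t\<bar> \<Longrightarrow> weight s \<le> weight t"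
  unfolding weight_def by (rule powr_mono2) (auto simp: abs_le_square_iff add_pos_nonneg)

lemma weight_power4: "(weight t) ^ 4 = 1 + t\<^sup>2"
proof -
  have p: "0 < 1 + t\<^sup>2" by (simp add: add_pos_nonneg)
  then have "(weight t) ^ 4 = (1 + t\<^sup>2) powr (4 * (1/4))"
    unfolding weight_def by (subst powr_realpow[symmetric]) (auto simp: powr_powr)
  with p show ?thesis by simp
qed

lemma eigenspace_scaleR_iff: "c \<noteq> 0 \<Longrightarrow> c *\<^sub>R x \<in> eigenspace t \<longleftrightarrow> x \<in> eigenspace t"
  using eigenspace_scaleR[of "c *\<^sub>R x" t "1 / c"] eigenspace_scaleR by auto

lemma sobolev_half: "x \<in> sobolev (1/2) \<longleftrightarrow> ell2 (\<lambda>t. weight t *\<^sub>R x t)"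
proof -
  have "(1 + t\<^sup>2) powr (1/2/2) = weight t" for t by (simp add: weight_def)
  then show ?thesis unfolding sobolev_def ell2_def by (simp only: mem_Collect_eq) (simp add: eigenspace_scaleR_iff)
qed

lemma powr_minus_quarter: "(1 + t\<^sup>2) powr (- 1/2/2) = 1 / weight t"
  by (simp add: weight_def powr_minus_divide)

lemma sobolev_minus_half: "x \<in> sobolev (- 1/2) \<longleftrightarrow> ell2 (\<lambda>t. (1 / weight t) *\<^sub>R x t)"
  unfolding sobolev_def ell2_def powr_minus_quarter by (simp add: eigenspace_scaleR_iff)

lemma H_half_iff: "x \<in> H_half \<longleftrightarrow> ell2 (\<lambda>t. weight t *\<^sub>R coeffs x t)"
  by (simp add: H_half_def sobolev_half)

lemma sobolev_half_eq: "sobolev (1/2) = coeffs ` H_half"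
proof (intro antisym subsetI)
  fix x assume x: "x \<in> sobolev (1/2)"
  have "norm (x t) \<le> norm (weight t *\<^sub>R x t)" for t
    using mult_right_mono[OF weight_ge_1, of "norm (x t)" t] by simp
  then have "ell2 x"
    using x by (intro ell2_compare[of "\<lambda>t. weight t *\<^sub>R x t" x])
      (auto simp: sobolev_half[symmetric] sobolev_def)
  then have "coeffs (of_coeffs x) = x" by (rule coeffs_of_coeffs)
  with x show "x \<in> coeffs ` H_half" by (intro image_eqI[of _ _ "of_coeffs x"]) (auto simp: H_half_def)
qed (auto simp: H_half_def)

text \<open>The fourth root of \<open>I + A\<^sup>2\<close>, an isometry of \<open>sobolev (1/2)\<close> onto \<open>H\<close>, and its inverse.  On
  vectors of \<open>H\<close>, \<open>norm (qroot_inv x)\<close> is the norm of \<open>sobolev (-1/2)\<close>.\<close>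

definition qroot :: "'a \<Rightarrow> 'a" where
  "qroot x = of_coeffs (\<lambda>t. weight t *\<^sub>R coeffs x t)"

definition qroot_inv :: "'a \<Rightarrow> 'a" where
  "qroot_inv x = of_coeffs (\<lambda>t. (1 / weight t) *\<^sub>R coeffs x t)"

lemma coeffs_qroot: "x \<in> H_half \<Longrightarrow> coeffs (qroot x) t = weight t *\<^sub>R coeffs x t"
  by (simp add: qroot_def coeffs_of_coeffs H_half_iff)

lemma coeffs_qroot_inv: "coeffs (qroot_inv x) t = (1 / weight t) *\<^sub>R coeffs x t"
proof -
  have "(1 / weight t) * norm (coeffs x t) \<le> norm (coeffs x t)" for t
    using mult_right_mono[OF weight_ge_1, of "norm (coeffs x t)" t] by (simp add: field_simps)
  then have "ell2 (\<lambda>t. (1 / weight t) *\<^sub>R coeffs x t)"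
    by (intro ell2_compare[OF ell2_coeffs[of x]]) (auto simp: eigenspace_scaleR)
  then show ?thesis by (simp add: qroot_inv_def coeffs_of_coeffs)
qed

lemma qroot_inv_H_half [simp]: "qroot_inv x \<in> H_half"
  by (simp add: H_half_iff coeffs_qroot_inv)

lemma qroot_qroot_inv [simp]: "qroot (qroot_inv x) = x"
  by (rule coeffs_inject) (simp add: coeffs_qroot coeffs_qroot_inv)

lemma qroot_inv_qroot [simp]: "x \<in> H_half \<Longrightarrow> qroot_inv (qroot x) = x"
  by (rule coeffs_inject) (simp add: coeffs_qroot coeffs_qroot_inv)

lemma qroot_inv_add: "qroot_inv (x + y) = qroot_inv x + qroot_inv y"
  and qroot_inv_diff: "qroot_inv (x - y) = qroot_inv x - qroot_inv y"
  and qroot_inv_scaleC: "qroot_inv (c *\<^sub>C x) = c *\<^sub>C qroot_inv x"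
  by (rule coeffs_inject; simp add: coeffs_qroot_inv coeffs_add coeffs_diff coeffs_scaleC
      scaleR_add_right scaleR_diff_right scaleR_scaleC scaleC_scaleC scaleC_add_right
      cvec.scale_right_diff_distrib mult.commute)+

lemma norm_qroot_inv_le: "norm (qroot_inv x) \<le> norm x"
proof (rule norm_le_coeffwise)
  show "norm (coeffs (qroot_inv x) t) \<le> norm (coeffs x t)" for t
    using mult_right_mono[OF weight_ge_1, of "norm (coeffs x t)" t]
    by (simp add: coeffs_qroot_inv field_simps)
qed

lemma qroot_inv_linear: "bounded_linear qroot_inv"
  by (rule bounded_linear_intro[of _ 1])
    (simp_all add: qroot_inv_add qroot_inv_scaleC scaleR_scaleC norm_qroot_inv_le)

lemma H_half_csubspace: "cvec.subspace H_half"
  unfolding cvec.subspace_def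
proof (intro conjI ballI allI)
  have r: "x \<in> H_half \<longleftrightarrow> x \<in> range qroot_inv" for x
    by (metis qroot_inv_H_half qroot_inv_qroot rangeE rangeI)
  show "0 \<in> H_half" unfolding r using qroot_inv_diff[of 0 0] by (metis diff_self rangeI)
  show "x + y \<in> H_half" if "x \<in> H_half" "y \<in> H_half" for x y
    using that unfolding r by (auto simp flip: qroot_inv_add)
  show "c *\<^sub>C x \<in> H_half" if "x \<in> H_half" for x c
    using that unfolding r by (auto simp flip: qroot_inv_scaleC)
qed

lemmas H_half_add = cvec.subspace_add[OF H_half_csubspace]
  and H_half_diff = cvec.subspace_diff[OF H_half_csubspace]
  and H_half_scaleC = cvec.subspace_scale[OF H_half_csubspace]
  and H_half_0 [simp] = cvec.subspace_0[OF H_half_csubspace]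

lemma qroot_add: "x \<in> H_half \<Longrightarrow> y \<in> H_half \<Longrightarrow> qroot (x + y) = qroot x + qroot y"
  and qroot_diff: "x \<in> H_half \<Longrightarrow> y \<in> H_half \<Longrightarrow> qroot (x - y) = qroot x - qroot y"
  and qroot_scaleC: "x \<in> H_half \<Longrightarrow> qroot (c *\<^sub>C x) = c *\<^sub>C qroot x"
  by (metis qroot_inv_add qroot_inv_qroot qroot_qroot_inv, metis qroot_inv_diff qroot_inv_qroot qroot_qroot_inv,
      metis qroot_inv_scaleC qroot_inv_qroot qroot_qroot_inv)

lemma norm_le_qroot: "x \<in> H_half \<Longrightarrow> norm x \<le> norm (qroot x)"
  by (metis norm_qroot_inv_le qroot_inv_qroot)

lemma cinner_qroot_inv: "cinner (qroot_inv x) y = cinner x (qroot_inv y)"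
proof -
  have "cinner (coeffs (qroot_inv x) t) (coeffs y t) = cinner (coeffs x t) (coeffs (qroot_inv y) t)" for t
    by (simp add: coeffs_qroot_inv cinner_scaleR_left cinner_scaleR_right)
  then show ?thesis using parseval_cinner[of "qroot_inv x" y] parseval_cinner[of x "qroot_inv y"]
    by (simp add: has_sum_unique)
qed

lemma spec_proj_H_half: "x \<in> H_half \<Longrightarrow> spec_proj J x \<in> H_half"
  and qroot_spec_proj: "x \<in> H_half \<Longrightarrow> qroot (spec_proj J x) = spec_proj J (qroot x)"
proof -
  assume x: "x \<in> H_half"
  have eq: "spec_proj J x = qroot_inv (spec_proj J (qroot x))"
    by (rule coeffs_inject) (simp add: coeffs_spec_proj coeffs_qroot_inv coeffs_qroot x cut_def)
  show "spec_proj J x \<in> H_half" by (simp add: eq)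
  show "qroot (spec_proj J x) = spec_proj J (qroot x)" by (simp add: eq)
qed

lemma \<gamma>_H_half: "x \<in> H_half \<Longrightarrow> \<gamma> x \<in> H_half"
  and qroot_\<gamma>: "x \<in> H_half \<Longrightarrow> qroot (\<gamma> x) = \<gamma> (qroot x)"
proof -
  assume x: "x \<in> H_half"
  have eq: "\<gamma> x = qroot_inv (\<gamma> (qroot x))"
    by (rule coeffs_inject) (simp add: coeffs_\<gamma> coeffs_qroot_inv coeffs_qroot x \<gamma>_scaleR)
  show "\<gamma> x \<in> H_half" by (simp add: eq)
  show "qroot (\<gamma> x) = \<gamma> (qroot x)" by (simp add: eq)
qed

lemma \<gamma>_H_half_iff: "\<gamma> x \<in> H_half \<longleftrightarrow> x \<in> H_half"
  using \<gamma>_H_half[of x] \<gamma>_H_half[of "\<gamma> x"] H_half_scaleC[of "- x" "-1"] by (auto simp: \<gamma>_inverse)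

lemma eigenvector_H_half:
  assumes "x \<in> eigenspace t" shows "x \<in> H_half"
proof -
  have "x = qroot_inv (weight t *\<^sub>R x)"
    by (rule coeffs_inject) (simp add: coeffs_qroot_inv coeffs_scaleR coeffs_eigenvector[OF assms])
  then show ?thesis by (metis qroot_inv_H_half)
qed

lemma coeffs_A: "x \<in> D \<Longrightarrow> coeffs (A x) t = t *\<^sub>R coeffs x t"
proof (rule coeffs_eqI)
  fix z assume x: "x \<in> D" and z: "z \<in> eigenspace t"
  then have "cinner (A x) z = of_real t * cinner x z"
    by (simp add: A_csymmetric eigenspace_def cinner_scaleR_right)
  then show "cinner (A x) z = cinner (t *\<^sub>R coeffs x t) z"
    by (simp add: cinner_scaleR_left cinner_coeffs z)
qed (simp add: eigenspace_scaleR)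

text \<open>The inverse square root of \<open>I + A\<^sup>2\<close> maps \<open>H\<close> isometrically into the domain of \<open>A\<close> with the
  graph norm.  So the compact embedding of this domain makes it a compact operator on \<open>H\<close>.\<close>

lemma qroot_inv_qroot_inv_domain:
  defines "y \<equiv> \<lambda>h. qroot_inv (qroot_inv h)"
  shows "y h \<in> D" "graph_norm A (y h) = norm h"
proof -
  have w2: "\<bar>t\<bar> \<le> (weight t)\<^sup>2" for t
  proof (rule power2_le_imp_le)
    show "\<bar>t\<bar>\<^sup>2 \<le> ((weight t)\<^sup>2)\<^sup>2" using weight_power4[of t] by (simp flip: power_mult)
  qed simp
  define z where "z = of_coeffs (\<lambda>t. (t / (weight t)\<^sup>2) *\<^sub>R coeffs h t)"
  have cy: "coeffs (y h) t = (1 / (weight t)\<^sup>2) *\<^sub>R coeffs h t" for t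
    by (simp add: y_def coeffs_qroot_inv power2_eq_square)
  have "(\<bar>t\<bar> / (weight t)\<^sup>2) * norm (coeffs h t) \<le> 1 * norm (coeffs h t)" for t
    using w2[of t] by (intro mult_right_mono) auto
  then have "ell2 (\<lambda>t. (t / (weight t)\<^sup>2) *\<^sub>R coeffs h t)"
    by (intro ell2_compare[OF ell2_coeffs[of h]]) (auto simp: eigenspace_scaleR)
  then have cz: "coeffs z t = (t / (weight t)\<^sup>2) *\<^sub>R coeffs h t" for t
    by (simp add: z_def coeffs_of_coeffs)
  have weak: "inner (A x) (y h) = inner x z" if x: "x \<in> D" for x
  proof -
    have "cinner (coeffs (A x) t) (coeffs (y h) t) = cinner (coeffs x t) (coeffs z t)" for t
      by (simp add: coeffs_A x cy cz cinner_scaleR_left cinner_scaleR_right)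
    then have "cinner (A x) (y h) = cinner x z"
      using parseval_cinner[of "A x" "y h"] parseval_cinner[of x z] by (simp add: has_sum_unique)
    then show ?thesis by (simp add: inner_eq_Re_cinner)
  qed
  show "y h \<in> D" by (rule A_maximal[OF weak])
  have Ay: "A (y h) = z" by (rule A_maximal[OF weak])
  have "(norm (coeffs (y h) t))\<^sup>2 + (norm (coeffs z t))\<^sup>2 = (norm (coeffs h t))\<^sup>2" for t
  proof -
    have "(norm (coeffs (y h) t))\<^sup>2 + (norm (coeffs z t))\<^sup>2
      = (1 + t\<^sup>2) / (weight t) ^ 4 * (norm (coeffs h t))\<^sup>2"
      by (simp add: cy cz power_mult_distrib power_divide add_divide_distrib distrib_right flip: power_mult)
    also have "\<dots> = (norm (coeffs h t))\<^sup>2"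
      using weight_power4[of t] by (metis div_self mult_1 weight_nonzero power_not_zero)
    finally show ?thesis .
  qed
  then have "((\<lambda>t. (norm (coeffs h t))\<^sup>2) has_sum (norm (y h))\<^sup>2 + (norm z)\<^sup>2) UNIV"
    using has_sum_add[OF parseval[of "y h"] parseval[of z]] by simp
  then have "(norm (y h))\<^sup>2 + (norm z)\<^sup>2 = (norm h)\<^sup>2" using parseval[of h] by (rule has_sum_unique)
  then show "graph_norm A (y h) = norm h" by (simp add: graph_norm_def Ay)
qed

lemma qroot_inv_compact:
  fixes h :: "nat \<Rightarrow> 'a"
  assumes "\<And>n. norm (h n) \<le> C"
  obtains r :: "nat \<Rightarrow> nat" where "strict_mono r" "Cauchy (\<lambda>n. qroot_inv (qroot_inv (h (r n))))"
proof -
  define c where "c = max C 1"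
  have c: "c > 0" "\<And>n. norm (h n) \<le> c" using assms by (auto simp: c_def max_def intro: order_trans)
  define k where "k n = qroot_inv (qroot_inv ((1/c) *\<^sub>R h n))" for n
  have "\<forall>n. k n \<in> closure {x \<in> D. graph_norm A x \<le> 1}"
    using c by (intro allI closure_subset[THEN subsetD]) (simp add: k_def qroot_inv_qroot_inv_domain)
  then obtain l r where r: "strict_mono r" "(k \<circ> r) \<longlonglongrightarrow> l"
    by (rule seq_compactE[OF compact_imp_seq_compact[OF compact_embedding]]) blast
  have "(\<lambda>n. c *\<^sub>R (k \<circ> r) n) \<longlonglongrightarrow> c *\<^sub>R l" by (intro tendsto_intros r)
  moreover have "c *\<^sub>R (k \<circ> r) n = qroot_inv (qroot_inv (h (r n)))" for n
    using c(1) by (simp add: k_def linear_simps[OF qroot_inv_linear])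
  ultimately have "(\<lambda>n. qroot_inv (qroot_inv (h (r n)))) \<longlonglongrightarrow> c *\<^sub>R l" by simp
  then have "Cauchy (\<lambda>n. qroot_inv (qroot_inv (h (r n))))" by (rule LIMSEQ_imp_Cauchy)
  with r(1) that show ?thesis by blast
qed


section \<open>The hybrid space as a Hilbert space\<close>

definition check_weight :: "real \<Rightarrow> real" where
  "check_weight t = (if t \<le> 0 then weight t else 1 / weight t)"

lemma check_weight_pos [simp]: "0 < check_weight t"
  by (simp add: check_weight_def)

lemma check_weight_nonzero [simp]: "check_weight t \<noteq> 0"
  using check_weight_pos[of t] by linarith

lemma check_weight_minus: "check_weight t * check_weight (- t) = 1"
proof (cases "t = 0")
  case True
  then show ?thesis by (simp add: check_weight_def weight_def)
qed (auto simp: check_weight_def)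

lemma check_weight_le_weight: "check_weight t \<le> weight t"
  using weight_ge_1[of t] by (auto simp: check_weight_def field_simps intro: order_trans[of _ 1] mult_ge1_I)

text \<open>The weight \<open>check_weight\<close> identifies the hybrid space isometrically with \<open>H\<close>.  Its values at
  \<open>t\<close> and \<open>- t\<close> are inverse to each other, so the weights cancel in \<open>\<omega>\<close>.\<close>

definition of_check :: "(real \<Rightarrow> 'a) \<Rightarrow> 'a" where
  "of_check x = of_coeffs (\<lambda>t. check_weight t *\<^sub>R x t)"

definition to_check :: "'a \<Rightarrow> real \<Rightarrow> 'a" where
  "to_check h t = (1 / check_weight t) *\<^sub>R coeffs h t"

lemma H_check_iff: "x \<in> H_check \<longleftrightarrow> ell2 (\<lambda>t. check_weight t *\<^sub>R x t)"
  and check_norm_eq: "x \<in> H_check \<Longrightarrow> check_norm x = norm (of_check x)"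
proof -
  define p where "p t = weight t *\<^sub>R cut {..0} x t" for t
  define q where "q t = (1 / weight t) *\<^sub>R cut {0<..} x t" for t
  define s where "s t = check_weight t *\<^sub>R x t" for t
  have pq: "p t + q t = s t" "p t = (if t \<le> 0 then s t else 0)" "q t = (if t \<le> 0 then 0 else s t)" for t
    by (auto simp: p_def q_def s_def cut_def check_weight_def)
  have H: "x \<in> H_check \<longleftrightarrow> ell2 p \<and> ell2 q"
    unfolding H_check_def mem_Collect_eq sobolev_half sobolev_minus_half p_def[abs_def] q_def[abs_def] ..
  have split: "coeffs (of_coeffs p + of_coeffs q) = s" if "ell2 p" "ell2 q"
    using that by (auto simp: fun_eq_iff coeffs_add coeffs_of_coeffs pq(1))
  have "ell2 s" if "ell2 p" "ell2 q" using ell2_coeffs[of "of_coeffs p + of_coeffs q"] split[OF that] by simp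
  moreover have "ell2 p" "ell2 q" if s: "ell2 s"
    by (rule ell2_compare[OF s]; use s in \<open>auto simp: pq ell2_def\<close>)+
  ultimately show iff: "x \<in> H_check \<longleftrightarrow> ell2 (\<lambda>t. check_weight t *\<^sub>R x t)"
    unfolding H s_def[abs_def, symmetric] by blast
  assume "x \<in> H_check"
  then have l: "ell2 p" "ell2 q" unfolding H by auto
  have "cinner (of_coeffs p) (of_coeffs q) = 0"
    using l by (intro spec_space_orth[of _ "{..0}" _ "{0<..}"]) (auto simp: spec_space_eq coeffs_of_coeffs pq)
  then have "orthogonal (of_coeffs p) (of_coeffs q)" by (simp add: orthogonal_def cinner_0_imp_inner_0)
  from norm_add_Pythagorean[OF this]
  have "(norm (of_coeffs s))\<^sup>2 = (norm (of_coeffs p))\<^sup>2 + (norm (of_coeffs q))\<^sup>2"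
    using of_coeffs_eqI[OF split[OF l]] by simp
  moreover have "(sobolev_norm (1/2) (cut {..0} x))\<^sup>2 = (norm (of_coeffs p))\<^sup>2"
    using norm_of_coeffs[OF l(1)] by (simp add: sobolev_norm_def p_def weight_def infsum_nonneg)
  moreover have "(sobolev_norm (- 1/2) (cut {0<..} x))\<^sup>2 = (norm (of_coeffs q))\<^sup>2"
    unfolding sobolev_norm_def powr_minus_quarter
    using norm_of_coeffs[OF l(2)] by (simp add: q_def infsum_nonneg)
  ultimately show "check_norm x = norm (of_check x)"
    unfolding check_norm_def of_check_def s_def[abs_def] by (metis real_sqrt_unique norm_ge_zero)
qed

lemma to_check_in [simp]: "to_check h \<in> H_check"
  by (simp add: H_check_iff to_check_def)

lemma of_check_to_check [simp]: "of_check (to_check h) = h"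
  by (simp add: of_check_def to_check_def)

lemma coeffs_of_check: "x \<in> H_check \<Longrightarrow> coeffs (of_check x) t = check_weight t *\<^sub>R x t"
  by (simp add: of_check_def coeffs_of_coeffs H_check_iff)

lemma to_check_of_check [simp]: "x \<in> H_check \<Longrightarrow> to_check (of_check x) = x"
  by (rule ext) (simp add: to_check_def coeffs_of_check)

lemma H_check_eq: "H_check = range to_check"
  by (auto intro: to_check_of_check[symmetric])

lemma to_check_add: "(\<lambda>t. to_check h t + to_check k t) = to_check (h + k)"
  and to_check_diff: "(\<lambda>t. to_check h t - to_check k t) = to_check (h - k)"
  and to_check_scaleC: "(\<lambda>t. c *\<^sub>C to_check h t) = to_check (c *\<^sub>C h)"
  and to_check_zero: "to_check 0 = (\<lambda>t. 0)"
  by (auto simp: fun_eq_iff to_check_def coeffs_add coeffs_diff coeffs_scaleC scaleC_add_right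
      scaleR_scaleC scaleC_scaleC cvec.scale_right_diff_distrib mult.commute)

lemma check_norm_to_check: "check_norm (to_check h) = norm h"
  by (simp add: check_norm_eq)

lemma inj_to_check: "inj to_check"
  by (rule inj_on_inverseI[of _ of_check]) simp

lemma pairing_eq: "pairing s x y = (\<Sum>\<^sub>\<infinity>t. cinner (x t) (y t))"
proof -
  have one: "(1 + t\<^sup>2) powr (s / 2) * (1 + t\<^sup>2) powr (- s / 2) = 1" for t :: real
    using add_pos_nonneg[of 1 "t\<^sup>2"] by (simp flip: powr_add)
  have "cinner ((1 + t\<^sup>2) powr (s / 2) *\<^sub>R x t) ((1 + t\<^sup>2) powr (- s / 2) *\<^sub>R y t)
      = of_real ((1 + t\<^sup>2) powr (s / 2) * (1 + t\<^sup>2) powr (- s / 2)) * cinner (x t) (y t)" for t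
    by (simp only: cinner_scaleR_left cinner_scaleR_right of_real_mult mult_ac)
  then show ?thesis unfolding pairing_def one by simp
qed

lemma \<omega>_to_check: "\<omega> (to_check h) (to_check k) = cinner h (\<gamma> k)"
proof -
  have inv: "1 / check_weight t * (1 / check_weight (- t)) = 1" for t
    using check_weight_minus[of t] by (simp add: field_simps)
  have prod: "cinner (to_check h t) (\<gamma> (to_check k (- t))) = cinner (coeffs h t) (coeffs (\<gamma> k) t)" for t
  proof -
    have "cinner (to_check h t) (\<gamma> (to_check k (- t)))
      = of_real (1 / check_weight t * (1 / check_weight (- t))) * cinner (coeffs h t) (coeffs (\<gamma> k) t)"
      by (simp only: to_check_def \<gamma>_scaleR coeffs_\<gamma> cinner_scaleR_left cinner_scaleR_right of_real_mult mult_ac)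
    then show ?thesis unfolding inv by simp
  qed
  have "cinner (cut {..0} (to_check h) t) (\<gamma>_ext (cut {0..} (to_check k)) t)
      = cinner (coeffs (spec_proj {..0} h) t) (coeffs (\<gamma> k) t)" for t
    by (simp add: cut_def \<gamma>_ext_def coeffs_spec_proj prod)
  then have 1: "pairing (1/2) (cut {..0} (to_check h)) (\<gamma>_ext (cut {0..} (to_check k)))
      = cinner (spec_proj {..0} h) (\<gamma> k)"
    using infsumI[OF parseval_cinner] by (simp add: pairing_eq)
  have "cinner (cut {0<..} (to_check h) t) (\<gamma>_ext (cut {..<0} (to_check k)) t)
      = cinner (coeffs (spec_proj {0<..} h) t) (coeffs (\<gamma> k) t)" for t
    by (simp add: cut_def \<gamma>_ext_def coeffs_spec_proj prod)
  then have 2: "pairing (- 1/2) (cut {0<..} (to_check h)) (\<gamma>_ext (cut {..<0} (to_check k)))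
      = cinner (spec_proj {0<..} h) (\<gamma> k)"
    using infsumI[OF parseval_cinner] by (simp add: pairing_eq)
  have "- {..0::real} = {0<..}" by auto
  then show ?thesis using spec_proj_split[of "{..0}" h]
    unfolding \<omega>_def 1 2 by (metis cinner_add_left)
qed

lemma \<omega>_has_sum:
  assumes "x \<in> H_check" "y \<in> H_check"
  shows "((\<lambda>t. cinner (x t) (\<gamma> (y (- t)))) has_sum \<omega> x y) UNIV"
proof -
  have prod: "cinner (x t) (\<gamma> (y (- t))) = cinner (coeffs (of_check x) t) (coeffs (\<gamma> (of_check y)) t)" for t
  proof -
    have "cinner (coeffs (of_check x) t) (coeffs (\<gamma> (of_check y)) t)
      = of_real (check_weight t * check_weight (- t)) * cinner (x t) (\<gamma> (y (- t)))"
      by (simp only: coeffs_of_check assms coeffs_\<gamma> \<gamma>_scaleR cinner_scaleR_left cinner_scaleR_right of_real_mult mult_ac)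
    then show ?thesis by (simp add: check_weight_minus)
  qed
  have "\<omega> x y = cinner (of_check x) (\<gamma> (of_check y))"
    using \<omega>_to_check[of "of_check x" "of_check y"] assms by simp
  then show ?thesis unfolding prod by (simp add: parseval_cinner)
qed

lemma coeffs_H_check: "x \<in> H_half \<Longrightarrow> coeffs x \<in> H_check"
proof -
  assume "x \<in> H_half"
  then have "ell2 (\<lambda>t. weight t *\<^sub>R coeffs x t)" by (simp add: H_half_iff)
  then have "ell2 (\<lambda>t. check_weight t *\<^sub>R coeffs x t)"
    by (rule ell2_compare) (auto simp: eigenspace_scaleR less_imp_le intro!: mult_right_mono check_weight_le_weight)
  then show ?thesis by (simp add: H_check_iff)
qed

lemma \<omega>_coeffs:
  assumes "x \<in> H_half" "y \<in> H_half"
  shows "\<omega> (coeffs x) (coeffs y) = cinner x (\<gamma> y)"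
  using \<omega>_has_sum[OF coeffs_H_check[OF assms(1)] coeffs_H_check[OF assms(2)]]
    parseval_cinner[of x "\<gamma> y", unfolded coeffs_\<gamma>]
  by (rule has_sum_unique)

lemma norm_of_check_le_qroot: "x \<in> H_half \<Longrightarrow> norm (of_check (coeffs x)) \<le> norm (qroot x)"
  by (rule norm_le_coeffwise)
    (simp add: coeffs_of_check coeffs_H_check coeffs_qroot mult_right_mono check_weight_le_weight abs_of_pos)


section \<open>Boundary conditions as closed subspaces\<close>

lemma to_check_of_check_image: "B \<subseteq> H_check \<Longrightarrow> B = to_check ` (of_check ` B)"
  by (force simp: image_iff)

lemma boundary_condition_iff:
  "boundary_condition (to_check ` M) \<longleftrightarrow> cvec.subspace M \<and> closed M"
proof -
  have mem: "to_check h \<in> to_check ` M \<longleftrightarrow> h \<in> M" for h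
    by (rule inj_image_mem_iff[OF inj_to_check])
  have lin: "(\<lambda>t. 0) \<in> to_check ` M \<and>
     (\<forall>x\<in>to_check ` M. \<forall>y\<in>to_check ` M. (\<lambda>t. x t + y t) \<in> to_check ` M) \<and>
     (\<forall>c. \<forall>x\<in>to_check ` M. (\<lambda>t. c *\<^sub>C x t) \<in> to_check ` M) \<longleftrightarrow> cvec.subspace M"
    by (simp add: to_check_zero[symmetric] to_check_add to_check_scaleC mem cvec.subspace_def)
  have "(\<forall>x\<in>H_check. (\<forall>e>0. \<exists>b\<in>to_check ` M. check_norm (\<lambda>t. x t - b t) < e) \<longrightarrow> x \<in> to_check ` M)
      \<longleftrightarrow> (\<forall>h. (\<forall>e>0. \<exists>b\<in>M. norm (h - b) < e) \<longrightarrow> h \<in> M)"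
    by (simp add: H_check_eq to_check_diff check_norm_to_check mem)
  also have "\<dots> \<longleftrightarrow> closure M \<subseteq> M"
    by (simp add: subset_iff closure_approachable dist_norm norm_minus_commute)
  also have "\<dots> \<longleftrightarrow> closed M" by (metis closure_eq closure_subset subset_antisym order_refl)
  finally show ?thesis unfolding boundary_condition_def using lin by (auto simp: H_check_eq)
qed

lemma annihilator_to_check:
  "annihilator (to_check ` M) = to_check ` {k. \<forall>h\<in>M. cinner h (\<gamma> k) = 0}"
  by (auto simp: annihilator_def H_check_eq \<omega>_to_check)

lemma boundary_condition_annihilator:
  assumes "B \<subseteq> H_check"
  shows "boundary_condition (annihilator B)"
proof -
  define M where "M = of_check ` B"
  have "cvec.subspace {k. \<forall>h\<in>M. cinner h (\<gamma> k) = 0}"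
    by (auto simp: cvec.subspace_def \<gamma>_add \<gamma>_scaleC cinner_add_right cinner_scaleC_right)
  moreover have "closed {k. \<forall>h\<in>M. cinner h (\<gamma> k) = 0}"
  proof -
    have "{k. \<forall>h\<in>M. cinner h (\<gamma> k) = 0} = (\<Inter>h\<in>M. {k. cinner h (\<gamma> k) = 0})" by auto
    moreover have "continuous_on UNIV (\<lambda>k. cinner h (\<gamma> k))" for h
      by (intro linear_continuous_on bounded_linear_compose[OF
            bounded_bilinear.bounded_linear_right[OF bounded_bilinear_cinner] \<gamma>_linear])
    ultimately show ?thesis by (auto intro!: closed_INT closed_Collect_eq)
  qed
  moreover have "B = to_check ` M" unfolding M_def by (rule to_check_of_check_image[OF assms])
  ultimately show ?thesis by (simp add: annihilator_to_check boundary_condition_iff)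
qed

text \<open>After identification with \<open>H\<close> the annihilator is the image under \<open>\<gamma>\<close> of the
  orthogonal complement.\<close>

lemma biannihilator:
  assumes B: "boundary_condition B"
  shows "annihilator (annihilator B) = B"
proof -
  have BH: "B \<subseteq> H_check" using B by (simp add: boundary_condition_def)
  define M where "M = of_check ` B"
  have BM: "B = to_check ` M" unfolding M_def by (rule to_check_of_check_image[OF BH])
  then have M: "cvec.subspace M" "closed M" using B boundary_condition_iff by auto
  define N where "N = {k. \<forall>h\<in>M. cinner h (\<gamma> k) = 0}"
  have "{k. \<forall>h\<in>N. cinner h (\<gamma> k) = 0} = M"
  proof (intro antisym subsetI)
    fix k assume k: "k \<in> M"
    have "cinner h (\<gamma> k) = 0" if "h \<in> N" for h
    proof -
      have "cinner k (\<gamma> h) = 0" using that k by (simp add: N_def)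
      then have "cinner (\<gamma> h) k = 0" by (simp add: cinner_eq_0_commute[of k])
      then show ?thesis by (simp add: cinner_\<gamma>_right)
    qed
    then show "k \<in> {k. \<forall>h\<in>N. cinner h (\<gamma> k) = 0}" by simp
  next
    fix k assume k: "k \<in> {k. \<forall>h\<in>N. cinner h (\<gamma> k) = 0}"
    obtain p where p: "p \<in> M" "\<And>m. m \<in> M \<Longrightarrow> cinner (k - p) m = 0"
      using orth_projection_exists[OF M, of k] by blast
    have "cinner m (\<gamma> (\<gamma> (k - p))) = 0" if "m \<in> M" for m
      using p(2)[OF that] by (simp add: \<gamma>_inverse cinner_eq_0_commute[of m] del: minus_diff_eq)
    then have "\<gamma> (k - p) \<in> N" by (simp add: N_def)
    then have "cinner (\<gamma> (k - p)) (\<gamma> k) = 0" using k by blast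
    then have "cinner (k - p) k = 0" by (simp add: cinner_\<gamma>_\<gamma>)
    then have "cinner (k - p) (k - p) = 0" using p by (simp add: cinner_diff_right)
    then show "k \<in> M" using p(1) by simp
  qed
  then show ?thesis unfolding BM annihilator_to_check N_def by simp
qed


section \<open>Graph conditions and their annihilators\<close>

definition opp :: "real set \<Rightarrow> real set" where
  "opp J = {t. - t \<notin> J}"

lemma opp_opp [simp]: "opp (opp J) = J"
  by (auto simp: opp_def)

lemma \<gamma>_spec_opp: "x \<in> spec_space (opp J) \<Longrightarrow> \<gamma> x \<in> spec_space (- J)"
  by (auto simp: spec_space_eq opp_def coeffs_\<gamma>)

lemma \<gamma>_spec_compl: "x \<in> spec_space (- J) \<Longrightarrow> \<gamma> x \<in> spec_space (opp J)"
  by (auto simp: spec_space_eq opp_def coeffs_\<gamma>)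

text \<open>The spectral sets \<open>(-\<infinity>, \<Lambda>]\<close> and \<open>(-\<infinity>, -\<Lambda>)\<close> enter symmetrically only as members of
  a class that \<open>opp\<close> maps to itself: the sets that differ from \<open>(-\<infinity>, 0]\<close> by a bounded set.\<close>

definition cutoff :: "real set \<Rightarrow> bool" where
  "cutoff J \<longleftrightarrow> (\<exists>r. {..-r} \<subseteq> J \<and> J \<subseteq> {..r})"

lemma cutoff_atMost: "cutoff {..\<Lambda>}"
  unfolding cutoff_def by (rule exI[of _ "\<bar>\<Lambda>\<bar>"]) auto

lemma cutoff_opp: "cutoff J \<Longrightarrow> cutoff (opp J)"
proof -
  assume "cutoff J"
  then obtain r where r: "{..-r} \<subseteq> J" "J \<subseteq> {..r}" by (auto simp: cutoff_def)
  have "{..-(r+1)} \<subseteq> opp J"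
  proof
    fix t assume "t \<in> {..-(r+1)}"
    then have "- t \<notin> {..r}" by simp
    with r(2) show "t \<in> opp J" by (auto simp: opp_def)
  qed
  moreover have "opp J \<subseteq> {..r+1}"
  proof
    fix t assume "t \<in> opp J"
    then have "- t \<notin> {..-r}" using r(1) by (auto simp only: opp_def mem_Collect_eq)
    then show "t \<in> {..r+1}" by simp
  qed
  ultimately show ?thesis unfolding cutoff_def by blast
qed

lemma opp_atMost: "opp {..\<Lambda>} = {..<-\<Lambda>}"
  by (auto simp: opp_def)

text \<open>The data of the theorem, with \<open>h\<close> in the role of the adjoint of \<open>g\<close>.  In this form the
  hypotheses are symmetric under the exchange of \<open>J\<close> and \<open>opp J\<close>, which turns a statement about the
  annihilator of the graph of \<open>g\<close> into one about the annihilator of the graph of \<open>h\<close>.\<close>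

definition graph_data ::
    "real set \<Rightarrow> 'a set \<Rightarrow> 'a set \<Rightarrow> 'a set \<Rightarrow> 'a set \<Rightarrow> ('a \<Rightarrow> 'a) \<Rightarrow> ('a \<Rightarrow> 'a) \<Rightarrow> bool" where
  "graph_data J E U F V g h \<longleftrightarrow> cutoff J \<and>
     orth_decomp (spec_space J) E U \<and> finite_dim E \<and> E \<subseteq> H_half \<and>
     orth_decomp (spec_space (opp J)) F V \<and> finite_dim F \<and> F \<subseteq> H_half \<and>
     clinear_on U g \<and> g ` U \<subseteq> V \<and> g ` (U \<inter> H_half) \<subseteq> H_half \<and>
     clinear_on V h \<and> h ` V \<subseteq> U \<and> h ` (V \<inter> H_half) \<subseteq> H_half \<and>
     (\<forall>u\<in>U. \<forall>v\<in>V. cinner (g u) v = cinner u (h v))"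

lemma graph_data_swap:
  assumes "graph_data J E U F V g h" shows "graph_data (opp J) F V E U h g"
proof -
  have "cinner (h v) u = cinner v (g u)" if "u \<in> U" "v \<in> V" for u v
    using assms that cinner_commute[of "h v" u] cinner_commute[of v "g u"] by (simp add: graph_data_def)
  then show ?thesis using assms by (simp add: graph_data_def cutoff_opp)
qed

lemma graph_conditionE:
  assumes "x \<in> graph_condition F U g"
  obtains f u where "f \<in> F" "u \<in> U" "u \<in> H_half" "x = coeffs (\<gamma> f + (u + \<gamma> (g u)))"
  using assms by (auto simp: graph_condition_def graph_part_def)

lemma graph_conditionI:
  "f \<in> F \<Longrightarrow> u \<in> U \<Longrightarrow> u \<in> H_half \<Longrightarrow> coeffs (\<gamma> f + (u + \<gamma> (g u))) \<in> graph_condition F U g"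
  by (auto simp: graph_condition_def graph_part_def)

context
  fixes J E U F V g h
  assumes gd: "graph_data J E U F V g h"
begin

lemma graph_data_facts:
  shows cut: "cutoff J"
    and E: "cvec.subspace E" "finite_dim E" "E \<subseteq> H_half" "E \<subseteq> spec_space J"
    and U: "cvec.subspace U" "U \<subseteq> spec_space J"
    and F: "cvec.subspace F" "finite_dim F" "F \<subseteq> H_half" "F \<subseteq> spec_space (opp J)"
    and V: "cvec.subspace V" "V \<subseteq> spec_space (opp J)"
    and EU: "e \<in> E \<Longrightarrow> u \<in> U \<Longrightarrow> cinner e u = 0" "e \<in> E \<Longrightarrow> u \<in> U \<Longrightarrow> cinner u e = 0"
    and FV: "f \<in> F \<Longrightarrow> v \<in> V \<Longrightarrow> cinner f v = 0" "f \<in> F \<Longrightarrow> v \<in> V \<Longrightarrow> cinner v f = 0"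
    and adj: "u \<in> U \<Longrightarrow> v \<in> V \<Longrightarrow> cinner (g u) v = cinner u (h v)"
proof -
  have d: "orth_decomp (spec_space J) E U" "orth_decomp (spec_space (opp J)) F V"
    using gd by (auto simp: graph_data_def)
  show "cutoff J" "finite_dim E" "E \<subseteq> H_half" "finite_dim F" "F \<subseteq> H_half"
    "u \<in> U \<Longrightarrow> v \<in> V \<Longrightarrow> cinner (g u) v = cinner u (h v)"
    using gd by (auto simp: graph_data_def)
  show s: "cvec.subspace E" "cvec.subspace U" "cvec.subspace F" "cvec.subspace V"
    using d by (auto simp: orth_decomp_def)
  have sums: "spec_space J = {e + u | e u. e \<in> E \<and> u \<in> U}" "spec_space (opp J) = {e + u | e u. e \<in> F \<and> u \<in> V}"
    using d by (auto simp: orth_decomp_def)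
  have 0: "0 \<in> E" "0 \<in> U" "0 \<in> F" "0 \<in> V" using s by (auto simp: cvec.subspace_0)
  show "E \<subseteq> spec_space J" "U \<subseteq> spec_space J" "F \<subseteq> spec_space (opp J)" "V \<subseteq> spec_space (opp J)"
    unfolding sums using 0 by (force simp: subset_iff)+
  show eu: "e \<in> E \<Longrightarrow> u \<in> U \<Longrightarrow> cinner e u = 0" "f \<in> F \<Longrightarrow> v \<in> V \<Longrightarrow> cinner f v = 0"
    using d by (auto simp: orth_decomp_def)
  show "e \<in> E \<Longrightarrow> u \<in> U \<Longrightarrow> cinner u e = 0" "f \<in> F \<Longrightarrow> v \<in> V \<Longrightarrow> cinner v f = 0"
    using eu cinner_eq_0_commute by blast+
qed

lemma graph_data_maps:
  shows "u \<in> U \<Longrightarrow> g u \<in> V" "v \<in> V \<Longrightarrow> h v \<in> U"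
    "u \<in> U \<Longrightarrow> u \<in> H_half \<Longrightarrow> g u \<in> H_half" "v \<in> V \<Longrightarrow> v \<in> H_half \<Longrightarrow> h v \<in> H_half"
  using gd by (auto simp: graph_data_def)

lemma \<gamma>_F: "f \<in> F \<Longrightarrow> \<gamma> f \<in> spec_space (- J)" and \<gamma>_V: "v \<in> V \<Longrightarrow> \<gamma> v \<in> spec_space (- J)"
  using F V \<gamma>_spec_opp by auto

lemma spec_J_orth: "x \<in> spec_space J \<Longrightarrow> y \<in> spec_space (- J) \<Longrightarrow> cinner x y = 0"
  "x \<in> spec_space J \<Longrightarrow> y \<in> spec_space (- J) \<Longrightarrow> cinner y x = 0"
  by (auto intro: spec_space_orth)

lemma graph_condition_subset: "graph_condition F U g \<subseteq> coeffs ` H_half"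
proof
  fix x assume "x \<in> graph_condition F U g"
  then obtain f u where "f \<in> F" "u \<in> U" "u \<in> H_half" "x = coeffs (\<gamma> f + (u + \<gamma> (g u)))"
    by (rule graph_conditionE)
  then show "x \<in> coeffs ` H_half"
    using F(3) graph_data_maps(3) by (auto intro!: imageI H_half_add \<gamma>_H_half)
qed

lemma graph_condition_in_annihilator:
  "graph_condition E V h \<subseteq> annihilator (graph_condition F U g)"
proof
  fix y assume "y \<in> graph_condition E V h"
  then obtain e v where y: "e \<in> E" "v \<in> V" "v \<in> H_half" "y = coeffs (\<gamma> e + (v + \<gamma> (h v)))"
    by (rule graph_conditionE)
  define b where "b = \<gamma> e + (v + \<gamma> (h v))"
  have bh: "b \<in> H_half" unfolding b_def using y E(3) graph_data_maps(4)
    by (auto intro!: H_half_add \<gamma>_H_half)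
  have gb: "\<gamma> b = \<gamma> v - (e + h v)" by (simp add: b_def \<gamma>_add \<gamma>_inverse)
  have "\<omega> x y = 0" if x: "x \<in> graph_condition F U g" for x
  proof -
    obtain f u where fu: "f \<in> F" "u \<in> U" "u \<in> H_half" "x = coeffs (\<gamma> f + (u + \<gamma> (g u)))"
      using x by (rule graph_conditionE)
    define a where "a = \<gamma> f + (u + \<gamma> (g u))"
    have ah: "a \<in> H_half" unfolding a_def using fu F(3) graph_data_maps(3)
      by (auto intro!: H_half_add \<gamma>_H_half)
    have "e + h v \<in> spec_space J"
      using y E(4) U(2) graph_data_maps(2) by (intro cvec.subspace_add[OF spec_space_csubspace]) auto
    then have z: "cinner (\<gamma> f) (e + h v) = 0" "cinner (\<gamma> (g u)) (e + h v) = 0"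
      using spec_J_orth(2) \<gamma>_F \<gamma>_V graph_data_maps(1) fu by blast+
    have "cinner u (\<gamma> v) = 0" using spec_J_orth(1) fu y U(2) \<gamma>_V by blast
    then have "cinner a (\<gamma> b) = 0"
      using z EU(2)[of e u] FV(1)[of f v] adj[of u v] y fu
      by (simp add: a_def gb cinner_add_left cinner_diff_right cinner_\<gamma>_\<gamma>) (simp add: cinner_add_right)
    then show ?thesis using fu y \<omega>_coeffs[OF ah bh] by (simp add: a_def b_def)
  qed
  then show "y \<in> annihilator (graph_condition F U g)"
    using coeffs_H_check[OF bh] y by (simp add: annihilator_def b_def)
qed

text \<open>An element \<open>y\<close> of the annihilator has a regular part \<open>v\<close> on \<open>opp J\<close>, by definition of the
  hybrid space.  On the complement \<open>y\<close> is only a distribution, but testing it against the eigenvectors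
  \<open>x\<close> with eigenvalue in \<open>J\<close> determines its entries.  Such an \<open>x\<close> splits into a part in \<open>U\<close>, which the
  graph sees, and a part in \<open>E\<close>, on which every functional is represented by an element of \<open>E\<close>.\<close>

lemma annihilator_in_graph_condition:
  "annihilator (graph_condition F U g) \<subseteq> graph_condition E V h"
proof
  fix y assume y: "y \<in> annihilator (graph_condition F U g)"
  have yH: "y \<in> H_check" using y by (simp add: annihilator_def)
  define y1 where "y1 = cut (opp J) y"
  define y2 where "y2 = cut (- opp J) y"
  obtain r where r: "{..-r} \<subseteq> opp J" "opp J \<subseteq> {..r}" using cutoff_opp[OF cut] by (auto simp: cutoff_def)
  have ye: "y t \<in> eigenspace t" for t
    using yH by (simp add: H_check_iff ell2_def eigenspace_scaleR_iff)
  have y2H: "y2 \<in> H_check" unfolding H_check_iff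
    by (rule ell2_compare[OF yH[unfolded H_check_iff]])
      (auto simp: y2_def cut_def eigenspace_scaleR ye)
  have y1h: "y1 \<in> sobolev (1/2)"
  proof -
    have le: "weight t \<le> (weight r)\<^sup>2 * check_weight t" if "t \<in> opp J" for t
    proof (cases "t \<le> 0")
      case True
      have "1 * weight t \<le> (weight r)\<^sup>2 * weight t"
        by (intro mult_right_mono) (auto intro: one_le_power weight_ge_1)
      with True show ?thesis by (simp add: check_weight_def)
    next
      case False
      then have "weight t \<le> weight r" using that r(2) by (intro weight_mono) auto
      then have "weight t * weight t \<le> weight r * weight r" by (intro mult_mono) auto
      with False show ?thesis by (simp add: check_weight_def field_simps power2_eq_square)
    qed
    have "ell2 (\<lambda>t. check_weight t *\<^sub>R y t)" using yH by (simp add: H_check_iff)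
    from ell2_coeffs[of "(weight r)\<^sup>2 *\<^sub>R of_coeffs (\<lambda>t. check_weight t *\<^sub>R y t)"]
    have "ell2 (\<lambda>t. (weight r)\<^sup>2 *\<^sub>R check_weight t *\<^sub>R y t)"
      by (simp add: coeffs_scaleR[abs_def] coeffs_of_coeffs \<open>ell2 (\<lambda>t. check_weight t *\<^sub>R y t)\<close>)
    then have "ell2 (\<lambda>t. weight t *\<^sub>R y1 t)"
      by (rule ell2_compare)
        (use le in \<open>auto simp: y1_def cut_def eigenspace_scaleR ye abs_of_pos
          mult.assoc[symmetric] intro!: mult_right_mono mult_nonneg_nonneg less_imp_le[OF check_weight_pos]\<close>)
    then show ?thesis by (simp add: sobolev_half)
  qed
  then obtain v where v: "v \<in> H_half" "y1 = coeffs v" by (auto simp: sobolev_half_eq)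
  have vJ: "v \<in> spec_space (opp J)" by (auto simp: spec_space_eq v(2)[symmetric] y1_def cut_def)
  have \<omega>_split: "\<omega> (coeffs x) y = cinner x (\<gamma> v) + \<omega> (coeffs x) y2" if "x \<in> H_half" for x
  proof -
    have xH: "coeffs x \<in> H_check" using that by (rule coeffs_H_check)
    have "((\<lambda>t. cinner (coeffs x t) (\<gamma> (coeffs v (- t))) + cinner (coeffs x t) (\<gamma> (y2 (- t))))
        has_sum (\<omega> (coeffs x) (coeffs v) + \<omega> (coeffs x) y2)) UNIV"
      by (intro has_sum_add \<omega>_has_sum xH y2H coeffs_H_check v)
    moreover have "cinner (coeffs x t) (\<gamma> (coeffs v (- t))) + cinner (coeffs x t) (\<gamma> (y2 (- t)))
        = cinner (coeffs x t) (\<gamma> (y (- t)))" for t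
      by (simp add: v(2)[symmetric] y1_def y2_def cut_def)
    ultimately show ?thesis using \<omega>_has_sum[OF xH yH] that v(1)
      by (simp add: has_sum_unique \<omega>_coeffs)
  qed
  have \<omega>2_add: "\<omega> (coeffs (x + x')) y2 = \<omega> (coeffs x) y2 + \<omega> (coeffs x') y2"
    if "x \<in> H_half" "x' \<in> H_half" for x x'
  proof (rule has_sum_unique)
    show "((\<lambda>t. cinner (coeffs (x + x') t) (\<gamma> (y2 (- t)))) has_sum \<omega> (coeffs (x + x')) y2) UNIV"
      using that by (intro \<omega>_has_sum y2H coeffs_H_check H_half_add)
    show "((\<lambda>t. cinner (coeffs (x + x') t) (\<gamma> (y2 (- t)))) has_sum \<omega> (coeffs x) y2 + \<omega> (coeffs x') y2) UNIV"
      unfolding coeffs_add cinner_add_left using that by (intro has_sum_add \<omega>_has_sum y2H coeffs_H_check)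
  qed
  have \<omega>2_scale: "\<omega> (coeffs (c *\<^sub>C x)) y2 = c * \<omega> (coeffs x) y2" if "x \<in> H_half" for x c
  proof (rule has_sum_unique)
    show "((\<lambda>t. cinner (coeffs (c *\<^sub>C x) t) (\<gamma> (y2 (- t)))) has_sum \<omega> (coeffs (c *\<^sub>C x)) y2) UNIV"
      using that by (intro \<omega>_has_sum y2H coeffs_H_check H_half_scaleC)
    show "((\<lambda>t. cinner (coeffs (c *\<^sub>C x) t) (\<gamma> (y2 (- t)))) has_sum c * \<omega> (coeffs x) y2) UNIV"
      unfolding coeffs_scaleC cinner_scaleC_left using that by (intro has_sum_cmult_right \<omega>_has_sum y2H coeffs_H_check)
  qed
  have \<omega>2_zero: "\<omega> (coeffs x) y2 = 0" if "x \<in> H_half" "x \<in> spec_space (- J)" for x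
  proof -
    have "cinner (coeffs x t) (\<gamma> (y2 (- t))) = 0" for t
      using that by (cases "t \<in> J") (auto simp: spec_space_eq y2_def cut_def opp_def)
    then have "((\<lambda>t. cinner (coeffs x t) (\<gamma> (y2 (- t)))) has_sum 0) UNIV" by simp
    with \<omega>_has_sum[OF coeffs_H_check[OF that(1)] y2H] show ?thesis by (rule has_sum_unique)
  qed
  have ann: "\<omega> (coeffs (\<gamma> f + (u + \<gamma> (g u)))) y = 0" if "f \<in> F" "u \<in> U" "u \<in> H_half" for f u
    using y graph_conditionI[OF that] by (auto simp: annihilator_def)
  have vV: "v \<in> V"
  proof -
    obtain f0 v0 where fv: "f0 \<in> F" "v0 \<in> V" "v = f0 + v0"
      using vJ gd by (auto simp: graph_data_def orth_decomp_def)
    have g0: "g 0 = 0"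
    proof -
      have "g ((0::complex) *\<^sub>C 0) = (0::complex) *\<^sub>C g 0"
        using gd U(1) unfolding graph_data_def clinear_on_def by (meson cvec.subspace_0)
      then show ?thesis by simp
    qed
    have fh: "f0 \<in> H_half" using fv F(3) by auto
    have "\<omega> (coeffs (\<gamma> f0)) y = 0"
      using ann[OF fv(1), of 0] U(1) by (simp add: cvec.subspace_0 g0)
    then have "cinner (\<gamma> f0) (\<gamma> v) = 0"
      using \<omega>_split[OF \<gamma>_H_half[OF fh]] \<omega>2_zero[OF \<gamma>_H_half[OF fh] \<gamma>_F[OF fv(1)]] by simp
    then have "cinner f0 f0 = 0" using FV(1)[OF fv(1,2)] by (simp add: cinner_\<gamma>_\<gamma> fv(3) cinner_add_right)
    then show ?thesis using fv by simp
  qed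
  have U_test: "\<omega> (coeffs u) y2 = - cinner u (h v)" if u: "u \<in> U" "u \<in> H_half" for u
  proof -
    have gu: "g u \<in> V" "\<gamma> (g u) \<in> H_half" using u graph_data_maps by (auto intro: \<gamma>_H_half)
    have "cinner u (\<gamma> v) = 0" using spec_J_orth(1) u vV U(2) \<gamma>_V by blast
    then have "0 = cinner (g u) v + \<omega> (coeffs u) y2"
      using ann[of 0 u] F(1) u gu \<omega>_split[of "u + \<gamma> (g u)"] \<omega>2_add[of u "\<gamma> (g u)"] \<omega>2_zero[OF gu(2) \<gamma>_V[OF gu(1)]]
      by (simp add: cvec.subspace_0 H_half_add cinner_add_left cinner_\<gamma>_\<gamma>)
    then show ?thesis using adj[OF u(1) vV] by (simp add: add_eq_0_iff2)
  qed
  obtain S where S: "finite S" "orthonormal S" "cvec.span S = E"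
    using finite_dim_orthonormal_basis[OF E(2)] .
  have SE: "S \<subseteq> E" using S(3) cvec.span_superset by blast
  \<comment> \<open>The element of \<open>E\<close> that represents the functional \<open>e \<mapsto> \<omega> (coeffs e) y2\<close>.\<close>
  define c where "c = (\<Sum>e\<in>S. cnj (\<omega> (coeffs e) y2) *\<^sub>C e)"
  have cE: "c \<in> E" unfolding c_def S(3)[symmetric] by (intro cvec.span_sum cvec.span_scale cvec.span_base)
  have E_test: "\<omega> (coeffs e) y2 = cinner e c" if e: "e \<in> E" for e
  proof -
    have sumh: "(\<Sum>f\<in>T. cinner e f *\<^sub>C f) \<in> H_half \<and>
        \<omega> (coeffs (\<Sum>f\<in>T. cinner e f *\<^sub>C f)) y2 = (\<Sum>f\<in>T. cinner e f * \<omega> (coeffs f) y2)"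
      if "finite T" "T \<subseteq> S" for T
      using that
    proof (induction T rule: finite_induct)
      case empty
      show ?case using \<omega>2_scale[of 0 0] by (simp del: coeffs_zero)
    next
      case (insert f T)
      then have "f \<in> H_half" using SE E(3) by auto
      with insert show ?case by (auto simp: \<omega>2_add \<omega>2_scale H_half_scaleC intro!: H_half_add)
    qed
    have "e = fourier S e" using fourier_eq[OF S(1,2)] e S(3) by simp
    then have "\<omega> (coeffs e) y2 = (\<Sum>f\<in>S. cinner e f * \<omega> (coeffs f) y2)"
      using sumh[OF S(1)] by (simp add: fourier_def)
    then show ?thesis by (simp add: c_def cinner_sum_right cinner_scaleC_right mult.commute)
  qed
  define z where "z = c - h v"
  have hvU: "h v \<in> U" using graph_data_maps vV by blast
  have zJ: "z \<in> spec_space J" unfolding z_def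
    using cE hvU E(4) U(2) by (intro cvec.subspace_diff[OF spec_space_csubspace]) auto
  have entry: "coeffs z t = \<gamma> (y (- t))" if t: "t \<in> J" for t
  proof (rule coeffs_eqI)
    show "\<gamma> (y (- t)) \<in> eigenspace t" using \<gamma>_eigenspace[OF ye, of "- t"] by simp
    fix x assume x: "x \<in> eigenspace t"
    then have xh: "x \<in> H_half" and xJ: "x \<in> spec_space J"
      using t eigenvector_H_half by (auto simp: spec_space_eq coeffs_eigenvector)
    obtain e u where eu: "e \<in> E" "u \<in> U" "x = e + u"
      using xJ gd by (auto simp: graph_data_def orth_decomp_def)
    have eh: "e \<in> H_half" using eu E(3) by blast
    then have uh: "u \<in> H_half" using H_half_diff[OF xh eh] eu by simp
    have "\<omega> (coeffs x) y2 = cinner e c - cinner u (h v)"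
      unfolding eu(3) by (simp add: \<omega>2_add[OF eh uh] E_test[OF eu(1)] U_test[OF eu(2) uh])
    also have "\<dots> = cinner x z"
      using EU(1)[OF eu(1) hvU] EU(2)[OF cE eu(2)] by (simp add: eu(3) z_def cinner_add_left cinner_diff_right)
    finally have 1: "\<omega> (coeffs x) y2 = cinner x z" .
    have "((\<lambda>s. cinner (coeffs x s) (\<gamma> (y2 (- s)))) has_sum cinner x (\<gamma> (y (- t)))) UNIV"
      by (rule has_sum_finite_neutralI[of "{t}"])
        (use x t in \<open>auto simp: coeffs_eigenvector y2_def cut_def opp_def\<close>)
    then have 2: "\<omega> (coeffs x) y2 = cinner x (\<gamma> (y (- t)))"
      using \<omega>_has_sum[OF coeffs_H_check[OF xh] y2H] has_sum_unique by blast
    have "cinner x z = cinner x (\<gamma> (y (- t)))" using 1 2 by simp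
    then show "cinner z x = cinner (\<gamma> (y (- t))) x" by (metis cinner_commute)
  qed
  have "y = coeffs (\<gamma> (- c) + (v + \<gamma> (h v)))"
  proof
    fix t
    have \<gamma>z: "coeffs (\<gamma> (- c) + (v + \<gamma> (h v))) t = coeffs v t - \<gamma> (coeffs z (- t))"
      by (simp add: z_def coeffs_add coeffs_\<gamma> coeffs_diff coeffs_minus \<gamma>_diff \<gamma>_minus)
    show "y t = coeffs (\<gamma> (- c) + (v + \<gamma> (h v))) t"
    proof (cases "t \<in> opp J")
      case True
      then have "coeffs z (- t) = 0" using zJ by (auto simp: spec_space_eq opp_def)
      then show ?thesis using True unfolding \<gamma>z by (simp add: v(2)[symmetric] y1_def cut_def)
    next
      case False
      then have "- t \<in> J" by (simp add: opp_def)
      from entry[OF this] have "coeffs z (- t) = \<gamma> (y t)" by simp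
      moreover have "coeffs v t = 0" using False vJ by (simp add: spec_space_eq)
      ultimately show ?thesis unfolding \<gamma>z by (simp add: \<gamma>_inverse)
    qed
  qed
  moreover have "- c \<in> E" using cvec.subspace_neg[OF E(1) cE] .
  ultimately show "y \<in> graph_condition E V h"
    using graph_conditionI[of "- c" E v V h] vV v(1) by simp
qed

lemma annihilator_graph_condition:
  "annihilator (graph_condition F U g) = graph_condition E V h"
  using graph_condition_in_annihilator annihilator_in_graph_condition by (rule antisym[rotated])

lemma graph_part_inter:
  "\<gamma> ` F \<inter> graph_part U g = {0}"
proof -
  have g0: "g 0 = 0"
  proof -
    have "g ((0::complex) *\<^sub>C 0) = (0::complex) *\<^sub>C g 0"
      using gd U(1) unfolding graph_data_def clinear_on_def by (meson cvec.subspace_0)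
    then show ?thesis by simp
  qed
  have "0 \<in> \<gamma> ` F \<inter> graph_part U g"
    using F(1) U(1) g0 by (auto simp: graph_part_def cvec.subspace_0 intro!: image_eqI[of _ _ 0] exI[of _ 0])
  moreover have "x = 0" if x: "x \<in> \<gamma> ` F" "x \<in> graph_part U g" for x
  proof -
    obtain f u where fu: "f \<in> F" "u \<in> U" "x = \<gamma> f" "x = u + \<gamma> (g u)"
      using x by (auto simp: graph_part_def)
    have "u = \<gamma> f - \<gamma> (g u)" using fu(3,4) by (metis add_diff_cancel_right')
    also have "\<dots> \<in> spec_space (- J)"
      using fu graph_data_maps(1) by (intro cvec.subspace_diff[OF spec_space_csubspace] \<gamma>_F \<gamma>_V)
    finally have "cinner u u = 0" using spec_J_orth(1)[of u u] fu U(2) by auto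
    then show ?thesis using fu(4) g0 by simp
  qed
  ultimately show ?thesis by blast
qed

end

text \<open>Applying the computation of the annihilator twice gives back the original graph, which is
  therefore closed.\<close>

lemma graph_condition_elliptic:
  assumes gd: "graph_data J E U F V g h"
  shows "elliptic (graph_condition F U g)"
proof -
  have 1: "annihilator (graph_condition F U g) = graph_condition E V h"
    by (rule annihilator_graph_condition[OF gd])
  have 2: "annihilator (graph_condition E V h) = graph_condition F U g"
    by (rule annihilator_graph_condition[OF graph_data_swap[OF gd]])
  have s: "graph_condition F U g \<subseteq> coeffs ` H_half" "graph_condition E V h \<subseteq> coeffs ` H_half"
    using graph_condition_subset[OF gd] graph_condition_subset[OF graph_data_swap[OF gd]] by auto
  have "graph_condition E V h \<subseteq> H_check" using s(2) coeffs_H_check by blast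
  then have "boundary_condition (graph_condition F U g)"
    using boundary_condition_annihilator 2 by metis
  then show ?thesis using s by (simp add: elliptic_def regular_def 1 sobolev_half_eq)
qed


section \<open>A priori estimates for regular boundary conditions\<close>

definition vecs :: "(real \<Rightarrow> 'a) set \<Rightarrow> 'a set" where
  "vecs B = {x. coeffs x \<in> B}"

text \<open>For regular \<open>B\<close>, the image of this space under \<open>\<gamma>\<close> consists of the elements of \<open>B\<close> without
  entries in \<open>J\<close>.\<close>

definition defect :: "real set \<Rightarrow> (real \<Rightarrow> 'a) set \<Rightarrow> 'a set" where
  "defect J B = {f \<in> spec_space (opp J). \<gamma> f \<in> vecs B}"

text \<open>This is the closed graph theorem for the inclusion of \<open>B\<close> into \<open>sobolev (1/2)\<close>.  It follows from
  uniform boundedness of the truncations of this inclusion to finite sets of eigenvalues, each of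
  which is continuous for the hybrid norm.\<close>

lemma regular_estimate:
  assumes bc: "boundary_condition B" and reg: "B \<subseteq> sobolev (1/2)"
  shows "\<exists>C. \<forall>x\<in>vecs B. norm (qroot x) \<le> C * norm (of_check (coeffs x))"
proof -
  define M where "M = of_check ` B"
  have BM: "B = to_check ` M" unfolding M_def
    using bc by (intro to_check_of_check_image) (simp add: boundary_condition_def)
  then have M: "cvec.subspace M" "closed M" using bc boundary_condition_iff by auto
  define f where "f T h = (\<Sum>t\<in>T. (weight t / check_weight t) *\<^sub>R coeffs h t)" for T h
  have lin: "bounded_linear (f T)" for T
    unfolding f_def by (intro bounded_linear_sum bounded_linear_const_scaleR coeffs_linear)
  have f_of_check: "f T (of_check (coeffs x)) = (\<Sum>t\<in>T. coeffs (qroot x) t)" if "x \<in> H_half" for x T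
    unfolding f_def by (simp add: coeffs_of_check coeffs_H_check coeffs_qroot that)
  have f_norm: "(norm (f T (of_check (coeffs x))))\<^sup>2 = (\<Sum>t\<in>T. (norm (coeffs (qroot x) t))\<^sup>2)"
    if "x \<in> H_half" "finite T" for x T
    using that by (simp add: f_of_check norm_sum_eigenvectors)
  have ptw: "\<exists>K. \<forall>T\<in>{T. finite T}. norm (f T h) \<le> K" if "h \<in> M" for h
  proof -
    have "to_check h \<in> sobolev (1/2)" using that reg BM by blast
    then obtain x where x: "x \<in> H_half" "to_check h = coeffs x" by (auto simp: sobolev_half_eq)
    then have h: "h = of_check (coeffs x)" by (metis of_check_to_check)
    have "norm (f T h) \<le> norm (qroot x)" if "finite T" for T
    proof (rule power2_le_imp_le)
      show "(norm (f T h))\<^sup>2 \<le> (norm (qroot x))\<^sup>2"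
        unfolding h f_norm[OF x(1) that] by (rule finite_sum_le_has_sum[OF parseval]) (use that in auto)
    qed simp
    then show ?thesis by blast
  qed
  obtain C where C: "\<And>T h. T \<in> {T. finite T} \<Longrightarrow> h \<in> M \<Longrightarrow> norm (f T h) \<le> C * norm h"
    using uniform_boundedness[OF cvec_subspace_imp_subspace[OF M(1)] M(2), of "{T. finite T}" f] lin ptw by blast
  have "norm (qroot x) \<le> C * norm (of_check (coeffs x))" if x: "x \<in> vecs B" for x
  proof (rule power2_le_imp_le)
    have xh: "x \<in> H_half" using x reg by (auto simp: vecs_def H_half_def)
    have hM: "of_check (coeffs x) \<in> M" using x by (auto simp: vecs_def M_def)
    show "(norm (qroot x))\<^sup>2 \<le> (C * norm (of_check (coeffs x)))\<^sup>2"
    proof (rule has_sum_le_finite_sums[OF parseval])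
      fix T :: "real set" assume T: "finite T"
      show "(\<Sum>t\<in>T. (norm (coeffs (qroot x) t))\<^sup>2) \<le> (C * norm (of_check (coeffs x)))\<^sup>2"
        unfolding f_norm[OF xh T, symmetric] using C[OF _ hM] T by (intro power_mono) auto
    qed
    show "0 \<le> C * norm (of_check (coeffs x))" using C[OF _ hM, of "{}"] by (simp add: f_def)
  qed
  then show ?thesis by blast
qed

text \<open>The hybrid weight never exceeds the weight of \<open>sobolev (1/2)\<close>.  Outside \<open>J\<close>, where the
  eigenvalues are bounded below, it is at most a multiple of the weight of \<open>sobolev (-1/2)\<close>.\<close>

lemma norm_of_check_le:
  assumes J: "cutoff J"
  shows "\<exists>c\<ge>0. \<forall>x\<in>H_half.
    norm (of_check (coeffs x)) \<le> c * (norm (qroot (spec_proj J x)) + norm (qroot_inv x))"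
proof -
  obtain r where r: "{..-r} \<subseteq> J" using J by (auto simp: cutoff_def)
  define c where "c = (weight r)\<^sup>2"
  have c1: "1 \<le> c" unfolding c_def by (intro one_le_power weight_ge_1)
  have le: "check_weight t \<le> c * (1 / weight t)" if "t \<notin> J" for t
  proof (cases "t \<le> 0")
    case True
    have "t \<notin> {..-r}" using that r by blast
    then have "weight t \<le> weight r" using True by (intro weight_mono) auto
    then have "weight t * weight t \<le> weight r * weight r" by (intro mult_mono) auto
    with True show ?thesis by (simp add: check_weight_def c_def field_simps power2_eq_square)
  next
    case False
    then show ?thesis using c1 by (simp add: check_weight_def divide_right_mono)
  qed
  have "norm (of_check (coeffs x)) \<le> c * (norm (qroot (spec_proj J x)) + norm (qroot_inv x))"
    if x: "x \<in> H_half" for x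
  proof -
    define k where "k = of_check (coeffs x)"
    have ck: "coeffs k t = check_weight t *\<^sub>R coeffs x t" for t
      by (simp add: k_def coeffs_of_check coeffs_H_check x)
    have "norm (spec_proj J k) \<le> norm (qroot (spec_proj J x))"
      by (rule norm_le_coeffwise)
        (simp add: coeffs_spec_proj cut_def ck coeffs_qroot spec_proj_H_half x abs_of_pos mult_right_mono check_weight_le_weight)
    also have "\<dots> \<le> c * norm (qroot (spec_proj J x))" using mult_right_mono[OF c1] by simp
    finally have 1: "norm (spec_proj J k) \<le> c * norm (qroot (spec_proj J x))" .
    have "norm (spec_proj (- J) k) \<le> norm (c *\<^sub>R qroot_inv x)"
    proof (rule norm_le_coeffwise)
      fix t
      show "norm (coeffs (spec_proj (- J) k) t) \<le> norm (coeffs (c *\<^sub>R qroot_inv x) t)"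
      proof (cases "t \<in> J")
        case False
        then have "check_weight t * norm (coeffs x t) \<le> (c * (1 / weight t)) * norm (coeffs x t)"
          by (intro mult_right_mono le) auto
        with False c1 show ?thesis
          by (simp add: coeffs_spec_proj cut_def ck coeffs_scaleR coeffs_qroot_inv abs_of_pos)
      qed (simp add: coeffs_spec_proj cut_def)
    qed
    then have 2: "norm (spec_proj (- J) k) \<le> c * norm (qroot_inv x)" using c1 by simp
    have "norm k \<le> norm (spec_proj J k) + norm (spec_proj (- J) k)"
      by (metis norm_triangle_ineq spec_proj_split)
    with 1 2 show ?thesis by (simp add: k_def distrib_left)
  qed
  then show ?thesis using c1 by (intro exI[of _ c]) simp
qed

lemma spec_proj_\<gamma>_opp: "f \<in> spec_space (opp J) \<Longrightarrow> spec_proj J (\<gamma> f) = 0"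
  by (rule spec_proj_zero_disjoint[OF \<gamma>_spec_opp]) auto

context
  fixes B :: "(real \<Rightarrow> 'a) set"
  assumes bc: "boundary_condition B" and reg: "B \<subseteq> sobolev (1/2)"
begin

lemma vecs_H_half: "x \<in> vecs B \<Longrightarrow> x \<in> H_half"
  using reg by (auto simp: vecs_def H_half_def)

lemma vecs_csubspace: "cvec.subspace (vecs B)"
proof -
  have "(\<lambda>t. x t + y t) \<in> B" if "x \<in> B" "y \<in> B" for x y
    using bc that by (simp add: boundary_condition_def)
  moreover have "(\<lambda>t. c *\<^sub>C x t) \<in> B" if "x \<in> B" for x c
    using bc that by (simp add: boundary_condition_def)
  moreover have "(\<lambda>t. 0) \<in> B" using bc by (simp add: boundary_condition_def)
  moreover have "coeffs 0 = (\<lambda>t. 0)" by (simp add: fun_eq_iff)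
  moreover have "coeffs (x + y) = (\<lambda>t. coeffs x t + coeffs y t)"
    "coeffs (c *\<^sub>C x) = (\<lambda>t. c *\<^sub>C coeffs x t)" for x y c
    by (simp_all add: fun_eq_iff coeffs_add coeffs_scaleC)
  ultimately show ?thesis by (simp add: cvec.subspace_def vecs_def)
qed

lemma coeffs_vecs: "B = coeffs ` vecs B"
  using reg by (auto simp: vecs_def sobolev_half_eq)

text \<open>Convergence in \<open>sobolev (1/2)\<close> implies convergence in the hybrid space, where \<open>B\<close> is closed.\<close>

lemma vecs_limit:
  assumes b: "\<And>n. b n \<in> vecs B" and lim: "(\<lambda>n::nat. qroot (b n)) \<longlonglongrightarrow> k"
  shows "qroot_inv k \<in> vecs B"
proof -
  have "\<exists>a\<in>B. check_norm (\<lambda>t. coeffs (qroot_inv k) t - a t) < e" if e: "e > 0" for e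
  proof -
    obtain n where "\<forall>m\<ge>n. norm (qroot (b m) - k) < e"
      using LIMSEQ_D[OF lim e] by blast
    then have n: "norm (qroot (b n) - k) < e" by simp
    define d where "d = qroot_inv k - b n"
    have d: "d \<in> H_half" unfolding d_def by (simp add: H_half_diff vecs_H_half b)
    have "check_norm (coeffs d) = norm (of_check (coeffs d))"
      by (rule check_norm_eq[OF coeffs_H_check[OF d]])
    also have "\<dots> \<le> norm (qroot d)" by (rule norm_of_check_le_qroot[OF d])
    also have "qroot d = k - qroot (b n)" unfolding d_def by (simp add: qroot_diff vecs_H_half b)
    also have "norm (k - qroot (b n)) < e" using n by (simp add: norm_minus_commute)
    finally have "check_norm (\<lambda>t. coeffs (qroot_inv k) t - coeffs (b n) t) < e"
      by (simp add: d_def coeffs_diff[abs_def])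
    then show ?thesis using b[of n] by (auto simp: vecs_def)
  qed
  moreover have "coeffs (qroot_inv k) \<in> H_check" by (simp add: coeffs_H_check)
  ultimately show ?thesis using bc by (simp add: boundary_condition_def vecs_def)
qed

lemma defect_csubspace: "cvec.subspace (defect J B)"
  using vecs_csubspace spec_space_csubspace[of "opp J"]
  by (auto simp: cvec.subspace_def defect_def \<gamma>_add \<gamma>_scaleC)

lemma defect_H_half: "f \<in> defect J B \<Longrightarrow> f \<in> H_half"
  using vecs_H_half[of "\<gamma> f"] by (simp add: defect_def \<gamma>_H_half_iff)

lemma \<gamma>_defectI:
  assumes "b \<in> vecs B" "spec_proj J b = 0"
  shows "\<exists>f\<in>defect J B. b = \<gamma> f"
proof -
  have "b \<in> spec_space (- J)" using spec_proj_split[of J b] assms(2) spec_proj_in[of "- J" b] by simp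
  then have "\<gamma> b \<in> spec_space (opp J)" by (rule \<gamma>_spec_compl)
  then have "- \<gamma> b \<in> spec_space (opp J)" using cvec.subspace_neg[OF spec_space_csubspace] by blast
  then have "- \<gamma> b \<in> defect J B" using assms(1) by (simp add: defect_def \<gamma>_minus \<gamma>_inverse)
  then show ?thesis by (intro bexI[of _ "- \<gamma> b"]) (simp_all add: \<gamma>_minus \<gamma>_inverse)
qed

context
  fixes J :: "real set"
  assumes J: "cutoff J"
begin

lemma vecs_estimate:
  "\<exists>C\<ge>0. \<forall>b\<in>vecs B. norm (qroot b) \<le> C * (norm (qroot (spec_proj J b)) + norm (qroot_inv b))"
proof -
  obtain C1 where C1: "\<And>x. x \<in> vecs B \<Longrightarrow> norm (qroot x) \<le> C1 * norm (of_check (coeffs x))"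
    using regular_estimate[OF bc reg] by blast
  obtain c where c: "c \<ge> 0" "\<And>x. x \<in> H_half \<Longrightarrow>
    norm (of_check (coeffs x)) \<le> c * (norm (qroot (spec_proj J x)) + norm (qroot_inv x))"
    using norm_of_check_le[OF J] by blast
  have "norm (qroot b) \<le> (\<bar>C1\<bar> * c) * (norm (qroot (spec_proj J b)) + norm (qroot_inv b))"
    if b: "b \<in> vecs B" for b
  proof -
    have "norm (qroot b) \<le> \<bar>C1\<bar> * norm (of_check (coeffs b))"
      using C1[OF b] by (rule order_trans) (simp add: mult_right_mono)
    also have "\<dots> \<le> \<bar>C1\<bar> * (c * (norm (qroot (spec_proj J b)) + norm (qroot_inv b)))"
      by (intro mult_left_mono c vecs_H_half b) simp
    finally show ?thesis by (simp add: mult.assoc)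
  qed
  then show ?thesis using c(1) by (intro exI[of _ "\<bar>C1\<bar> * c"]) simp
qed

text \<open>The term \<open>qroot_inv b\<close> of the estimate is compact relative to \<open>qroot b\<close>, since it arises from it
  by the inverse square root of \<open>I + A\<^sup>2\<close>.\<close>

lemma vecs_compact:
  fixes b :: "nat \<Rightarrow> 'a"
  assumes b: "\<And>n. b n \<in> vecs B" and bound: "\<And>n. norm (qroot (b n)) \<le> K"
    and cauchy: "Cauchy (\<lambda>n. qroot (spec_proj J (b n)))"
  obtains r :: "nat \<Rightarrow> nat" where "strict_mono r" "Cauchy (\<lambda>n. qroot (b (r n)))"
proof -
  obtain C where C: "C \<ge> 0"
    "\<And>b. b \<in> vecs B \<Longrightarrow> norm (qroot b) \<le> C * (norm (qroot (spec_proj J b)) + norm (qroot_inv b))"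
    using vecs_estimate by blast
  obtain r :: "nat \<Rightarrow> nat" where r: "strict_mono r" "Cauchy (\<lambda>n. qroot_inv (qroot_inv (qroot (b (r n)))))"
    using qroot_inv_compact[of "\<lambda>n. qroot (b n)", OF bound] .
  then have c2: "Cauchy (\<lambda>n. qroot_inv (b (r n)))" using b vecs_H_half by simp
  have c1: "Cauchy (\<lambda>n. qroot (spec_proj J (b (r n))))"
    using Cauchy_subseq_Cauchy[OF cauchy r(1)] by (simp add: o_def)
  have "Cauchy (\<lambda>n. qroot (b (r n)))"
  proof (rule CauchyI)
    fix e :: real assume "e > 0"
    define d where "d = e / (2 * (C + 1))"
    have d: "d > 0" using \<open>e > 0\<close> C(1) by (simp add: d_def)
    obtain M1 where M1: "\<forall>m\<ge>M1. \<forall>n\<ge>M1. norm (qroot (spec_proj J (b (r m))) - qroot (spec_proj J (b (r n)))) < d"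
      using CauchyD[OF c1 d] by blast
    obtain M2 where M2: "\<forall>m\<ge>M2. \<forall>n\<ge>M2. norm (qroot_inv (b (r m)) - qroot_inv (b (r n))) < d"
      using CauchyD[OF c2 d] by blast
    have "norm (qroot (b (r m)) - qroot (b (r n))) < e" if "m \<ge> max M1 M2" "n \<ge> max M1 M2" for m n
    proof -
      define x where "x = b (r m) - b (r n)"
      have x: "x \<in> vecs B" unfolding x_def by (intro cvec.subspace_diff[OF vecs_csubspace] b)
      have est: "norm (qroot x) \<le> C * (norm (qroot (spec_proj J x)) + norm (qroot_inv x))" by (rule C(2)[OF x])
      have "norm (qroot (spec_proj J x)) < d" using M1 that b unfolding x_def
        by (simp add: spec_proj_diff qroot_diff spec_proj_H_half vecs_H_half)
      moreover have "norm (qroot_inv x) < d" using M2 that unfolding x_def by (simp add: qroot_inv_diff)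
      ultimately have "norm (qroot (spec_proj J x)) + norm (qroot_inv x) \<le> d + d" by simp
      then have "C * (norm (qroot (spec_proj J x)) + norm (qroot_inv x)) \<le> C * (d + d)"
        using C(1) by (rule mult_left_mono)
      with est have "norm (qroot x) \<le> C * (d + d)" by linarith
      also have "\<dots> < (C + 1) * (d + d)" using d by simp
      also have "\<dots> = d * (2 * (C + 1))" by (simp add: algebra_simps)
      also have "\<dots> = e" using C(1) by (simp add: d_def)
      finally show ?thesis unfolding x_def by (simp add: qroot_diff vecs_H_half b)
    qed
    then show "\<exists>M. \<forall>m\<ge>M. \<forall>n\<ge>M. norm (qroot (b (r m)) - qroot (b (r n))) < e" by blast
  qed
  with r(1) that show ?thesis by blast
qed

text \<open>On \<open>\<gamma> F\<close>, with \<open>F\<close> the defect space, only the compact term of the estimate is present.\<close>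

lemma defect_finite_dim: "finite_dim (defect J B)"
proof (rule compact_imp_finite_dim[OF defect_csubspace])
  fix s :: "nat \<Rightarrow> 'a" assume s: "\<And>n. s n \<in> defect J B \<and> norm (s n) \<le> 1"
  obtain C where C: "C \<ge> 0"
    "\<And>b. b \<in> vecs B \<Longrightarrow> norm (qroot b) \<le> C * (norm (qroot (spec_proj J b)) + norm (qroot_inv b))"
    using vecs_estimate by blast
  have b: "\<gamma> (s n) \<in> vecs B" for n using s by (simp add: defect_def)
  have z: "spec_proj J (\<gamma> (s n)) = 0" for n using s by (simp add: defect_def spec_proj_\<gamma>_opp)
  have q0: "qroot 0 = 0" using norm_le_qroot[of 0] qroot_diff[of 0 0] by simp
  have "norm (qroot (\<gamma> (s n))) \<le> C * 1" for n
  proof -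
    have "norm (qroot (\<gamma> (s n))) \<le> C * norm (qroot_inv (\<gamma> (s n)))" using C(2)[OF b, of n] by (simp add: z q0)
    also have "\<dots> \<le> C * 1" using norm_qroot_inv_le[of "\<gamma> (s n)"] s[of n] C(1) by (intro mult_left_mono) auto
    finally show ?thesis .
  qed
  then obtain r :: "nat \<Rightarrow> nat" where r: "strict_mono r" "Cauchy (\<lambda>n. qroot (\<gamma> (s (r n))))"
    using vecs_compact[of "\<lambda>n. \<gamma> (s n)" "C * 1"] b by (auto simp: z q0 Cauchy_def)
  have "norm (s m - s n) \<le> norm (qroot (\<gamma> (s m)) - qroot (\<gamma> (s n)))" for m n
  proof -
    have "norm (s m - s n) = norm (\<gamma> (s m) - \<gamma> (s n))" by (simp flip: \<gamma>_diff)
    also have "\<dots> \<le> norm (qroot (\<gamma> (s m) - \<gamma> (s n)))" by (intro norm_le_qroot H_half_diff vecs_H_half b)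
    finally show ?thesis by (simp add: qroot_diff vecs_H_half b)
  qed
  then have "Cauchy (s \<circ> r)" using r(2) unfolding Cauchy_iff o_def by (meson order_le_less_trans)
  with r(1) show "\<exists>r. strict_mono r \<and> Cauchy (s \<circ> r)" by blast
qed

text \<open>Were there no such constant, a normalised sequence of counterexamples would converge to a
  unit vector of \<open>B\<close> without entries in \<open>J\<close> and orthogonal to the defect space that contains it.\<close>

lemma vecs_coercive:
  "\<exists>C\<ge>0. \<forall>b\<in>vecs B. (\<forall>f\<in>defect J B. cinner b (\<gamma> f) = 0) \<longrightarrow>
    norm (qroot b) \<le> C * norm (qroot (spec_proj J b))"
proof -
  define P where "P b \<longleftrightarrow> b \<in> vecs B \<and> (\<forall>f\<in>defect J B. cinner b (\<gamma> f) = 0)" for b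
  have "\<exists>n. \<forall>b. P b \<longrightarrow> norm (qroot b) \<le> real (Suc n) * norm (qroot (spec_proj J b))"
  proof (rule ccontr)
    assume "\<not> ?thesis"
    then have "\<forall>n. \<exists>b. P b \<and> real (Suc n) * norm (qroot (spec_proj J b)) < norm (qroot b)"
      by (simp add: not_le)
    then obtain a where a: "\<And>n. P (a n)" "\<And>n. real (Suc n) * norm (qroot (spec_proj J (a n))) < norm (qroot (a n))"
      by metis
    have pos: "norm (qroot (a n)) > 0" for n
      using a(2)[of n] by (rule le_less_trans[rotated]) simp
    define b where "b n = of_real (1 / norm (qroot (a n))) *\<^sub>C a n" for n
    have ah: "a n \<in> H_half" for n using a(1) by (simp add: P_def vecs_H_half)
    have Pb: "P (b n)" for n using a(1)[of n] vecs_csubspace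
      by (auto simp: P_def b_def cvec.subspace_scale cinner_scaleC_left)
    have bB: "b n \<in> vecs B" for n using Pb by (simp add: P_def)
    have nb: "norm (qroot (b n)) = 1" for n using pos[of n]
      by (simp add: b_def qroot_scaleC ah norm_scaleC norm_divide)
    have "norm (qroot (spec_proj J (b n))) \<le> 1 / real (Suc n)" for n
      using a(2)[of n] pos[of n]
      by (simp add: b_def spec_proj_scaleC qroot_scaleC spec_proj_H_half ah norm_scaleC norm_divide field_simps)
    then have ev: "\<forall>\<^sub>F n in sequentially. norm (qroot (spec_proj J (b n))) \<le> 1 / real (Suc n)"
      by (intro always_eventually allI)
    have inv0: "(\<lambda>n. 1 / real (Suc n)) \<longlonglongrightarrow> 0"
      using LIMSEQ_inverse_real_of_nat by (simp add: inverse_eq_divide)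
    have lim0: "(\<lambda>n. qroot (spec_proj J (b n))) \<longlonglongrightarrow> 0"
      by (rule Lim_null_comparison[OF ev inv0])
    obtain r :: "nat \<Rightarrow> nat" where r: "strict_mono r" "Cauchy (\<lambda>n. qroot (b (r n)))"
      using vecs_compact[of b 1] bB nb LIMSEQ_imp_Cauchy[OF lim0] by auto
    then obtain k where k: "(\<lambda>n. qroot (b (r n))) \<longlonglongrightarrow> k" using Cauchy_convergent_iff convergent_def by blast
    have "(\<lambda>n. norm (qroot (b (r n)))) \<longlonglongrightarrow> norm k" by (intro tendsto_norm k)
    then have nk: "norm k = 1" by (simp add: nb LIMSEQ_const_iff)
    define l where "l = qroot_inv k"
    have lB: "l \<in> vecs B" unfolding l_def by (rule vecs_limit[OF bB k])
    have "spec_proj J k = 0"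
    proof (rule LIMSEQ_unique)
      show "(\<lambda>n. spec_proj J (qroot (b (r n)))) \<longlonglongrightarrow> spec_proj J k"
        by (rule bounded_linear.tendsto[OF spec_proj_linear k])
      show "(\<lambda>n. spec_proj J (qroot (b (r n)))) \<longlonglongrightarrow> 0"
        using LIMSEQ_subseq_LIMSEQ[OF lim0 r(1)] by (simp add: o_def qroot_spec_proj vecs_H_half bB)
    qed
    then have "qroot (spec_proj J l) = 0" by (simp add: l_def qroot_spec_proj)
    then have "spec_proj J l = 0"
      using norm_le_qroot[of "spec_proj J l"] spec_proj_H_half[of l J] by (simp add: l_def)
    then obtain f where f: "f \<in> defect J B" "l = \<gamma> f" using \<gamma>_defectI[OF lB] by blast
    have "(\<lambda>n. b (r n)) \<longlonglongrightarrow> l"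
      using bounded_linear.tendsto[OF qroot_inv_linear k] by (simp add: l_def vecs_H_half bB)
    then have "(\<lambda>n. cinner (b (r n)) (\<gamma> f)) \<longlonglongrightarrow> cinner l (\<gamma> f)" by (intro tendsto_cinner tendsto_const)
    moreover have "cinner (b (r n)) (\<gamma> f) = 0" for n using Pb f(1) by (simp add: P_def)
    ultimately have "cinner l (\<gamma> f) = 0" by (simp add: LIMSEQ_const_iff)
    then have "l = 0" using f(2) by simp
    then have "k = 0" using qroot_qroot_inv[of k] qroot_diff[of 0 0] by (simp add: l_def)
    with nk show False by simp
  qed
  then obtain n where n: "\<And>b. P b \<Longrightarrow> norm (qroot b) \<le> real (Suc n) * norm (qroot (spec_proj J b))" by blast
  then show ?thesis by (intro exI[of _ "real (Suc n)"]) (auto simp: P_def)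
qed

text \<open>Subtracting the component in \<open>\<gamma> F\<close>, with \<open>F\<close> the defect space, changes no entry in \<open>J\<close>.\<close>

lemma vecs_reduce:
  assumes b: "b \<in> vecs B"
  shows "\<exists>b'\<in>vecs B. spec_proj J b' = spec_proj J b \<and> (\<forall>f\<in>defect J B. cinner b' (\<gamma> f) = 0)"
proof -
  obtain S where S: "finite S" "orthonormal S" "cvec.span S = defect J B"
    using finite_dim_orthonormal_basis[OF defect_finite_dim] .
  define p where "p = fourier S (- \<gamma> b)"
  have p: "p \<in> defect J B" unfolding p_def S(3)[symmetric] by (rule fourier_in_span)
  show ?thesis
  proof (intro bexI[of _ "b - \<gamma> p"] conjI ballI)
    show "b - \<gamma> p \<in> vecs B" using b p by (intro cvec.subspace_diff[OF vecs_csubspace]) (auto simp: defect_def)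
    show "spec_proj J (b - \<gamma> p) = spec_proj J b"
      using p by (simp add: spec_proj_diff spec_proj_\<gamma>_opp defect_def)
    show "cinner (b - \<gamma> p) (\<gamma> f) = 0" if f: "f \<in> defect J B" for f
      using fourier_orth[OF S(1,2), of f "- \<gamma> b"] f S(3)
      by (simp add: cinner_diff_left cinner_\<gamma>_\<gamma> p_def) (simp add: cinner_\<gamma>_right)
  qed
qed

end

end

text \<open>The range of \<open>B\<close> on \<open>J\<close> is closed by coercivity, so what is missing is detected by a vector
  \<open>p\<close> orthogonal to it in \<open>sobolev (1/2)\<close>.  The functional given by \<open>p\<close> is an element of the annihilator
  of \<open>B\<close>; since the annihilator is regular, it comes from the defect space of the annihilator.\<close>

lemma elliptic_range:
  fixes B :: "(real \<Rightarrow> 'a) set" and J :: "real set"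
  assumes J: "cutoff J" and bc: "boundary_condition B" and reg: "B \<subseteq> sobolev (1/2)"
    and reg': "annihilator B \<subseteq> sobolev (1/2)"
    and u: "u \<in> H_half" "u \<in> spec_space J"
    and orth: "\<And>e. e \<in> defect (opp J) (annihilator B) \<Longrightarrow> cinner u e = 0"
  obtains b where "b \<in> vecs B" "spec_proj J b = u"
proof -
  note vh = vecs_H_half[OF bc reg]
  define N where "N = (\<lambda>b. qroot (spec_proj J b)) ` vecs B"
  have N: "cvec.subspace N"
  proof -
    have sub: "cvec.subspace (vecs B)" by (rule vecs_csubspace[OF bc reg])
    have lin: "qroot (spec_proj J (a + b)) = qroot (spec_proj J a) + qroot (spec_proj J b)"
      "qroot (spec_proj J (c *\<^sub>C a)) = c *\<^sub>C qroot (spec_proj J a)" if "a \<in> vecs B" "b \<in> vecs B" for a b c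
      using that by (simp_all add: spec_proj_add spec_proj_scaleC qroot_add qroot_scaleC spec_proj_H_half vh)
    have 0: "0 \<in> vecs B" using sub by (rule cvec.subspace_0)
    have "0 \<in> N" using lin(2)[OF 0 0, of 0] 0 unfolding N_def by (intro image_eqI[of _ _ 0]) simp_all
    moreover have "x + y \<in> N" if xy: "x \<in> N" "y \<in> N" for x y
    proof -
      obtain a b where "a \<in> vecs B" "b \<in> vecs B" "x = qroot (spec_proj J a)" "y = qroot (spec_proj J b)"
        using xy by (auto simp: N_def)
      then show ?thesis unfolding N_def using cvec.subspace_add[OF sub] lin(1)
        by (intro image_eqI[of _ _ "a + b"]) auto
    qed
    moreover have "c *\<^sub>C x \<in> N" if x: "x \<in> N" for x c
    proof -
      obtain a where "a \<in> vecs B" "x = qroot (spec_proj J a)" using x by (auto simp: N_def)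
      then show ?thesis unfolding N_def using cvec.subspace_scale[OF sub] lin(2)
        by (intro image_eqI[of _ _ "c *\<^sub>C a"]) auto
    qed
    ultimately show ?thesis by (simp add: cvec.subspace_def)
  qed
  have "closed N" unfolding closed_sequential_limits
  proof (intro allI impI, elim conjE)
    fix x l assume x: "\<forall>n. x n \<in> N" and l: "x \<longlonglongrightarrow> l"
    have "\<exists>b. b \<in> vecs B \<and> (\<forall>f\<in>defect J B. cinner b (\<gamma> f) = 0) \<and> x n = qroot (spec_proj J b)" for n
    proof -
      obtain a where a: "a \<in> vecs B" "x n = qroot (spec_proj J a)" using x by (auto simp: N_def)
      obtain b where "b \<in> vecs B" "spec_proj J b = spec_proj J a"
        "\<And>f. f \<in> defect J B \<Longrightarrow> cinner b (\<gamma> f) = 0"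
        using vecs_reduce[OF bc reg J a(1)] by blast
      then show ?thesis using a(2) by auto
    qed
    then obtain b where b: "\<And>n. b n \<in> vecs B" "\<And>n f. f \<in> defect J B \<Longrightarrow> cinner (b n) (\<gamma> f) = 0"
      "\<And>n. x n = qroot (spec_proj J (b n))" by metis
    obtain C where C: "C \<ge> 0" "\<And>b. b \<in> vecs B \<Longrightarrow> (\<And>f. f \<in> defect J B \<Longrightarrow> cinner b (\<gamma> f) = 0) \<Longrightarrow>
      norm (qroot b) \<le> C * norm (qroot (spec_proj J b))"
      using vecs_coercive[OF bc reg J] by blast
    have diff: "norm (qroot (b m) - qroot (b n)) \<le> C * norm (x m - x n)" for m n
    proof -
      have "b m - b n \<in> vecs B" by (intro cvec.subspace_diff[OF vecs_csubspace[OF bc reg]] b)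
      from C(2)[OF this] show ?thesis
        by (simp add: b cinner_diff_left spec_proj_diff qroot_diff spec_proj_H_half vh)
    qed
    have "Cauchy (\<lambda>n. qroot (b n))"
    proof (rule CauchyI)
      fix e :: real assume e: "e > 0"
      obtain M where M: "\<forall>m\<ge>M. \<forall>n\<ge>M. norm (x m - x n) < e / (C + 1)"
        using CauchyD[OF LIMSEQ_imp_Cauchy[OF l], of "e / (C + 1)"] e C(1) by auto
      have "norm (qroot (b m) - qroot (b n)) < e" if "m \<ge> M" "n \<ge> M" for m n
      proof -
        have "norm (x m - x n) \<le> e / (C + 1)" using M that by (simp add: less_imp_le)
        then have "C * norm (x m - x n) \<le> C * (e / (C + 1))" using C(1) by (rule mult_left_mono)
        with diff have "norm (qroot (b m) - qroot (b n)) \<le> C * (e / (C + 1))" by (rule order_trans)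
        also have "\<dots> < e" using e C(1) by (simp add: field_simps)
        finally show ?thesis .
      qed
      then show "\<exists>M. \<forall>m\<ge>M. \<forall>n\<ge>M. norm (qroot (b m) - qroot (b n)) < e" by blast
    qed
    then obtain k where k: "(\<lambda>n. qroot (b n)) \<longlonglongrightarrow> k" using Cauchy_convergent_iff convergent_def by blast
    have kB: "qroot_inv k \<in> vecs B" by (rule vecs_limit[OF bc reg b(1) k])
    have "(\<lambda>n. spec_proj J (qroot (b n))) \<longlonglongrightarrow> spec_proj J k" by (rule bounded_linear.tendsto[OF spec_proj_linear k])
    then have "x \<longlonglongrightarrow> spec_proj J k" by (simp add: b(3)[abs_def] qroot_spec_proj vh b(1))
    then have "l = qroot (spec_proj J (qroot_inv k))" using LIMSEQ_unique[OF l] by (simp add: qroot_spec_proj)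
    then show "l \<in> N" using kB by (simp add: N_def)
  qed
  then obtain m where m: "m \<in> N" "\<And>z. z \<in> N \<Longrightarrow> cinner (qroot u - m) z = 0"
    using orth_projection_exists[OF N] by blast
  obtain b where b: "b \<in> vecs B" "m = qroot (spec_proj J b)" using m(1) by (auto simp: N_def)
  define p where "p = qroot u - m"
  have "p = spec_proj J (qroot (u - b))"
    using u b by (simp add: p_def qroot_diff vh spec_proj_diff flip: qroot_spec_proj) (simp add: spec_proj_id)
  then have pJ: "p \<in> spec_space J" by simp
  obtain r where r: "J \<subseteq> {..r}" using J by (auto simp: cutoff_def)
  \<comment> \<open>Up to sign, \<open>\<omega> (coeffs b) y\<close> is \<open>cinner (qroot b) p\<close>.\<close>
  define y where "y t = weight t *\<^sub>R coeffs (\<gamma> p) t" for t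
  have yH: "y \<in> H_check"
  proof -
    have le: "check_weight t * weight t \<le> (weight r)\<^sup>2" if "- t \<in> J" for t
    proof (cases "t \<le> 0")
      case True
      then have "weight t \<le> weight r" using that r by (intro weight_mono) auto
      then have "weight t * weight t \<le> weight r * weight r" by (intro mult_mono) auto
      with True show ?thesis by (simp add: check_weight_def power2_eq_square)
    qed (simp add: check_weight_def one_le_power weight_ge_1)
    show ?thesis unfolding H_check_iff
    proof (rule ell2_compare[OF ell2_coeffs[of "(weight r)\<^sup>2 *\<^sub>R \<gamma> p"]])
      fix t
      show "check_weight t *\<^sub>R y t \<in> eigenspace t" by (simp add: y_def eigenspace_scaleR)
      show "norm (check_weight t *\<^sub>R y t) \<le> norm (coeffs ((weight r)\<^sup>2 *\<^sub>R \<gamma> p) t)"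
      proof (cases "- t \<in> J")
        case True
        then have "(check_weight t * weight t) * norm (coeffs (\<gamma> p) t) \<le> (weight r)\<^sup>2 * norm (coeffs (\<gamma> p) t)"
          by (intro mult_right_mono le) auto
        then show ?thesis by (simp add: y_def coeffs_scaleR abs_of_pos)
      next
        case False
        then show ?thesis using pJ by (simp add: y_def coeffs_\<gamma> spec_space_eq)
      qed
    qed
  qed
  have "\<omega> x y = 0" if x: "x \<in> B" for x
  proof -
    obtain a where a: "a \<in> vecs B" "x = coeffs a" using x coeffs_vecs[OF bc reg] by blast
    have "cinner (coeffs a t) (\<gamma> (y (- t))) = - cinner (coeffs (qroot a) t) (coeffs p t)" for t
      by (simp add: y_def coeffs_\<gamma> \<gamma>_scaleR \<gamma>_inverse coeffs_qroot vh a cinner_scaleR_left cinner_scaleR_right)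
    then have "((\<lambda>t. cinner (coeffs a t) (\<gamma> (y (- t)))) has_sum - cinner (qroot a) p) UNIV"
      by (simp add: has_sum_uminusI parseval_cinner)
    then have "\<omega> x y = - cinner (qroot a) p"
      using \<omega>_has_sum[OF coeffs_H_check[OF vh[OF a(1)]] yH] a(2) by (simp add: has_sum_unique)
    also have "cinner (qroot a) p = cinner (qroot (spec_proj J a)) p"
      using cinner_spec_proj[OF pJ, of "qroot a"] by (simp add: qroot_spec_proj vh a)
    also have "\<dots> = 0"
      using m(2)[of "qroot (spec_proj J a)"] a(1) by (subst cinner_eq_0_commute) (simp add: N_def p_def)
    finally show ?thesis by simp
  qed
  then have yA: "y \<in> annihilator B" using yH by (simp add: annihilator_def)
  then obtain y0 where y0: "y = coeffs y0" using reg' by (auto simp: sobolev_half_eq)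
  define e where "e = - \<gamma> y0"
  have ce: "coeffs e t = weight t *\<^sub>R coeffs p t" for t
    by (simp add: e_def coeffs_minus coeffs_\<gamma> flip: y0) (simp add: y_def coeffs_\<gamma> \<gamma>_scaleR \<gamma>_inverse)
  have "e \<in> spec_space J" using pJ by (simp add: spec_space_eq ce)
  moreover have "\<gamma> e = y0" by (simp add: e_def \<gamma>_minus \<gamma>_inverse)
  ultimately have "e \<in> defect (opp J) (annihilator B)" using yA y0 by (simp add: defect_def vecs_def)
  then have ue: "cinner u e = 0" by (rule orth)
  have pe: "p = qroot_inv e" by (rule coeffs_inject) (simp add: coeffs_qroot_inv ce)
  have "cinner (qroot u) p = 0" using ue u(1) by (simp add: pe flip: cinner_qroot_inv)
  moreover have "cinner p m = 0" using m by (simp add: p_def)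
  then have "cinner m p = 0" by (simp add: cinner_eq_0_commute)
  ultimately have "cinner p p = 0" by (simp add: p_def[of] cinner_diff_left)
  then have "qroot (spec_proj J b) = qroot u" using b(2) by (simp add: p_def)
  then have "spec_proj J b = u" using qroot_inv_qroot u(1) spec_proj_H_half[OF vh[OF b(1)]] by metis
  with b(1) that show ?thesis by blast
qed


section \<open>Elliptic boundary conditions as graphs\<close>

definition spec_compl :: "real set \<Rightarrow> 'a set \<Rightarrow> 'a set" where
  "spec_compl J E = {u \<in> spec_space J. \<forall>e\<in>E. cinner u e = 0}"

lemma spec_compl_csubspace: "cvec.subspace (spec_compl J E)"
  using spec_space_csubspace[of J]
  by (auto simp: cvec.subspace_def spec_compl_def cinner_add_left cinner_scaleC_left)

lemma spec_compl_closed: "closed (spec_compl J E)"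
proof -
  have "spec_compl J E = spec_space J \<inter> (\<Inter>e\<in>E. {u. cinner u e = 0})" by (auto simp: spec_compl_def)
  moreover have "continuous_on UNIV (\<lambda>u. cinner u e)" for e :: 'a
    by (intro linear_continuous_on bounded_bilinear.bounded_linear_left[OF bounded_bilinear_cinner])
  ultimately show ?thesis
    using spec_space_closed[of J] by (auto intro!: closed_Int closed_INT closed_Collect_eq)
qed

context
  fixes J :: "real set" and E :: "'a set"
  assumes E: "finite_dim E" "E \<subseteq> spec_space J" "E \<subseteq> H_half"
begin

lemma spec_compl_decomp:
  assumes "x \<in> spec_space J"
  shows "\<exists>e\<in>E. x - e \<in> spec_compl J E"
proof -
  obtain S where S: "finite S" "orthonormal S" "cvec.span S = E"
    using finite_dim_orthonormal_basis[OF E(1)] .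
  have e: "fourier S x \<in> E" using fourier_in_span S(3) by blast
  have "cinner (x - fourier S x) z = 0" if "z \<in> E" for z
    using fourier_orth[OF S(1,2)] that S(3) by blast
  moreover have "x - fourier S x \<in> spec_space J"
    using assms e E(2) by (intro cvec.subspace_diff[OF spec_space_csubspace]) auto
  ultimately show ?thesis using e by (auto simp: spec_compl_def)
qed

lemma orth_decomp_spec_compl: "orth_decomp (spec_space J) E (spec_compl J E)"
proof -
  have "cinner e u = 0" if "e \<in> E" "u \<in> spec_compl J E" for e u
    using that cinner_eq_0_commute[of e u] by (simp add: spec_compl_def)
  moreover have "spec_space J = {e + u | e u. e \<in> E \<and> u \<in> spec_compl J E}"
  proof (intro antisym subsetI)
    fix x assume "x \<in> spec_space J"
    then obtain e where "e \<in> E" "x - e \<in> spec_compl J E" using spec_compl_decomp by blast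
    then show "x \<in> {e + u | e u. e \<in> E \<and> u \<in> spec_compl J E}"
      by (intro CollectI exI[of _ e] exI[of _ "x - e"]) simp
  next
    fix x assume "x \<in> {e + u | e u. e \<in> E \<and> u \<in> spec_compl J E}"
    then show "x \<in> spec_space J"
      using E(2) by (auto simp: spec_compl_def intro!: cvec.subspace_add[OF spec_space_csubspace])
  qed
  ultimately show ?thesis
    using finite_dim_subspace[OF E(1)] spec_compl_csubspace by (simp add: orth_decomp_def)
qed

text \<open>Eigenvectors, corrected by their components in \<open>E\<close>, are regular and already suffice
  for testing.\<close>

lemma spec_compl_test:
  assumes d: "d \<in> spec_compl J E" and orth: "\<And>v. v \<in> spec_compl J E \<inter> H_half \<Longrightarrow> cinner d v = 0"
  shows "d = 0"
proof (rule orth_eigenspaces_imp_zero)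
  fix t x assume x: "x \<in> eigenspace t"
  have dJ: "d \<in> spec_space J" using d by (simp add: spec_compl_def)
  have "cinner d x = 0"
  proof (cases "t \<in> J")
    case True
    then have "x \<in> spec_space J" using x by (auto simp: spec_space_eq coeffs_eigenvector)
    then obtain e where e: "e \<in> E" "x - e \<in> spec_compl J E" using spec_compl_decomp by blast
    have "x - e \<in> H_half" using eigenvector_H_half[OF x] e(1) E(3) by (auto intro: H_half_diff)
    then have "cinner d (x - e) = 0" using orth e(2) by blast
    moreover have "cinner d e = 0" using d e(1) by (simp add: spec_compl_def)
    ultimately show ?thesis by (simp add: cinner_diff_right)
  next
    case False
    then have "coeffs d t = 0" using dJ by (simp add: spec_space_eq)
    then show ?thesis using cinner_coeffs[OF x, of d] by simp
  qed
  then show "inner d x = 0" by (rule cinner_0_imp_inner_0)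
qed

lemma spec_compl_dense:
  assumes u: "u \<in> spec_compl J E"
  shows "\<exists>s. (\<forall>n::nat. s n \<in> spec_compl J E \<inter> H_half) \<and> s \<longlonglongrightarrow> u"
proof -
  define N where "N = spec_compl J E \<inter> H_half"
  have N: "cvec.subspace N" unfolding N_def by (intro cvec.subspace_inter spec_compl_csubspace H_half_csubspace)
  obtain p where p: "p \<in> closure N" "\<And>z. z \<in> closure N \<Longrightarrow> cinner (u - p) z = 0"
    using orth_projection_exists[OF closure_csubspace[OF N], of u] by auto
  have "closure N \<subseteq> spec_compl J E"
    by (intro closure_minimal spec_compl_closed) (simp add: N_def)
  then have "u - p \<in> spec_compl J E" using u p(1) by (intro cvec.subspace_diff[OF spec_compl_csubspace]) auto
  moreover have "cinner (u - p) v = 0" if "v \<in> spec_compl J E \<inter> H_half" for v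
    using p(2) closure_subset[of N] that by (auto simp: N_def)
  ultimately have "u - p = 0" by (rule spec_compl_test)
  then show ?thesis using p(1) by (simp add: closure_sequential N_def)
qed

end

lemma spec_proj_sum_\<gamma>:
  assumes "u \<in> spec_space J" "v \<in> spec_space (opp J)"
  shows "spec_proj J (u + \<gamma> v) = u" "spec_proj (- J) (u + \<gamma> v) = \<gamma> v"
proof -
  have "\<gamma> v \<in> spec_space (- J)" using assms(2) by (rule \<gamma>_spec_opp)
  then show "spec_proj J (u + \<gamma> v) = u" "spec_proj (- J) (u + \<gamma> v) = \<gamma> v"
    using assms(1) spec_proj_zero_disjoint[of "\<gamma> v" "- J" J] spec_proj_zero_disjoint[of u J "- J"]
    by (simp_all add: spec_proj_add spec_proj_id)
qed

text \<open>Coercivity applies to \<open>u + \<gamma> v\<close>, because \<open>u\<close> has no entries outside \<open>J\<close> and \<open>v\<close> is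
  orthogonal to the defect space.\<close>

lemma regular_graph_bound:
  assumes J: "cutoff J" and bc: "boundary_condition B" and reg: "B \<subseteq> sobolev (1/2)"
  shows "\<exists>C\<ge>0. \<forall>u\<in>spec_space J \<inter> H_half. \<forall>v\<in>spec_compl (opp J) (defect J B) \<inter> H_half.
    u + \<gamma> v \<in> vecs B \<longrightarrow> norm (qroot v) \<le> C * norm (qroot u)"
proof -
  obtain C where C: "C \<ge> 0" "\<And>b. b \<in> vecs B \<Longrightarrow> (\<And>f. f \<in> defect J B \<Longrightarrow> cinner b (\<gamma> f) = 0) \<Longrightarrow>
      norm (qroot b) \<le> C * norm (qroot (spec_proj J b))"
    using vecs_coercive[OF bc reg J] by blast
  have "norm (qroot v) \<le> C * norm (qroot u)" if u: "u \<in> spec_space J \<inter> H_half" and v: "v \<in> spec_compl (opp J) (defect J B) \<inter> H_half"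
    and b: "u + \<gamma> v \<in> vecs B" for u v
  proof -
    have sp: "u \<in> spec_space J" "v \<in> spec_space (opp J)" using u v by (auto simp: spec_compl_def)
    have h: "u \<in> H_half" "v \<in> H_half" using u v by auto
    have "cinner (u + \<gamma> v) (\<gamma> f) = 0" if f: "f \<in> defect J B" for f
    proof -
      have "\<gamma> f \<in> spec_space (- J)" using f by (intro \<gamma>_spec_opp) (simp add: defect_def)
      then have "cinner u (\<gamma> f) = 0" using sp(1) by (intro spec_space_orth[of _ J _ "- J"]) auto
      moreover have "cinner v f = 0" using v f by (simp add: spec_compl_def)
      ultimately show ?thesis by (simp add: cinner_add_left cinner_\<gamma>_\<gamma>)
    qed
    from C(2)[OF b this] have le: "norm (qroot (u + \<gamma> v)) \<le> C * norm (qroot u)"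
      by (simp add: spec_proj_sum_\<gamma>[OF sp])
    have "norm (qroot v) = norm (qroot (\<gamma> v))" by (simp add: qroot_\<gamma> h)
    also have "qroot (\<gamma> v) = qroot (spec_proj (- J) (u + \<gamma> v))" by (simp add: spec_proj_sum_\<gamma>[OF sp])
    also have "\<dots> = spec_proj (- J) (qroot (u + \<gamma> v))" using h by (intro qroot_spec_proj H_half_add \<gamma>_H_half)
    also have "norm \<dots> \<le> norm (qroot (u + \<gamma> v))" by (rule norm_spec_proj_le)
    finally show ?thesis using le by simp
  qed
  then show ?thesis using C(1) by blast
qed

text \<open>Here \<open>E\<close> and \<open>F\<close> are the finite-dimensional spaces of the theorem, and \<open>U1\<close> and \<open>V1\<close> are the
  regular parts of \<open>U\<close> and \<open>V\<close>.  Modulo \<open>\<gamma> F\<close>, the boundary condition \<open>B\<close> is the graph of a map from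
  \<open>U1\<close> to \<open>V1\<close>, whose values are unique by \<open>regular_graph_bound\<close>.\<close>

context
  fixes B :: "(real \<Rightarrow> 'a) set" and J :: "real set"
  assumes J: "cutoff J" and bc: "boundary_condition B" and reg: "B \<subseteq> sobolev (1/2)"
    and reg': "annihilator B \<subseteq> sobolev (1/2)"
begin

private abbreviation (input) "E \<equiv> defect (opp J) (annihilator B)"
private abbreviation (input) "F \<equiv> defect J B"
private abbreviation (input) "U1 \<equiv> spec_compl J E \<inter> H_half"
private abbreviation (input) "V1 \<equiv> spec_compl (opp J) F \<inter> H_half"

lemma elliptic_graph_exists:
  assumes u: "u \<in> U1"
  shows "\<exists>v\<in>V1. u + \<gamma> v \<in> vecs B"
proof -
  have u': "u \<in> H_half" "u \<in> spec_space J" "\<And>e. e \<in> E \<Longrightarrow> cinner u e = 0"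
    using u by (auto simp: spec_compl_def)
  obtain b0 where b0: "b0 \<in> vecs B" "spec_proj J b0 = u"
    using elliptic_range[OF J bc reg reg' u'] by blast
  obtain b where b: "b \<in> vecs B" "spec_proj J b = u" "\<And>f. f \<in> F \<Longrightarrow> cinner b (\<gamma> f) = 0"
    using vecs_reduce[OF bc reg J b0(1)] b0(2) by auto
  define v where "v = - \<gamma> (spec_proj (- J) b)"
  have \<gamma>v: "\<gamma> v = spec_proj (- J) b" by (simp add: v_def \<gamma>_minus \<gamma>_inverse)
  have bv: "u + \<gamma> v = b" using spec_proj_split[of J b] by (simp add: \<gamma>v b(2))
  have "\<gamma> (spec_proj (- J) b) \<in> spec_space (opp J)" by (intro \<gamma>_spec_compl) simp
  then have "v \<in> spec_space (opp J)" unfolding v_def by (rule cvec.subspace_neg[OF spec_space_csubspace])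
  moreover have "cinner v f = 0" if f: "f \<in> F" for f
  proof -
    have "\<gamma> f \<in> spec_space (- J)" using f by (intro \<gamma>_spec_opp) (simp add: defect_def)
    then have "cinner (spec_proj (- J) b) (\<gamma> f) = 0" using b(3)[OF f] by (simp add: cinner_spec_proj)
    then show ?thesis by (simp add: cinner_\<gamma>_\<gamma> flip: \<gamma>v)
  qed
  moreover have "v \<in> H_half"
    using spec_proj_H_half[OF vecs_H_half[OF bc reg b(1)], of "- J"] by (simp add: \<gamma>_H_half_iff flip: \<gamma>v)
  ultimately show ?thesis using b(1) bv by (intro bexI[of _ v]) (auto simp: spec_compl_def)
qed

lemma vecs_annihilator_orth:
  assumes "b \<in> vecs B" "a \<in> vecs (annihilator B)"
  shows "cinner b (\<gamma> a) = 0"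
proof -
  have h: "b \<in> H_half" "a \<in> H_half" using assms reg reg' by (auto simp: vecs_def H_half_def)
  have "\<omega> (coeffs b) (coeffs a) = 0" using assms by (simp add: vecs_def annihilator_def)
  then show ?thesis by (simp add: \<omega>_coeffs h)
qed

lemma elliptic_vecs_split:
  assumes b: "b \<in> vecs B"
  shows "\<exists>f\<in>F. \<exists>u\<in>U1. \<exists>v\<in>V1. u + \<gamma> v \<in> vecs B \<and> b = \<gamma> f + (u + \<gamma> v)"
proof -
  define u where "u = spec_proj J b"
  have "cinner u e = 0" if e: "e \<in> E" for e
  proof -
    have "cinner b (\<gamma> (\<gamma> e)) = 0" using e by (intro vecs_annihilator_orth[OF b]) (simp add: defect_def)
    moreover have "e \<in> spec_space J" using e by (simp add: defect_def)
    ultimately show ?thesis by (simp add: u_def cinner_spec_proj \<gamma>_inverse)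
  qed
  then have uU: "u \<in> U1"
    using spec_proj_H_half[OF vecs_H_half[OF bc reg b]] by (simp add: spec_compl_def u_def)
  then obtain v where v: "v \<in> V1" "u + \<gamma> v \<in> vecs B" using elliptic_graph_exists by blast
  have "b - (u + \<gamma> v) \<in> vecs B" using b v(2) by (intro cvec.subspace_diff[OF vecs_csubspace[OF bc reg]])
  moreover have "spec_proj J (b - (u + \<gamma> v)) = 0"
    using uU v(1) by (simp add: spec_proj_diff spec_proj_sum_\<gamma> spec_compl_def flip: u_def)
  ultimately obtain f where "f \<in> F" "b - (u + \<gamma> v) = \<gamma> f" using \<gamma>_defectI[OF bc reg] by blast
  then show ?thesis using uU v by (metis diff_add_cancel)
qed

end

text \<open>The maps \<open>g0\<close> and \<open>h0\<close> belonging to \<open>B\<close> and to its annihilator are adjoint to each other for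
  the inner product of \<open>H\<close>, because \<open>\<omega>\<close> vanishes.  Hence \<open>h0 \<circ> g0\<close> is symmetric for this
  inner product and bounded on \<open>sobolev (1/2)\<close>, which makes \<open>g0\<close> bounded on \<open>H\<close>.\<close>

lemma elliptic_is_graph_condition:
  assumes J: "cutoff J" and ell: "elliptic B"
  shows "\<exists>E U F V g. orth_decomp (spec_space J) E U \<and> finite_dim E \<and> E \<subseteq> H_half \<and>
     orth_decomp (spec_space (opp J)) F V \<and> finite_dim F \<and> F \<subseteq> H_half \<and>
     half_smooth U V g \<and> B = graph_condition F U g"
proof -
  define B' where "B' = annihilator B"
  have bc: "boundary_condition B" and reg: "B \<subseteq> sobolev (1/2)" and reg': "annihilator B \<subseteq> sobolev (1/2)"
    using ell by (auto simp: elliptic_def regular_def)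
  have bc2: "boundary_condition B'" unfolding B'_def
    using bc by (intro boundary_condition_annihilator) (simp add: boundary_condition_def)
  have ann2: "annihilator B' = B" unfolding B'_def by (rule biannihilator[OF bc])
  have reg2: "B' \<subseteq> sobolev (1/2)" "annihilator B' \<subseteq> sobolev (1/2)" using reg reg' by (simp_all add: B'_def[symmetric] ann2)
  have J2: "cutoff (opp J)" using J by (rule cutoff_opp)
  define E where "E = defect (opp J) B'"
  define F where "F = defect J B"
  define U where "U = spec_compl J E"
  define V where "V = spec_compl (opp J) F"
  have E: "finite_dim E" "E \<subseteq> H_half" "E \<subseteq> spec_space J"
    using defect_finite_dim[OF bc2 reg2(1) J2] defect_H_half[OF bc2 reg2(1), of _ "opp J"] by (auto simp: E_def defect_def)
  have F: "finite_dim F" "F \<subseteq> H_half" "F \<subseteq> spec_space (opp J)"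
    using defect_finite_dim[OF bc reg J] defect_H_half[OF bc reg, of _ J] by (auto simp: F_def defect_def)
  have ex1: "\<exists>v\<in>V \<inter> H_half. u + \<gamma> v \<in> vecs B" if "u \<in> U \<inter> H_half" for u
    using elliptic_graph_exists[OF J bc reg reg'] that by (simp add: U_def V_def E_def F_def B'_def)
  have ex2: "\<exists>u\<in>U \<inter> H_half. v + \<gamma> u \<in> vecs B'" if "v \<in> V \<inter> H_half" for v
    using elliptic_graph_exists[OF J2 bc2 reg2] that by (simp add: U_def V_def E_def F_def ann2)
  obtain g0 where g0: "\<And>u. u \<in> U \<inter> H_half \<Longrightarrow> g0 u \<in> V \<inter> H_half"
    "\<And>u. u \<in> U \<inter> H_half \<Longrightarrow> u + \<gamma> (g0 u) \<in> vecs B"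
    using bchoice[of "U \<inter> H_half" "\<lambda>u v. v \<in> V \<inter> H_half \<and> u + \<gamma> v \<in> vecs B"] ex1 by blast
  obtain h0 where h0: "\<And>v. v \<in> V \<inter> H_half \<Longrightarrow> h0 v \<in> U \<inter> H_half"
    "\<And>v. v \<in> V \<inter> H_half \<Longrightarrow> v + \<gamma> (h0 v) \<in> vecs B'"
    using bchoice[of "V \<inter> H_half" "\<lambda>v u. u \<in> U \<inter> H_half \<and> v + \<gamma> u \<in> vecs B'"] ex2 by blast
  obtain C1 where C1: "C1 \<ge> 0" "\<And>u v. u \<in> U \<inter> H_half \<Longrightarrow> v \<in> V \<inter> H_half \<Longrightarrow> u + \<gamma> v \<in> vecs B \<Longrightarrow>
      norm (qroot v) \<le> C1 * norm (qroot u)"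
    using regular_graph_bound[OF J bc reg] by (fastforce simp: U_def V_def F_def spec_compl_def)
  obtain C2 where C2: "C2 \<ge> 0" "\<And>u v. u \<in> U \<inter> H_half \<Longrightarrow> v \<in> V \<inter> H_half \<Longrightarrow> v + \<gamma> u \<in> vecs B' \<Longrightarrow>
      norm (qroot u) \<le> C2 * norm (qroot v)"
    using regular_graph_bound[OF J2 bc2 reg2(1)] by (fastforce simp: U_def V_def E_def spec_compl_def)
  have q0: "qroot 0 = 0" using qroot_diff[of 0 0] by simp
  have uniq: "v = g0 u" if u: "u \<in> U \<inter> H_half" and v: "v \<in> V \<inter> H_half" and b: "u + \<gamma> v \<in> vecs B" for u v
  proof -
    have V1: "cvec.subspace (V \<inter> H_half)" unfolding V_def by (intro cvec.subspace_inter spec_compl_csubspace H_half_csubspace)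
    have 0: "0 \<in> U \<inter> H_half" unfolding U_def using cvec.subspace_0[OF spec_compl_csubspace] by simp
    have "(u + \<gamma> v) - (u + \<gamma> (g0 u)) \<in> vecs B"
      by (intro cvec.subspace_diff[OF vecs_csubspace[OF bc reg]] b g0 u)
    then have "0 + \<gamma> (v - g0 u) \<in> vecs B" by (simp add: \<gamma>_diff)
    from C1(2)[OF 0 cvec.subspace_diff[OF V1 v g0(1)[OF u]] this]
    have "qroot (v - g0 u) = 0" by (simp add: q0)
    then show ?thesis using norm_le_qroot[of "v - g0 u"] v g0(1)[OF u] by (simp add: H_half_diff)
  qed
  have adj: "cinner (g0 u) v = cinner u (h0 v)" if u: "u \<in> U \<inter> H_half" and v: "v \<in> V \<inter> H_half" for u v
  proof -
    have "h0 v \<in> spec_space J" "g0 u \<in> spec_space (opp J)" "u \<in> spec_space J" "v \<in> spec_space (opp J)"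
      using g0(1)[OF u] h0(1)[OF v] u v by (auto simp: U_def V_def spec_compl_def)
    then have "cinner u (\<gamma> v) = 0" "cinner (\<gamma> (g0 u)) (h0 v) = 0"
      using spec_space_orth[of u J "\<gamma> v" "- J"] spec_space_orth[of "\<gamma> (g0 u)" "- J" "h0 v" J] \<gamma>_spec_opp by auto
    moreover have "cinner (u + \<gamma> (g0 u)) (\<gamma> (v + \<gamma> (h0 v))) = 0"
      using vecs_annihilator_orth[OF J bc reg reg'] g0(2)[OF u] h0(2)[OF v] by (simp add: B'_def)
    ultimately show ?thesis
      by (simp add: \<gamma>_add \<gamma>_inverse cinner_add_left cinner_diff_right cinner_\<gamma>_\<gamma>)
  qed
  \<comment> \<open>The maximum with 1 makes \<open>sqrt R \<le> R\<close>, where \<open>sqrt R\<close> is the bound that the argument gives.\<close>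
  define R where "R = max 1 (C2 * C1)"
  have R: "R \<ge> 1" "C2 * C1 \<le> R" by (auto simp: R_def)
  have bound: "norm (g0 u) \<le> R * norm u" if u: "u \<in> U \<inter> H_half" for u
  proof -
    define T where "T = (\<lambda>x. h0 (g0 x))"
    have inv: "T x \<in> U \<inter> H_half" if "x \<in> U \<inter> H_half" for x
      using that g0(1) h0(1) by (simp add: T_def)
    have sym: "inner (T x) y = inner x (T y)" if x: "x \<in> U \<inter> H_half" and y: "y \<in> U \<inter> H_half" for x y
    proof -
      have "cinner (T x) y = cnj (cinner y (T x))" by (rule cinner_commute)
      also have "cinner y (T x) = cinner (g0 y) (g0 x)" using adj[OF y g0(1)[OF x]] by (simp add: T_def)
      also have "cnj \<dots> = cinner (g0 x) (g0 y)" by (rule cinner_commute[symmetric])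
      also have "\<dots> = cinner x (T y)" using adj[OF x g0(1)[OF y]] by (simp add: T_def)
      finally show ?thesis by (simp add: inner_eq_Re_cinner)
    qed
    have TR: "norm (qroot (T x)) \<le> R * norm (qroot x)" if x: "x \<in> U \<inter> H_half" for x
    proof -
      have "norm (qroot (T x)) \<le> C2 * norm (qroot (g0 x))"
        unfolding T_def by (intro C2 h0 g0 x)
      also have "\<dots> \<le> C2 * (C1 * norm (qroot x))" by (intro mult_left_mono C1 g0 x C2)
      also have "\<dots> = (C2 * C1) * norm (qroot x)" by simp
      also have "\<dots> \<le> R * norm (qroot x)" by (intro mult_right_mono R) simp
      finally show ?thesis .
    qed
    have pow: "(T ^^ n) u \<in> U \<inter> H_half \<and> norm (qroot ((T ^^ n) u)) \<le> norm (qroot u) * R ^ n" for n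
    proof (induction n)
      case (Suc n)
      have "norm (qroot (T ((T ^^ n) u))) \<le> R * norm (qroot ((T ^^ n) u))" using Suc by (intro TR) simp
      also have "\<dots> \<le> R * (norm (qroot u) * R ^ n)" using Suc R(1) by (intro mult_left_mono) auto
      finally show ?case using inv Suc by (simp add: mult_ac)
    qed (use u in simp)
    have "norm ((T ^^ n) u) \<le> norm (qroot u) * R ^ n" for n
      using pow[of n] norm_le_qroot[of "(T ^^ n) u"] by auto
    from symmetric_orbit_bound[of "U \<inter> H_half" T, OF inv sym this u]
    have T: "norm (T u) \<le> R * norm u" using R(1) by simp
    have "(norm (g0 u))\<^sup>2 = inner u (T u)"
      using adj[OF u g0(1)[OF u]] by (simp add: power2_norm_eq_inner inner_eq_Re_cinner T_def)
    also have "\<dots> \<le> norm u * norm (T u)" by (rule norm_cauchy_schwarz)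
    also have "\<dots> \<le> norm u * (R * norm u)" by (intro mult_left_mono T) simp
    also have "\<dots> \<le> R * (norm u * (R * norm u))" using mult_right_mono[OF R(1), of "norm u * (R * norm u)"] R by simp
    also have "\<dots> = (R * norm u)\<^sup>2" by (simp add: power2_eq_square)
    finally show ?thesis using R(1) by (intro power2_le_imp_le[of "norm (g0 u)"]) auto
  qed
  have U_sub: "cvec.subspace U" "closed U" and V_sub: "cvec.subspace V" "closed V"
    by (auto simp: U_def V_def spec_compl_csubspace spec_compl_closed)
  have "\<exists>g. bounded_clinear_between U V g \<and> (\<forall>u\<in>U \<inter> H_half. g u = g0 u) \<and>
      (\<forall>u\<in>U. \<forall>v\<in>V \<inter> H_half. cinner (g u) v = cinner u (h0 v))"
  proof (rule bounded_extension[OF U_sub(1) V_sub])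
    show "\<exists>s. (\<forall>n. s n \<in> U \<inter> H_half) \<and> s \<longlonglongrightarrow> u" if "u \<in> U" for u
      using spec_compl_dense[OF E(1,3,2)] that by (simp add: U_def)
    show "d = 0" if "d \<in> V" "\<And>v. v \<in> V \<inter> H_half \<Longrightarrow> cinner d v = 0" for d
      using spec_compl_test[OF F(1,3,2)] that by (simp add: V_def)
    show "cvec.subspace (U \<inter> H_half)" by (intro cvec.subspace_inter U_sub H_half_csubspace)
  qed (use g0(1) bound adj in auto)
  then obtain g where g: "bounded_clinear_between U V g" "\<And>u. u \<in> U \<inter> H_half \<Longrightarrow> g u = g0 u"
    "\<And>u v. u \<in> U \<Longrightarrow> v \<in> V \<inter> H_half \<Longrightarrow> cinner (g u) v = cinner u (h0 v)" by blast
  have "adjoint_between U g v = h0 v" if "v \<in> V \<inter> H_half" for v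
    using h0(1)[OF that] g(3) that by (intro adjoint_betweenI U_sub) auto
  then have smooth: "half_smooth U V g"
    using U_sub V_sub g(1,2) g0(1) h0(1) by (auto simp: half_smooth_def)
  have "B = graph_condition F U g"
  proof (intro antisym subsetI)
    fix x assume "x \<in> B"
    then obtain b where b: "b \<in> vecs B" "x = coeffs b" using coeffs_vecs[OF bc reg] by blast
    then obtain f u v where fuv: "f \<in> F" "u \<in> U \<inter> H_half" "v \<in> V \<inter> H_half" "u + \<gamma> v \<in> vecs B"
        "b = \<gamma> f + (u + \<gamma> v)"
      using elliptic_vecs_split[OF J bc reg reg' b(1)] unfolding U_def V_def E_def F_def B'_def by blast
    then have "v = g u" using uniq g(2) by simp
    then show "x \<in> graph_condition F U g" using fuv b(2) graph_conditionI[of f F u U g] by simp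
  next
    fix x assume "x \<in> graph_condition F U g"
    then obtain f u where fu: "f \<in> F" "u \<in> U" "u \<in> H_half" "x = coeffs (\<gamma> f + (u + \<gamma> (g u)))"
      by (rule graph_conditionE)
    have "\<gamma> f \<in> vecs B" using fu(1) by (simp add: F_def defect_def)
    moreover have "u + \<gamma> (g u) \<in> vecs B" using g0(2) g(2) fu by simp
    ultimately have "\<gamma> f + (u + \<gamma> (g u)) \<in> vecs B" by (rule cvec.subspace_add[OF vecs_csubspace[OF bc reg]])
    then show "x \<in> B" using fu(4) by (simp add: vecs_def)
  qed
  moreover have "orth_decomp (spec_space J) E U" "orth_decomp (spec_space (opp J)) F V"
    unfolding U_def V_def by (intro orth_decomp_spec_compl E F)+
  ultimately show ?thesis using E F smooth by blast
qed

section \<open>The classification\<close>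

lemma subset_spec_proj_image:
  "E \<subseteq> spec_space J \<Longrightarrow> E \<subseteq> spec_proj J ` H_half \<longleftrightarrow> E \<subseteq> H_half"
  using spec_proj_H_half by (auto simp: image_iff subset_iff) (metis spec_proj_id)

lemma orth_decomp_subset: "orth_decomp M E U \<Longrightarrow> E \<subseteq> M"
proof
  fix e assume "orth_decomp M E U" "e \<in> E"
  then have "0 \<in> U" "M = {e + u | e u. e \<in> E \<and> u \<in> U}" by (auto simp: orth_decomp_def cvec.subspace_0)
  with \<open>e \<in> E\<close> have "e + 0 \<in> M" by blast
  then show "e \<in> M" by simp
qed

lemma boundary_data_iff:
  "boundary_data \<Lambda> E U F V g \<longleftrightarrow>
     orth_decomp (spec_space {..\<Lambda>}) E U \<and> finite_dim E \<and> E \<subseteq> H_half \<and>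
     orth_decomp (spec_space (opp {..\<Lambda>})) F V \<and> finite_dim F \<and> F \<subseteq> H_half \<and> half_smooth U V g"
  unfolding boundary_data_def opp_atMost
  using orth_decomp_subset subset_spec_proj_image by metis

lemma boundary_data_imp_graph_data:
  assumes "boundary_data \<Lambda> E U F V g"
  shows "graph_data {..\<Lambda>} E U F V g (adjoint_between U g)"
proof -
  have hs: "half_smooth U V g" using assms by (simp add: boundary_data_iff)
  then have U: "cvec.subspace U" "closed U" and g: "bounded_clinear_between U V g" by (auto simp: half_smooth_def)
  note adj = adjoint_between_props[OF U g]
  have "clinear_on V (adjoint_between U g)" unfolding clinear_on_def
    using adj U(1)
    by (auto intro!: adjoint_betweenI simp: cvec.subspace_add cvec.subspace_scale cinner_add_right cinner_scaleC_right)
  then show ?thesis using assms hs g adj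
    by (auto simp: boundary_data_iff graph_data_def cutoff_atMost half_smooth_def bounded_clinear_between_def)
qed

end

theorem proposition1p65:
  fixes D :: "'a::chilbert_space set" and A \<gamma> :: "'a \<Rightarrow> 'a" and \<Lambda> :: real
  assumes "dirac_system D A \<gamma>"
  shows "(\<forall>E U F V g. dirac_system.boundary_data D A \<Lambda> E U F V g \<longrightarrow>
            \<gamma> ` F \<inter> dirac_system.graph_part D A \<gamma> U g = {0} \<and>
            dirac_system.elliptic D A \<gamma> (dirac_system.graph_condition D A \<gamma> F U g) \<and>
            \<gamma> ` E \<inter> dirac_system.graph_part D A \<gamma> V (adjoint_between U g) = {0} \<and>
            dirac_system.annihilator D A \<gamma> (dirac_system.graph_condition D A \<gamma> F U g)
              = dirac_system.graph_condition D A \<gamma> E V (adjoint_between U g))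
       \<and> (\<forall>B. dirac_system.elliptic D A \<gamma> B \<longrightarrow>
            (\<exists>E U F V g. dirac_system.boundary_data D A \<Lambda> E U F V g \<and>
               B = dirac_system.graph_condition D A \<gamma> F U g))"
proof -
  interpret dirac_system D A \<gamma> by (rule assms)
  have "\<gamma> ` F \<inter> graph_part U g = {0} \<and> elliptic (graph_condition F U g) \<and>
      \<gamma> ` E \<inter> graph_part V (adjoint_between U g) = {0} \<and>
      annihilator (graph_condition F U g) = graph_condition E V (adjoint_between U g)"
    if "boundary_data \<Lambda> E U F V g" for E U F V g
  proof -
    have gd: "graph_data {..\<Lambda>} E U F V g (adjoint_between U g)"
      using that by (rule boundary_data_imp_graph_data)
    show ?thesis
      using graph_part_inter[OF gd] graph_condition_elliptic[OF gd]
        graph_part_inter[OF graph_data_swap[OF gd]] annihilator_graph_condition[OF gd] by blast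
  qed
  moreover have "\<exists>E U F V g. boundary_data \<Lambda> E U F V g \<and> B = graph_condition F U g" if "elliptic B" for B
    using elliptic_is_graph_condition[OF cutoff_atMost that, of \<Lambda>] unfolding boundary_data_iff by blast
  ultimately show ?thesis by blast
qed

end
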